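(* Let $A$ be a separable semiprime operator algebra. Then $\text{h-soc}(A)$ is a $\sigma$-matricial algebra.
   Context: An operator algebra is a norm closed subalgebra of $B(H)$ for a Hilbert space $H$ (not necessarily unital); $A^{**}$ is an operator algebra with the Arens product. $A$ is semiprime if $J^2=(0)$ implies $J=(0)$ for closed two-sided ideals $J$. Projections are orthogonal projections; a projection $e\in A$ is algebraically minimal if $eAe=\mathbb{C}e$. The r-socle $\text{r-soc}(A)$ is the closure of the sum of the right ideals $eA$ over all algebraically minimal projections $e\in A$. It is a right ideal with a left contractive approximate identity, and this left approximate identity converges weak* to a projection $f\in A^{**}$ (the support projection of $\text{r-soc}(A)$), which is the join (supremum) of all algebraically minimal projections of $A$; thus $\text{r-soc}(A)=fA^{**}\cap A$. One defines $\text{h-soc}(A)=fA^{**}f\cap A$. A $1$-matricial algebra is an operator algebra having a set of (nonzero) matrix units $\{T_{ij}\}$, $T_{ij}T_{kl}=\delta_{jk}T_{il}$, with dense span, such that each $q_k=T_{kk}$ has norm $1$ (i.e. is an orthogonal projection). In the separable case, up to completely isometric isomorphism these are the algebras given by a finite or infinite sequence $T_1=I,T_2,\dots$ of invertible operators on a Hilbert space $K$, as the closed span in $B(K\oplus^2K\oplus^2\cdots)$ of $T_{ij}=E_{ij}\otimes T_i^{-1}T_j$. A $\sigma$-matricial algebra is (up to completely isometric isomorphism) a finite or countable, possibly empty, $c_0$-direct sum of (separable) $1$-matricial algebras. *)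

theory Defs
  imports "HOL-Analysis.Analysis"
begin

section \<open>Complex Hilbert spaces and their bounded operators\<close>

text \<open>The inner product is linear in the first argument. The norm of the class is the Hilbert space
  norm, because \<open>inner x x = Re (cinner x x)\<close> and \<open>cinner x x\<close> is real.\<close>

class complex_hilbert = real_inner + complete_space +
  fixes scaleC :: "complex \<Rightarrow> 'a \<Rightarrow> 'a" (infixr \<open>*\<^sub>C\<close> 75)
    and cinner :: "'a \<Rightarrow> 'a \<Rightarrow> complex"
  assumes scaleC_add_right: "c *\<^sub>C (x + y) = c *\<^sub>C x + c *\<^sub>C y"
    and scaleC_add_left: "(c + d) *\<^sub>C x = c *\<^sub>C x + d *\<^sub>C x"
    and scaleC_scaleC: "c *\<^sub>C d *\<^sub>C x = (c * d) *\<^sub>C x"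
    and scaleC_of_real: "complex_of_real r *\<^sub>C x = r *\<^sub>R x"
    and cinner_add_left: "cinner (x + y) z = cinner x z + cinner y z"
    and cinner_scaleC_left: "cinner (c *\<^sub>C x) y = c * cinner x y"
    and cinner_commute: "cinner x y = cnj (cinner y x)"
    and Re_cinner: "Re (cinner x y) = inner x y"

instantiation complex :: complex_hilbert
begin

definition scaleC_complex :: "complex \<Rightarrow> complex \<Rightarrow> complex"
  where "scaleC_complex c x = c * x"

definition cinner_complex :: "complex \<Rightarrow> complex \<Rightarrow> complex"
  where "cinner_complex x y = x * cnj y"

instance
  by standard
    (auto simp: scaleC_complex_def cinner_complex_def inner_complex_def scaleR_conv_of_real
      algebra_simps)

end

lemma norm_scaleC: "norm (c *\<^sub>C x) = cmod c * norm (x :: 'h::complex_hilbert)"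
proof -
  have right: "cinner y (d *\<^sub>C z) = cnj d * cinner y z" for d and y z :: 'h
    by (metis cinner_commute cinner_scaleC_left complex_cnj_cnj complex_cnj_mult)
  have "cinner (c *\<^sub>C x) (c *\<^sub>C x) = (c * cnj c) * cinner x x"
    by (simp add: cinner_scaleC_left right)
  also have "\<dots> = complex_of_real ((cmod c)\<^sup>2) * cinner x x"
    by (simp only: complex_norm_square)
  finally have "inner (c *\<^sub>C x) (c *\<^sub>C x) = (cmod c)\<^sup>2 * inner x x"
    by (simp flip: Re_cinner)
  then have "(norm (c *\<^sub>C x))\<^sup>2 = (cmod c * norm x)\<^sup>2"
    by (simp add: power2_norm_eq_inner power_mult_distrib)
  then show ?thesis
    by (simp add: power2_eq_iff_nonneg)
qed

text \<open>The type \<open>'h endo\<close> contains all real-linear bounded maps; the complex-linear ones among them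
  form \<open>BH\<close>. The norm of the type is the operator norm.\<close>

type_synonym 'h endo = "'h \<Rightarrow>\<^sub>L 'h"

definition BH :: "'h::complex_hilbert endo set"
  where "BH = {T. \<forall>c x. blinfun_apply T (c *\<^sub>C x) = c *\<^sub>C blinfun_apply T x}"

definition op_scaleC :: "complex \<Rightarrow> 'h::complex_hilbert endo \<Rightarrow> 'h endo"
  where "op_scaleC c T = Blinfun (\<lambda>x. c *\<^sub>C blinfun_apply T x)"

lemma op_scaleC_apply [simp]: "blinfun_apply (op_scaleC c T) x = c *\<^sub>C blinfun_apply T x"
proof -
  have "c *\<^sub>C r *\<^sub>R y = r *\<^sub>R c *\<^sub>C y" for r and y :: 'a
    by (simp add: scaleC_scaleC mult.commute flip: scaleC_of_real)
  then have "bounded_linear (\<lambda>y :: 'a. c *\<^sub>C y)"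
    by (intro bounded_linear_intro[where K = "cmod c"])
      (simp_all add: scaleC_add_right norm_scaleC mult.commute)
  then have "bounded_linear (\<lambda>x. c *\<^sub>C blinfun_apply T x)"
    by (rule bounded_linear_compose) (rule blinfun.bounded_linear_right)
  then show ?thesis
    by (simp add: op_scaleC_def bounded_linear_Blinfun_apply)
qed

lemma vector_space_op_scaleC: "vector_space (op_scaleC :: complex \<Rightarrow> 'h::complex_hilbert endo \<Rightarrow> _)"
  by standard
    (auto intro!: blinfun_eqI simp: blinfun.add_left scaleC_add_right scaleC_add_left scaleC_scaleC
      scaleC_of_real[of 1, simplified])

abbreviation op_csubspace :: "'h::complex_hilbert endo set \<Rightarrow> bool"
  where "op_csubspace \<equiv> module.subspace op_scaleC"

abbreviation op_cspan :: "'h::complex_hilbert endo set \<Rightarrow> 'h endo set"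
  where "op_cspan \<equiv> module.span op_scaleC"

section \<open>Operator algebras\<close>

definition operator_algebra :: "'h::complex_hilbert endo set \<Rightarrow> bool"
  where "operator_algebra A \<longleftrightarrow>
    A \<subseteq> BH \<and> closed A \<and> op_csubspace A \<and> (\<forall>a\<in>A. \<forall>b\<in>A. a o\<^sub>L b \<in> A)"

definition closed_ideal :: "'h::complex_hilbert endo set \<Rightarrow> 'h endo set \<Rightarrow> bool"
  where "closed_ideal A J \<longleftrightarrow>
    J \<subseteq> A \<and> closed J \<and> op_csubspace J \<and> (\<forall>a\<in>A. \<forall>x\<in>J. a o\<^sub>L x \<in> J \<and> x o\<^sub>L a \<in> J)"

definition semiprime :: "'h::complex_hilbert endo set \<Rightarrow> bool"
  where "semiprime A \<longleftrightarrow>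
    (\<forall>J. closed_ideal A J \<and> (\<forall>x\<in>J. \<forall>y\<in>J. x o\<^sub>L y = 0) \<longrightarrow> J = {0})"

definition is_projection :: "'h::complex_hilbert endo \<Rightarrow> bool"
  where "is_projection p \<longleftrightarrow> p \<in> BH \<and> p o\<^sub>L p = p \<and>
    (\<forall>x y. cinner (blinfun_apply p x) y = cinner x (blinfun_apply p y))"

text \<open>The projection \<open>0\<close> is not excluded; it contributes the zero right ideal to the r-socle.\<close>

definition alg_minimal :: "'h::complex_hilbert endo set \<Rightarrow> 'h endo \<Rightarrow> bool"
  where "alg_minimal A e \<longleftrightarrow>
    e \<in> A \<and> is_projection e \<and> {e o\<^sub>L a o\<^sub>L e | a. a \<in> A} = {op_scaleC c e | c. True}"

text \<open>The algebraic sum of the subspaces \<open>eA\<close> is the span of their union.\<close>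

definition r_soc :: "'h::complex_hilbert endo set \<Rightarrow> 'h endo set"
  where "r_soc A = closure (op_cspan (\<Union>e\<in>{e. alg_minimal A e}. {e o\<^sub>L a | a. a \<in> A}))"

section \<open>The bidual with the Arens product\<close>

text \<open>As \<open>A\<close> is a set and not a type, functionals on \<open>A\<close> (on \<open>A*\<close>) are represented by functions that
  are \<open>0\<close> outside of \<open>A\<close> (of \<open>A*\<close>); this makes equality of functionals equality of functions.\<close>

definition dual :: "'h::complex_hilbert endo set \<Rightarrow> ('h endo \<Rightarrow> complex) set"
  where "dual A = {\<phi>.
    (\<forall>a. a \<notin> A \<longrightarrow> \<phi> a = 0) \<and>
    (\<forall>a\<in>A. \<forall>b\<in>A. \<phi> (a + b) = \<phi> a + \<phi> b) \<and>
    (\<forall>c. \<forall>a\<in>A. \<phi> (op_scaleC c a) = c * \<phi> a) \<and>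
    (\<exists>C. \<forall>a\<in>A. cmod (\<phi> a) \<le> C * norm a)}"

definition dual_norm :: "'h::complex_hilbert endo set \<Rightarrow> ('h endo \<Rightarrow> complex) \<Rightarrow> real"
  where "dual_norm A \<phi> = (SUP a\<in>{a\<in>A. norm a \<le> 1}. cmod (\<phi> a))"

definition bidual :: "'h::complex_hilbert endo set \<Rightarrow> (('h endo \<Rightarrow> complex) \<Rightarrow> complex) set"
  where "bidual A = {F.
    (\<forall>\<phi>. \<phi> \<notin> dual A \<longrightarrow> F \<phi> = 0) \<and>
    (\<forall>\<phi>\<in>dual A. \<forall>\<psi>\<in>dual A. F (\<lambda>a. \<phi> a + \<psi> a) = F \<phi> + F \<psi>) \<and>
    (\<forall>c. \<forall>\<phi>\<in>dual A. F (\<lambda>a. c * \<phi> a) = c * F \<phi>) \<and>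
    (\<exists>C. \<forall>\<phi>\<in>dual A. cmod (F \<phi>) \<le> C * dual_norm A \<phi>)}"

definition bidual_norm ::
  "'h::complex_hilbert endo set \<Rightarrow> (('h endo \<Rightarrow> complex) \<Rightarrow> complex) \<Rightarrow> real"
  where "bidual_norm A F = (SUP \<phi>\<in>{\<phi>\<in>dual A. dual_norm A \<phi> \<le> 1}. cmod (F \<phi>))"

definition bidual_embed ::
  "'h::complex_hilbert endo set \<Rightarrow> 'h endo \<Rightarrow> ('h endo \<Rightarrow> complex) \<Rightarrow> complex"
  where "bidual_embed A a = (\<lambda>\<phi>. if \<phi> \<in> dual A then \<phi> a else 0)"

text \<open>First Arens product: \<open>(F G)(\<phi>) = F (G\<cdot>\<phi>)\<close> with \<open>(G\<cdot>\<phi>)(a) = G (\<phi>\<cdot>a)\<close> and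
  \<open>(\<phi>\<cdot>a)(b) = \<phi> (a b)\<close>. Operator algebras are Arens regular, so the second Arens product agrees
  with it.\<close>

definition arens ::
  "'h::complex_hilbert endo set \<Rightarrow> (('h endo \<Rightarrow> complex) \<Rightarrow> complex)
    \<Rightarrow> (('h endo \<Rightarrow> complex) \<Rightarrow> complex) \<Rightarrow> ('h endo \<Rightarrow> complex) \<Rightarrow> complex"
  where "arens A F G = (\<lambda>\<phi>. if \<phi> \<in> dual A
    then F (\<lambda>a. if a \<in> A then G (\<lambda>b. if b \<in> A then \<phi> (a o\<^sub>L b) else 0) else 0)
    else 0)"

text \<open>The bidual is an abstract operator algebra: it does not come with a Hilbert space on which it
  acts. In every isometric representation as operators, the orthogonal projections are the contractive
  idempotents.\<close>

definition bidual_projection ::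
  "'h::complex_hilbert endo set \<Rightarrow> (('h endo \<Rightarrow> complex) \<Rightarrow> complex) \<Rightarrow> bool"
  where "bidual_projection A f \<longleftrightarrow>
    f \<in> bidual A \<and> arens A f f = f \<and> bidual_norm A f \<le> 1"

section \<open>The h-socle\<close>

text \<open>Nets are represented by proper filters on the operators.\<close>

definition left_cai :: "'h::complex_hilbert endo set \<Rightarrow> 'h endo filter \<Rightarrow> bool"
  where "left_cai J U \<longleftrightarrow> U \<noteq> bot \<and> (\<forall>\<^sub>F e in U. e \<in> J \<and> norm e \<le> 1) \<and>
    (\<forall>x\<in>J. ((\<lambda>e. e o\<^sub>L x) \<longlongrightarrow> x) U)"

definition weak_star_limit ::
  "'h::complex_hilbert endo set \<Rightarrow> 'h endo filter \<Rightarrow> (('h endo \<Rightarrow> complex) \<Rightarrow> complex) \<Rightarrow> bool"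
  where "weak_star_limit A U F \<longleftrightarrow> (\<forall>\<phi>\<in>dual A. ((\<lambda>e. bidual_embed A e \<phi>) \<longlongrightarrow> F \<phi>) U)"

text \<open>For a closed right ideal with a left contractive approximate identity, all these weak*
  limits are the same projection, so that the choice is immaterial.\<close>

definition support_projection ::
  "'h::complex_hilbert endo set \<Rightarrow> 'h endo set \<Rightarrow> ('h endo \<Rightarrow> complex) \<Rightarrow> complex"
  where "support_projection A J =
    (SOME f. bidual_projection A f \<and> (\<exists>U. left_cai J U \<and> weak_star_limit A U f))"

definition h_soc :: "'h::complex_hilbert endo set \<Rightarrow> 'h endo set"
  where "h_soc A = (let f = support_projection A (r_soc A) in
    {a\<in>A. \<exists>F\<in>bidual A. bidual_embed A a = arens A (arens A f F) f})"

section \<open>Matricial algebras\<close>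

definition matrix_units :: "'i set \<Rightarrow> ('i \<Rightarrow> 'i \<Rightarrow> 'h::complex_hilbert endo) \<Rightarrow> bool"
  where "matrix_units I T \<longleftrightarrow> (\<forall>i\<in>I. \<forall>j\<in>I. T i j \<noteq> 0) \<and>
    (\<forall>i\<in>I. \<forall>j\<in>I. \<forall>k\<in>I. \<forall>l\<in>I. T i j o\<^sub>L T k l = (if j = k then T i l else 0))"

text \<open>The separable 1-matricial algebras are those whose matrix units are indexed by a countable
  set, for which a set of natural numbers can be taken.\<close>

definition separable_one_matricial :: "'h::complex_hilbert endo set \<Rightarrow> bool"
  where "separable_one_matricial M \<longleftrightarrow> operator_algebra M \<and>
    (\<exists>(I :: nat set) T. I \<noteq> {} \<and> matrix_units I T \<and> (\<forall>k\<in>I. norm (T k k) = 1) \<and>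
      M = closure (op_cspan {T i j | i j. i \<in> I \<and> j \<in> I}))"

text \<open>Norm of an \<open>n \<times> n\<close> matrix of operators, acting on the Hilbert space sum of \<open>n\<close> copies
  of \<open>'h\<close>.\<close>

definition mat_norm :: "nat \<Rightarrow> (nat \<Rightarrow> nat \<Rightarrow> 'h::complex_hilbert endo) \<Rightarrow> real"
  where "mat_norm n x =
    (SUP v\<in>{v :: nat \<Rightarrow> 'h. (\<Sum>j<n. (norm (v j))\<^sup>2) \<le> 1}.
      sqrt (\<Sum>i<n. (norm (\<Sum>j<n. blinfun_apply (x i j) (v j)))\<^sup>2))"

text \<open>Sequences are \<open>0\<close> outside of the index set \<open>K\<close>, so finite and empty sums are covered.\<close>

definition c0_sum :: "nat set \<Rightarrow> (nat \<Rightarrow> 'h::complex_hilbert endo set) \<Rightarrow> (nat \<Rightarrow> 'h endo) set"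
  where "c0_sum K M =
    {a. (\<forall>k\<in>K. a k \<in> M k) \<and> (\<forall>k. k \<notin> K \<longrightarrow> a k = 0) \<and> a \<longlonglongrightarrow> 0}"

definition c0_mat_norm :: "nat \<Rightarrow> (nat \<Rightarrow> nat \<Rightarrow> nat \<Rightarrow> 'h::complex_hilbert endo) \<Rightarrow> real"
  where "c0_mat_norm n a = (SUP k. mat_norm n (\<lambda>i j. a i j k))"

definition completely_isometric_iso_c0 ::
  "'h::complex_hilbert endo set \<Rightarrow> nat set \<Rightarrow> (nat \<Rightarrow> 'h endo set)
    \<Rightarrow> ('h endo \<Rightarrow> nat \<Rightarrow> 'h endo) \<Rightarrow> bool"
  where "completely_isometric_iso_c0 B K M \<theta> \<longleftrightarrow>
    bij_betw \<theta> B (c0_sum K M) \<and>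
    (\<forall>x\<in>B. \<forall>y\<in>B. \<theta> (x + y) = (\<lambda>k. \<theta> x k + \<theta> y k)) \<and>
    (\<forall>c. \<forall>x\<in>B. \<theta> (op_scaleC c x) = (\<lambda>k. op_scaleC c (\<theta> x k))) \<and>
    (\<forall>x\<in>B. \<forall>y\<in>B. \<theta> (x o\<^sub>L y) = (\<lambda>k. \<theta> x k o\<^sub>L \<theta> y k)) \<and>
    (\<forall>n x. (\<forall>i<n. \<forall>j<n. x i j \<in> B) \<longrightarrow>
      c0_mat_norm n (\<lambda>i j. \<theta> (x i j)) = mat_norm n x)"

text \<open>The summands are taken on the same Hilbert space as \<open>B\<close>. This is no restriction: the inverse of
  a completely isometric isomorphism of \<open>B\<close> onto a \<open>c0\<close>-sum embeds every summand completely
  isometrically as a closed subalgebra of \<open>B\<close>.\<close>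

definition sigma_matricial :: "'h::complex_hilbert endo set \<Rightarrow> bool"
  where "sigma_matricial B \<longleftrightarrow> operator_algebra B \<and>
    (\<exists>K M \<theta>. (\<forall>k\<in>K. separable_one_matricial (M k)) \<and> completely_isometric_iso_c0 B K M \<theta>)"

end

theory Submission
  imports Defs "HOL-Complex_Analysis.Great_Picard"
begin

text \<open>Gram--Schmidt, applied to a dense sequence of algebraically minimal projections, yields pairwise
  orthogonal minimal (or zero) projections \<open>q\<^sub>i \<in> A\<close> whose partial sums \<open>s\<^sub>n\<close> form a left approximate
  identity of the r-socle. Since the differences \<open>s\<^sub>n - s\<^sub>m\<close> are projections, every bounded functional
  \<open>\<phi>\<close> is small on \<open>(s\<^sub>n - s\<^sub>m) u\<close> for large \<open>m, n\<close>, uniformly in the contractions \<open>u \<in> A\<close>. This takes the place of Arens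
  regularity: \<open>s\<^sub>n\<close> converges weak* to a projection of the bidual, every other left contractive
  approximate identity with a weak* limit has the same limit, and \<open>h_soc A\<close> is the set of all \<open>a\<close> with
  \<open>s\<^sub>n a \<rightarrow> a\<close> and \<open>a s\<^sub>n \<rightarrow> a\<close>. It is therefore the closed span of the spaces \<open>q\<^sub>i A q\<^sub>j\<close>. By
  semiprimeness each of these is zero or spanned by a matrix unit, which splits the indices into
  classes; the classes give mutually orthogonal 1-matricial blocks, so that the sum of the blocks
  is a \<open>c\<^sub>0\<close>-sum.\<close>

section \<open>Bounded operators and projections\<close>

text \<open>\<open>A\<close> is not closed under adjoints and its bidual carries no Hilbert space;
  this shapes three points. (1) Comparing \<open>s n\<close> with an arbitrary approximate identity
  \<open>u\<close> interchanges two limits of \<open>\<phi> (s n u)\<close>. The limit in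
  \<open>n\<close> is uniform over contractions \<open>u\<close> of the r-socle. The limit along
  \<open>u\<close> needs \<open>s n u \<rightarrow> s n\<close>, whereas a left approximate identity
  only gives \<open>u (s n) \<rightarrow> s n\<close>; contractivity supplies the missing order,
  which adjoints would give in a C*-algebra. (2) The formula of the first Arens product only shows
  weak* continuity in the left factor. An equation \<open>a = f F f\<close> therefore yields no more
  than weak convergence of \<open>s n a\<close> and \<open>a s n\<close> to \<open>a\<close>; the
  nesting of the \<open>s n\<close> and separability upgrade it to norm convergence. (3) That
  \<open>q i A q j\<close> is non-zero need not imply the same for \<open>q j A q i\<close>: the
  upper triangular 2 by 2 matrices with their diagonal units are an example. Semiprimeness excludes
  this, and so produces the inverse pairs from which matrix units are built.\<close>

instance complex_hilbert \<subseteq> banach ..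

interpretation ops: vector_space "op_scaleC :: complex \<Rightarrow> 'h::complex_hilbert endo \<Rightarrow> 'h endo"
  by (rule vector_space_op_scaleC)

lemma compose_assoc: "(a o\<^sub>L b) o\<^sub>L c = a o\<^sub>L (b o\<^sub>L c)"
  by (rule blinfun_eqI) simp

lemmas compose_simps = compose_assoc blinfun.bilinear_simps
  bounded_bilinear.add_left[OF bounded_bilinear_blinfun_compose]
  bounded_bilinear.add_right[OF bounded_bilinear_blinfun_compose]
  bounded_bilinear.diff_left[OF bounded_bilinear_blinfun_compose]
  bounded_bilinear.diff_right[OF bounded_bilinear_blinfun_compose]

lemma zero_compose [simp]: "0 o\<^sub>L (a :: 'h::complex_hilbert endo) = 0"
  and compose_zero [simp]: "(a :: 'h endo) o\<^sub>L 0 = 0"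
  by (auto intro: blinfun_eqI)

lemma scaleC_zero_left [simp]: "0 *\<^sub>C (x :: 'h::complex_hilbert) = 0"
  using scaleC_of_real[of 0 x] by simp

lemma scaleC_zero_right [simp]: "c *\<^sub>C (0 :: 'h::complex_hilbert) = 0"
  using scaleC_add_right[of c "0::'h" 0] by simp

lemma scaleC_minus_right: "c *\<^sub>C (- x) = - (c *\<^sub>C (x :: 'h::complex_hilbert))"
  using scaleC_add_right[of c x "- x"] by (simp add: eq_neg_iff_add_eq_0 add.commute)

lemma scaleC_diff_right: "c *\<^sub>C (x - y) = c *\<^sub>C x - c *\<^sub>C (y :: 'h::complex_hilbert)"
  using scaleC_add_right[of c x "- y"] by (simp add: scaleC_minus_right)

lemma cinner_add_right: "cinner x (y + z) = cinner x y + cinner x (z :: 'h::complex_hilbert)"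
  by (metis cinner_add_left cinner_commute complex_cnj_add)

lemma cinner_scaleC_right: "cinner x (c *\<^sub>C y) = cnj c * cinner x (y :: 'h::complex_hilbert)"
  by (metis cinner_commute cinner_scaleC_left complex_cnj_mult)

lemma cinner_diff_left: "cinner (x - y) z = cinner x z - cinner y (z :: 'h::complex_hilbert)"
  by (metis add_diff_cancel cinner_add_left diff_add_cancel)

lemma cinner_diff_right: "cinner x (y - z) = cinner x y - cinner x (z :: 'h::complex_hilbert)"
  by (metis add_diff_cancel cinner_add_right diff_add_cancel)

lemma cinner_self: "cinner x x = complex_of_real ((norm (x :: 'h::complex_hilbert))\<^sup>2)"
proof -
  have "Im (cinner x x) = 0"
    by (metis cinner_commute complex_cnj_cancel_iff complex_In_mult_cnj_zero Reals_cnj_iff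
      complex_is_Real_iff)
  then show ?thesis
    by (simp add: complex_eq_iff Re_cinner power2_norm_eq_inner)
qed

lemma cmod_cinner_le: "cmod (cinner x y) \<le> norm x * norm (y :: 'h::complex_hilbert)"
proof (cases "cinner x y = 0")
  case False
  \<comment> \<open>A phase that makes the inner product real and non-negative, so that the real
    Cauchy-Schwarz inequality of the class applies.\<close>
  define c where "c = cnj (cinner x y) / cmod (cinner x y)"
  have c: "cmod c = 1"
    using False by (simp add: c_def norm_divide)
  have "c * cinner x y = cmod (cinner x y)"
    using False by (simp add: c_def complex_norm_square[symmetric] field_simps power2_eq_square)
  then have "cmod (cinner x y) = inner (c *\<^sub>C x) y"
    by (metis Re_cinner Re_complex_of_real cinner_scaleC_left)
  also have "\<dots> \<le> norm (c *\<^sub>C x) * norm y"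
    by (rule norm_cauchy_schwarz)
  finally show ?thesis
    by (simp add: norm_scaleC c)
qed simp

lemma op_scaleC_compose_left: "op_scaleC c a o\<^sub>L b = op_scaleC c (a o\<^sub>L b)"
  by (rule blinfun_eqI) simp

lemma op_scaleC_compose_right: "a \<in> BH \<Longrightarrow> a o\<^sub>L op_scaleC c b = op_scaleC c (a o\<^sub>L b)"
  by (rule blinfun_eqI) (simp add: BH_def)

lemma op_scaleC_of_real: "op_scaleC (complex_of_real r) a = r *\<^sub>R a"
  by (rule blinfun_eqI) (simp add: scaleC_of_real blinfun.scaleR_left)

lemma norm_op_scaleC: "norm (op_scaleC c a) = cmod c * norm (a :: 'h::complex_hilbert endo)"
proof -
  have le: "norm (op_scaleC d b) \<le> cmod d * norm b" for d and b :: "'h endo"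
    by (rule norm_blinfun_bound)
      (auto simp: norm_scaleC mult.assoc intro!: mult_left_mono norm_blinfun)
  show ?thesis
  proof (cases "c = 0")
    case False
    have "norm a = norm (op_scaleC (inverse c) (op_scaleC c a))"
      using False by simp
    also have "\<dots> \<le> inverse (cmod c) * norm (op_scaleC c a)"
      using le[of "inverse c" "op_scaleC c a"] by (simp add: norm_inverse)
    finally have "cmod c * norm a \<le> norm (op_scaleC c a)"
      using False by (simp add: field_simps)
    with le[of c a] show ?thesis by simp
  qed simp
qed

lemma bounded_linear_op_scaleC: "bounded_linear (op_scaleC c)"
proof (rule bounded_linear_intro[where K = "cmod c"])
  show "op_scaleC c (r *\<^sub>R x) = r *\<^sub>R op_scaleC c x" for r and x :: "'a endo"
    by (simp flip: op_scaleC_of_real add: mult.commute)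
qed (simp_all add: ops.scale_right_distrib norm_op_scaleC)

lemmas tendsto_op_scaleC = bounded_linear.tendsto[OF bounded_linear_op_scaleC]

lemmas tendsto_compose_op = bounded_bilinear.tendsto[OF bounded_bilinear_blinfun_compose]

lemma csubspace_closure:
  assumes "op_csubspace S"
  shows "op_csubspace (closure S)"
proof (rule ops.subspaceI)
  show "0 \<in> closure S"
    using ops.subspace_0[OF assms] closure_subset by blast
next
  fix x y assume "x \<in> closure S" "y \<in> closure S"
  then obtain f g where "\<forall>n. f n \<in> S" "f \<longlonglongrightarrow> x" "\<forall>n. g n \<in> S" "g \<longlonglongrightarrow> y"
    unfolding closure_sequential by blast
  then have "\<forall>n. f n + g n \<in> S" "(\<lambda>n. f n + g n) \<longlonglongrightarrow> x + y"
    by (auto intro: ops.subspace_add[OF assms] tendsto_add)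
  then show "x + y \<in> closure S"
    unfolding closure_sequential by (intro exI[of _ "\<lambda>n. f n + g n"]) simp
next
  fix c x assume "x \<in> closure S"
  then obtain f where "\<forall>n. f n \<in> S" "f \<longlonglongrightarrow> x"
    unfolding closure_sequential by blast
  then have "\<forall>n. op_scaleC c (f n) \<in> S" "(\<lambda>n. op_scaleC c (f n)) \<longlonglongrightarrow> op_scaleC c x"
    by (auto intro: ops.subspace_scale[OF assms] tendsto_op_scaleC)
  then show "op_scaleC c x \<in> closure S"
    unfolding closure_sequential by (intro exI[of _ "\<lambda>n. op_scaleC c (f n)"]) simp
qed

text \<open>Bilinear extension from generators to closed spans. A complex scalar can be pulled out
  of the right factor only past a complex-linear left factor, hence \<open>S \<subseteq> BH\<close>.
  The target \<open>V\<close> is kept general: it is a closed span for subalgebras and ideals, and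
  \<open>{0}\<close> for ideals of square zero.\<close>

lemma closed_span_compose_mem:
  assumes mem: "\<And>a b. a \<in> S \<Longrightarrow> b \<in> T \<Longrightarrow> a o\<^sub>L b \<in> V"
    and V: "op_csubspace V" "closed V"
    and S: "S \<subseteq> BH"
    and a: "a \<in> closure (op_cspan S)" and b: "b \<in> closure (op_cspan T)"
  shows "a o\<^sub>L b \<in> V"
proof -
  have 1: "a o\<^sub>L b \<in> V" if "a \<in> S" "b \<in> op_cspan T" for a b
    using that(2)
  proof (induction rule: ops.span_induct_alt)
    case base
    then show ?case using V by (simp add: ops.subspace_0)
  next
    case (step c x y)
    then show ?case
      using that(1) mem V subsetD[OF S that(1)]
      by (simp add: compose_simps op_scaleC_compose_right ops.subspace_add ops.subspace_scale)
  qed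
  have 2: "a o\<^sub>L b \<in> V" if "a \<in> op_cspan S" "b \<in> op_cspan T" for a b
    using that(1)
  proof (induction rule: ops.span_induct_alt)
    case base
    then show ?case using V by (simp add: ops.subspace_0)
  next
    case (step c x y)
    then show ?case
      using that(2) 1 V
      by (auto simp: compose_simps op_scaleC_compose_left intro!: ops.subspace_add ops.subspace_scale)
  qed
  obtain f g where "\<forall>n. f n \<in> op_cspan S" "f \<longlonglongrightarrow> a" "\<forall>n. g n \<in> op_cspan T" "g \<longlonglongrightarrow> b"
    using a b unfolding closure_sequential by blast
  then have "\<forall>n. f n o\<^sub>L g n \<in> V" "(\<lambda>n. f n o\<^sub>L g n) \<longlonglongrightarrow> (a o\<^sub>L b)"
    by (auto intro: 2 tendsto_compose_op)
  then show ?thesis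
    using closed_sequentially[OF V(2), of "\<lambda>n. f n o\<^sub>L g n"] by simp
qed

lemma operator_algebra_subset_BH: "operator_algebra A \<Longrightarrow> A \<subseteq> BH"
  and operator_algebra_closed: "operator_algebra A \<Longrightarrow> closed A"
  and operator_algebra_csubspace: "operator_algebra A \<Longrightarrow> op_csubspace A"
  and operator_algebra_compose: "operator_algebra A \<Longrightarrow> a \<in> A \<Longrightarrow> b \<in> A \<Longrightarrow> a o\<^sub>L b \<in> A"
  by (auto simp: operator_algebra_def)

lemma operator_algebra_zero: "operator_algebra A \<Longrightarrow> 0 \<in> A"
  and operator_algebra_add: "operator_algebra A \<Longrightarrow> a \<in> A \<Longrightarrow> b \<in> A \<Longrightarrow> a + b \<in> A"
  and operator_algebra_diff: "operator_algebra A \<Longrightarrow> a \<in> A \<Longrightarrow> b \<in> A \<Longrightarrow> a - b \<in> A"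
  and operator_algebra_scaleC: "operator_algebra A \<Longrightarrow> a \<in> A \<Longrightarrow> op_scaleC c a \<in> A"
  by (simp_all add: operator_algebra_def ops.subspace_0 ops.subspace_add ops.subspace_diff
      ops.subspace_scale)

lemmas operator_algebra_intros = operator_algebra_compose operator_algebra_zero
  operator_algebra_add operator_algebra_diff operator_algebra_scaleC

lemma closed_span_subset:
  assumes "op_csubspace V" "closed V" "S \<subseteq> V"
  shows "closure (op_cspan S) \<subseteq> V"
  using assms by (simp add: closure_minimal ops.span_minimal)

lemma operator_algebra_closed_span:
  assumes A: "operator_algebra A" and S: "S \<subseteq> A"
    and mem: "\<And>a b. a \<in> S \<Longrightarrow> b \<in> S \<Longrightarrow> a o\<^sub>L b \<in> op_cspan S"
  shows "operator_algebra (closure (op_cspan S))"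
  unfolding operator_algebra_def
proof (intro conjI ballI)
  show "closure (op_cspan S) \<subseteq> BH"
    using closed_span_subset[of A S] A S by (auto simp: operator_algebra_def)
  show "op_csubspace (closure (op_cspan S))"
    by (intro csubspace_closure ops.subspace_span)
  fix a b assume "a \<in> closure (op_cspan S)" "b \<in> closure (op_cspan S)"
  then show "a o\<^sub>L b \<in> closure (op_cspan S)"
  proof (rule closed_span_compose_mem[rotated 4])
    show "S \<subseteq> BH"
      using S operator_algebra_subset_BH[OF A] by blast
  qed (use mem closure_subset in \<open>auto intro: csubspace_closure ops.subspace_span\<close>)
qed simp

section \<open>Orthogonal projections\<close>

lemma
  assumes "is_projection p"
  shows projection_BH: "p \<in> BH"
    and projection_idem: "p o\<^sub>L p = p"
    and projection_apply_idem: "blinfun_apply p (blinfun_apply p x) = blinfun_apply p x"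
    and projection_cinner: "cinner (blinfun_apply p x) y = cinner x (blinfun_apply p y)"
    and projection_inner: "inner (blinfun_apply p x) y = inner x (blinfun_apply p y)"
proof -
  show "p \<in> BH" "p o\<^sub>L p = p" "cinner (blinfun_apply p x) y = cinner x (blinfun_apply p y)"
    using assms by (auto simp: is_projection_def)
  then show "blinfun_apply p (blinfun_apply p x) = blinfun_apply p x"
    by (metis blinfun_apply_blinfun_compose)
  show "inner (blinfun_apply p x) y = inner x (blinfun_apply p y)"
    using assms by (metis is_projection_def Re_cinner)
qed

lemma projection_pythagoras:
  assumes "is_projection p"
  shows "(norm x)\<^sup>2 = (norm (blinfun_apply p x))\<^sup>2 + (norm (x - blinfun_apply p x))\<^sup>2"
proof -
  have "inner (p x) (x - p x) = 0"
    using assms by (simp add: inner_diff_right projection_inner projection_apply_idem)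
  then show ?thesis
    by (simp add: power2_norm_eq_inner inner_diff inner_commute)
qed

lemma projection_apply_le: "is_projection p \<Longrightarrow> norm (blinfun_apply p x) \<le> norm x"
  using projection_pythagoras[of p x] by (metis le_add_same_cancel1 norm_ge_zero power2_le_imp_le zero_le_power2)

lemma norm_projection_le: "is_projection p \<Longrightarrow> norm p \<le> 1"
  by (rule norm_blinfun_bound) (auto simp: projection_apply_le)

lemma norm_projection_eq_1:
  assumes "is_projection p" "p \<noteq> 0"
  shows "norm p = 1"
proof -
  have "norm p \<le> norm p * norm p"
    by (metis assms(1) norm_blinfun_compose projection_idem)
  with norm_projection_le[OF assms(1)] assms(2) show ?thesis
    by (metis mult_le_cancel_left1 norm_le_zero_iff not_le order_antisym)
qed

lemma is_projection_zero: "is_projection 0"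
  by (simp add: is_projection_def BH_def)
    (metis cinner_diff_left cinner_diff_right diff_self)

lemma projection_add:
  assumes "is_projection p" "is_projection q" "p o\<^sub>L q = 0" "q o\<^sub>L p = 0"
  shows "is_projection (p + q)"
  using assms
  by (auto simp: is_projection_def BH_def compose_simps cinner_add_left cinner_add_right
      scaleC_add_right)

section \<open>Algebraically minimal projections and their orthogonalisation\<close>

lemma alg_minimal_zero: "operator_algebra A \<Longrightarrow> alg_minimal A 0"
  using operator_algebra_zero by (auto simp: alg_minimal_def is_projection_zero)

lemma
  assumes "alg_minimal A e"
  shows alg_minimal_mem: "e \<in> A" and alg_minimal_projection: "is_projection e"
    and alg_minimal_corner: "a \<in> A \<Longrightarrow> \<exists>c. e o\<^sub>L a o\<^sub>L e = op_scaleC c e"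
  using assms by (auto simp: alg_minimal_def)

text \<open>The multiples of \<open>e\<close> always lie in \<open>eAe\<close>, because
  \<open>c e = e (c e) e\<close>.\<close>

lemma alg_minimalI:
  assumes "operator_algebra A" "e \<in> A" "is_projection e"
    and "\<And>a. a \<in> A \<Longrightarrow> \<exists>c. e o\<^sub>L a o\<^sub>L e = op_scaleC c e"
  shows "alg_minimal A e"
proof -
  have "op_scaleC c e = e o\<^sub>L op_scaleC c e o\<^sub>L e" for c
    using assms(3)
    by (simp add: op_scaleC_compose_right op_scaleC_compose_left projection_BH projection_idem)
  then show ?thesis
    using assms operator_algebra_scaleC[of A e] unfolding alg_minimal_def by blast
qed

text \<open>The witness is the normalisation of \<open>(1 - s) e (1 - s)\<close>.\<close>

lemma gram_schmidt_step:
  assumes A: "operator_algebra A" and s: "s \<in> A" "is_projection s" and e: "alg_minimal A e"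
  obtains q where "alg_minimal A q" "s o\<^sub>L q = 0" "q o\<^sub>L s = 0" "(s + q) o\<^sub>L e = e"
proof -
  note eA = alg_minimal_mem[OF e] and ep = alg_minimal_projection[OF e]
  note BH = projection_BH[OF ep] projection_BH[OF s(2)]
  have idem: "e (e x) = e x" "s (s x) = s x" for x
    by (simp_all add: projection_apply_idem ep s)
  \<comment> \<open>Minimality makes \<open>e (1 - s) e\<close> a multiple \<open>l e\<close>. It is
    written as \<open>e (e - s) e\<close> because \<open>1 - s\<close> need not belong to
    \<open>A\<close>.\<close>
  have "e o\<^sub>L (e - s) o\<^sub>L e = e - (e o\<^sub>L s o\<^sub>L e)"
    by (rule blinfun_eqI) (simp add: compose_simps idem)
  then obtain l where "e - (e o\<^sub>L s o\<^sub>L e) = op_scaleC l e"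
    using alg_minimal_corner[OF e] operator_algebra_diff[OF A eA s(1)] by metis
  then have l: "e x - e (s (e x)) = l *\<^sub>C e x" for x
    by (metis blinfun.diff_left blinfun_apply_blinfun_compose op_scaleC_apply)
  show ?thesis
  proof (cases "op_scaleC l e = 0")
    case True
    then have 0: "e x - e (s (e x)) = 0" for x
      by (metis l op_scaleC_apply zero_blinfun.rep_eq)
    \<comment> \<open>The squared norm of \<open>(1 - s) e x\<close> is a value of the quadratic
      form of \<open>e (1 - s) e\<close>, which vanishes here. So \<open>e\<close> already lies
      below \<open>s\<close>, and \<open>q = 0\<close> is an admissible choice.\<close>
    have "(norm (e x - s (e x)))\<^sup>2 = 0" for x
    proof -
      have "(norm (e x - s (e x)))\<^sup>2 = inner x (e x - e (s (e x)))"
      proof -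
        define u where "u = blinfun_apply e x"
        have "inner (s u) (s u) = inner u (s u)"
          using s by (simp add: projection_inner idem)
        then have "(norm (u - s u))\<^sup>2 = inner u (u - s u)"
          by (simp add: power2_norm_eq_inner inner_diff inner_commute)
        also have "\<dots> = inner x (e (u - s u))"
          unfolding u_def by (rule projection_inner[OF ep])
        finally show ?thesis
          by (simp add: u_def blinfun.diff_right idem)
      qed
      then show ?thesis by (simp only: 0 inner_zero_right)
    qed
    then have "s o\<^sub>L e = e"
      by (intro blinfun_eqI) simp
    then show ?thesis
      using that[of 0] alg_minimal_zero[OF A] by simp
  next
    case False
    then obtain y where y: "l \<noteq> 0" "e y \<noteq> 0"
      by (metis blinfun_eqI op_scaleC_apply ops.scale_zero_left scaleC_zero_right zero_blinfun.rep_eq)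
    \<comment> \<open>\<open>e (1 - s) e\<close> is self-adjoint, so \<open>l\<close> is real; the
      self-adjointness of \<open>q\<close> depends on it.\<close>
    have "l * cinner (e y) (e y) = cinner (e y - e (s (e y))) (e y)"
      by (simp add: l cinner_scaleC_left)
    also have "\<dots> = cinner (e y) (e y - e (s (e y)))"
      by (simp add: cinner_diff_left cinner_diff_right projection_cinner ep s idem)
    also have "\<dots> = cnj l * cinner (e y) (e y)"
      by (simp add: l cinner_scaleC_right)
    finally have real: "cnj l = l"
      using y(2) by (simp add: cinner_self)
    define x where "x = e - (s o\<^sub>L e) - (e o\<^sub>L s) + (s o\<^sub>L e o\<^sub>L s)"
    define q where "q = op_scaleC (inverse l) x"
    have x_apply: "x z = (e z - e (s z)) - s (e z - e (s z))" for z
      by (simp add: x_def compose_simps)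
    have q_apply: "q z = inverse l *\<^sub>C ((e z - e (s z)) - s (e z - e (s z)))" for z
      by (simp add: q_def x_apply)
    have cl: "e (c *\<^sub>C z) = c *\<^sub>C e z" "s (c *\<^sub>C z) = c *\<^sub>C s z" for c z
      using BH by (auto simp: BH_def)
    have xA: "x \<in> A"
      unfolding x_def by (intro operator_algebra_intros A eA s)
    then have qA: "q \<in> A"
      unfolding q_def by (intro operator_algebra_scaleC A)
    have qBH: "q \<in> BH"
      using qA operator_algebra_subset_BH[OF A] by blast
    have ll: "inverse l *\<^sub>C l *\<^sub>C z = z" "l *\<^sub>C inverse l *\<^sub>C z = z" for z :: 'a
      using y scaleC_of_real[of 1 z] by (simp_all add: scaleC_scaleC)
    have sq: "s (q z) = 0" for z
      by (simp add: q_apply cl blinfun.diff_right idem)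
    have qs: "q (s z) = 0" for z
      by (simp add: q_apply idem blinfun.diff_right)
    have qe: "q (e z) = e z - s (e z)" for z
    proof -
      have "e (e z) - e (s (e z)) = l *\<^sub>C e z"
        by (simp add: idem l)
      then show ?thesis
        by (simp add: q_apply cl ll scaleC_diff_right)
    qed
    have eq: "e (q z) = e z - e (s z)" for z
    proof -
      have "e (e z - e (s z) - s (e z - e (s z))) = l *\<^sub>C (e z - e (s z))"
        using l[of "z - s z"] by (simp add: blinfun.diff_right idem)
      then show ?thesis
        by (simp add: q_apply cl ll)
    qed
    have qq: "q (q z) = q z" for z
      unfolding q_apply[of "q z"] by (simp add: eq sq) (simp add: q_apply)
    have qp: "is_projection q"
      unfolding is_projection_def
    proof (intro conjI allI)
      show "q o\<^sub>L q = q"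
        by (rule blinfun_eqI) (simp add: qq)
      show "cinner (q z) w = cinner z (q w)" for z w
        by (simp add: q_apply cinner_scaleC_left cinner_scaleC_right real cinner_diff_left
          cinner_diff_right projection_cinner ep s blinfun.diff_right)
    qed (rule qBH)
    have "\<exists>c. q o\<^sub>L a o\<^sub>L q = op_scaleC c q" if a: "a \<in> A" for a
    proof -
      have aBH: "a (c *\<^sub>C z) = c *\<^sub>C a z" for c z
        using a operator_algebra_subset_BH[OF A] by (auto simp: BH_def)
      \<comment> \<open>This is \<open>(1 - s) a (1 - s)\<close> written out inside
        \<open>A\<close>. With \<open>e b e = c e\<close>, the product \<open>q a q\<close> is
        \<open>(1 - s) e b e (1 - s)\<close> divided by the square of \<open>l\<close>, that is
        \<open>c / l\<close> times \<open>q\<close>.\<close>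
      define b where "b = a - (s o\<^sub>L a) - (a o\<^sub>L s) + (s o\<^sub>L a o\<^sub>L s)"
      have "b \<in> A"
        unfolding b_def by (intro operator_algebra_intros A a s)
      then obtain c where "e o\<^sub>L b o\<^sub>L e = op_scaleC c e"
        using alg_minimal_corner[OF e] by blast
      then have c: "e (b (e z)) = c *\<^sub>C e z" for z
        by (metis blinfun_apply_blinfun_compose op_scaleC_apply)
      have "q (a (q z)) = op_scaleC (inverse l * c) q z" for z
      proof -
        define w where "w = e z - e (s z)"
        have ew: "e w = w" by (simp add: w_def blinfun.diff_right idem)
        have qz: "q z = inverse l *\<^sub>C (w - s w)"
          by (simp add: q_apply w_def)
        have "e (a (w - s w)) - e (s (a (w - s w))) = e (b w)"
          by (simp add: b_def blinfun.bilinear_simps)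
        also have "\<dots> = c *\<^sub>C w"
          using c[of w] by (simp add: ew)
        finally have "q (a (w - s w)) = inverse l *\<^sub>C (c *\<^sub>C w - s (c *\<^sub>C w))"
          by (simp only: q_apply)
        then have "q (a (w - s w)) = c *\<^sub>C q z"
          by (simp add: qz cl scaleC_diff_right scaleC_scaleC mult.commute)
        moreover have "q (a (q z)) = inverse l *\<^sub>C q (a (w - s w))"
          using qBH by (simp add: qz aBH BH_def)
        ultimately show ?thesis by (simp add: scaleC_scaleC)
      qed
      then show ?thesis
        by (intro exI blinfun_eqI) simp
    qed
    then have "alg_minimal A q"
      by (intro alg_minimalI A qA qp)
    moreover have "s o\<^sub>L q = 0" "q o\<^sub>L s = 0" "(s + q) o\<^sub>L e = e"
      by (auto intro!: blinfun_eqI simp: sq qs qe blinfun.bilinear_simps)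
    ultimately show ?thesis
      by (rule that)
  qed
qed

section \<open>Functionals\<close>

lemma dualI:
  assumes "\<And>a. a \<notin> A \<Longrightarrow> \<phi> a = 0"
    and "\<And>a b. a \<in> A \<Longrightarrow> b \<in> A \<Longrightarrow> \<phi> (a + b) = \<phi> a + \<phi> b"
    and "\<And>c a. a \<in> A \<Longrightarrow> \<phi> (op_scaleC c a) = c * \<phi> a"
    and "\<And>a. a \<in> A \<Longrightarrow> cmod (\<phi> a) \<le> C * norm a"
  shows "\<phi> \<in> dual A"
  unfolding dual_def using assms by blast

lemma
  assumes "\<phi> \<in> dual A"
  shows dual_outside: "a \<notin> A \<Longrightarrow> \<phi> a = 0"
    and dual_add: "a \<in> A \<Longrightarrow> b \<in> A \<Longrightarrow> \<phi> (a + b) = \<phi> a + \<phi> b"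
    and dual_scaleC: "a \<in> A \<Longrightarrow> \<phi> (op_scaleC c a) = c * \<phi> a"
  using assms by (auto simp: dual_def)

lemma dual_bound:
  assumes "\<phi> \<in> dual A"
  obtains C where "C \<ge> 0" "\<And>a. a \<in> A \<Longrightarrow> cmod (\<phi> a) \<le> C * norm a"
proof -
  obtain C where "\<forall>a\<in>A. cmod (\<phi> a) \<le> C * norm a"
    using assms by (auto simp: dual_def)
  then have "cmod (\<phi> a) \<le> \<bar>C\<bar> * norm a" if "a \<in> A" for a
    using that by (meson abs_ge_self mult_right_mono norm_ge_zero order_trans)
  then show ?thesis
    using that[of "\<bar>C\<bar>"] by simp
qed

lemma dual_diff:
  assumes "operator_algebra A" "\<phi> \<in> dual A" "a \<in> A" "b \<in> A"
  shows "\<phi> (a - b) = \<phi> a - \<phi> b"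
  using dual_add[OF assms(2) operator_algebra_diff[OF assms(1,3,4)] assms(4)] by simp

lemma dual_tendsto:
  assumes A: "operator_algebra A" and \<phi>: "\<phi> \<in> dual A" and a: "a \<in> A"
    and f: "\<forall>\<^sub>F x in F. f x \<in> A" and lim: "(f \<longlongrightarrow> a) F"
  shows "((\<lambda>x. \<phi> (f x)) \<longlongrightarrow> \<phi> a) F"
proof -
  obtain C where C: "\<And>a. a \<in> A \<Longrightarrow> cmod (\<phi> a) \<le> C * norm a"
    using dual_bound[OF \<phi>] by blast
  have "((\<lambda>x. C * norm (f x - a)) \<longlongrightarrow> 0) F"
    using tendsto_mult_right_zero[OF tendsto_norm_zero[OF LIM_zero[OF lim]]] .
  moreover have "\<forall>\<^sub>F x in F. norm (\<phi> (f x) - \<phi> a) \<le> C * norm (f x - a)"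
    using f by eventually_elim
      (metis C dual_diff[OF A \<phi> _ a] operator_algebra_diff[OF A _ a])
  ultimately have "((\<lambda>x. \<phi> (f x) - \<phi> a) \<longlongrightarrow> 0) F"
    by (rule Lim_null_comparison[rotated])
  then show ?thesis
    by (rule LIM_zero_cancel)
qed

text \<open>The functional \<open>\<phi>\<cdot>a\<close>, to which the right factor of an Arens
  product is applied.\<close>

lemma dual_compose_left:
  assumes A: "operator_algebra A" and \<phi>: "\<phi> \<in> dual A" and a: "a \<in> A"
  shows "(\<lambda>b. if b \<in> A then \<phi> (a o\<^sub>L b) else 0) \<in> dual A"
proof -
  obtain C where C: "C \<ge> 0" "\<And>a. a \<in> A \<Longrightarrow> cmod (\<phi> a) \<le> C * norm a"
    using dual_bound[OF \<phi>] by blast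
  have aBH: "a \<in> BH"
    using a A operator_algebra_subset_BH by blast
  show ?thesis
  proof (rule dualI[where C = "C * norm a"])
    fix b assume b: "b \<in> A"
    have "cmod (\<phi> (a o\<^sub>L b)) \<le> C * norm (a o\<^sub>L b)"
      by (intro C operator_algebra_compose A a b)
    also have "\<dots> \<le> C * (norm a * norm b)"
      by (intro mult_left_mono norm_blinfun_compose C)
    finally show "cmod (if b \<in> A then \<phi> (a o\<^sub>L b) else 0) \<le> C * norm a * norm b"
      using b by (simp add: mult.assoc)
  qed (use A a aBH in \<open>auto simp: compose_simps op_scaleC_compose_right operator_algebra_intros
      dual_add[OF \<phi>] dual_scaleC[OF \<phi>]\<close>)
qed

lemma dual_compose_right:
  assumes A: "operator_algebra A" and \<phi>: "\<phi> \<in> dual A" and a: "a \<in> A"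
  shows "(\<lambda>b. if b \<in> A then \<phi> (b o\<^sub>L a) else 0) \<in> dual A"
proof -
  obtain C where C: "C \<ge> 0" "\<And>a. a \<in> A \<Longrightarrow> cmod (\<phi> a) \<le> C * norm a"
    using dual_bound[OF \<phi>] by blast
  show ?thesis
  proof (rule dualI[where C = "C * norm a"])
    fix b assume b: "b \<in> A"
    have "cmod (\<phi> (b o\<^sub>L a)) \<le> C * norm (b o\<^sub>L a)"
      by (intro C operator_algebra_compose A a b)
    also have "\<dots> \<le> C * (norm b * norm a)"
      by (intro mult_left_mono norm_blinfun_compose C)
    finally show "cmod (if b \<in> A then \<phi> (b o\<^sub>L a) else 0) \<le> C * norm a * norm b"
      using b by (simp add: mult_ac)
  qed (use A a in \<open>auto simp: compose_simps op_scaleC_compose_left operator_algebra_intros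
      dual_add[OF \<phi>] dual_scaleC[OF \<phi>]\<close>)
qed

lemma zero_mem_dual: "(\<lambda>a. 0) \<in> dual A"
  by (rule dualI[where C = 0]) auto

lemma dual_plus: "\<phi> \<in> dual A \<Longrightarrow> \<psi> \<in> dual A \<Longrightarrow> (\<lambda>a. \<phi> a + \<psi> a) \<in> dual A"
proof -
  assume \<phi>: "\<phi> \<in> dual A" and \<psi>: "\<psi> \<in> dual A"
  obtain C D where C: "\<And>a. a \<in> A \<Longrightarrow> cmod (\<phi> a) \<le> C * norm a"
    and D: "\<And>a. a \<in> A \<Longrightarrow> cmod (\<psi> a) \<le> D * norm a"
    using dual_bound[OF \<phi>] dual_bound[OF \<psi>] by metis
  show ?thesis
  proof (rule dualI[where C = "C + D"])
    show "cmod (\<phi> a + \<psi> a) \<le> (C + D) * norm a" if "a \<in> A" for a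
      using norm_triangle_mono[OF C[OF that] D[OF that]] by (simp add: algebra_simps)
  qed (simp_all add: dual_outside[OF \<phi>] dual_outside[OF \<psi>] dual_add[OF \<phi>] dual_add[OF \<psi>]
      dual_scaleC[OF \<phi>] dual_scaleC[OF \<psi>] algebra_simps)
qed

lemma dual_times: "\<phi> \<in> dual A \<Longrightarrow> (\<lambda>a. c * \<phi> a) \<in> dual A"
proof -
  assume \<phi>: "\<phi> \<in> dual A"
  obtain C where C: "\<And>a. a \<in> A \<Longrightarrow> cmod (\<phi> a) \<le> C * norm a"
    using dual_bound[OF \<phi>] by metis
  show ?thesis
  proof (rule dualI[where C = "cmod c * C"])
    show "cmod (c * \<phi> a) \<le> cmod c * C * norm a" if "a \<in> A" for a
      using C[OF that] by (simp add: norm_mult mult.assoc mult_left_mono)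
  qed (simp_all add: dual_outside[OF \<phi>] dual_add[OF \<phi>] dual_scaleC[OF \<phi>] algebra_simps)
qed

lemma dual_norm_upper:
  assumes \<phi>: "\<phi> \<in> dual A" and a: "a \<in> A" "norm a \<le> 1"
  shows "cmod (\<phi> a) \<le> dual_norm A \<phi>"
proof -
  obtain C where C: "C \<ge> 0" "\<And>a. a \<in> A \<Longrightarrow> cmod (\<phi> a) \<le> C * norm a"
    using dual_bound[OF \<phi>] by blast
  have "bdd_above ((\<lambda>a. cmod (\<phi> a)) ` {a \<in> A. norm a \<le> 1})"
  proof (rule bdd_aboveI2[where M = C])
    fix b assume "b \<in> {a \<in> A. norm a \<le> 1}"
    then show "cmod (\<phi> b) \<le> C"
      using C(2)[of b] mult_left_mono[of "norm b" 1 C] C(1) by simp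
  qed
  then show ?thesis
    unfolding dual_norm_def using a by (intro cSUP_upper) auto
qed

lemma bidual_embed_mem:
  assumes "operator_algebra A" "a \<in> A"
  shows "bidual_embed A a \<in> bidual A"
proof -
  have "cmod (\<phi> a) \<le> norm a * dual_norm A \<phi>" if \<phi>: "\<phi> \<in> dual A" for \<phi>
  proof (cases "a = 0")
    case True
    then show ?thesis
      using dual_scaleC[OF \<phi>, of 0 0] operator_algebra_zero[OF assms(1)] by simp
  next
    case False
    have "cmod (\<phi> (op_scaleC (inverse (norm a)) a)) \<le> dual_norm A \<phi>"
      by (intro dual_norm_upper \<phi> operator_algebra_scaleC assms) (simp add: norm_op_scaleC norm_inverse False)
    then show ?thesis
      using False by (simp add: dual_scaleC[OF \<phi> assms(2)] norm_mult norm_inverse norm_divide field_simps)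
  qed
  then show ?thesis
    by (auto simp: bidual_def bidual_embed_def dual_plus dual_times intro!: exI[of _ "norm a"])
qed

section \<open>From weak to norm convergence under separability\<close>

lemma separable_dense:
  assumes "separable_space (top_of_set A)"
  obtains C where "countable C" "C \<subseteq> A" "A \<subseteq> closure C"
proof -
  obtain C where C: "countable C" "C \<subseteq> A" "top_of_set A closure_of C = A"
    using assms by (auto simp: separable_space_def)
  then have "A \<subseteq> closure C"
    using closure_mono[of "A \<inter> C" C] by (auto simp: closure_of_subtopology)
  with C that show ?thesis by blast
qed

lemma norm_attaining_vectors:
  fixes b :: "'h::complex_hilbert endo"
  assumes "\<delta> \<ge> 0" "\<delta> < norm b"
  obtains x y where "norm x \<le> 1" "norm y \<le> 1" "\<delta> \<le> cmod (cinner (blinfun_apply b x) y)"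
proof -
  have "\<not> (\<forall>x. norm (b x) \<le> \<delta> * norm x)"
    using norm_blinfun_bound[of \<delta> b] assms by auto
  then obtain z where z: "norm (b z) > \<delta> * norm z"
    by (auto simp: not_le)
  then have z0: "z \<noteq> 0"
    using blinfun.zero_right by force
  define x where "x = inverse (norm z) *\<^sub>R z"
  have bx: "norm (b x) > \<delta>"
    using z z0 by (simp add: x_def blinfun.scaleR_right field_simps)
  define y where "y = inverse (norm (b x)) *\<^sub>R b x"
  have bx0: "b x \<noteq> 0"
    using bx assms by auto
  then have "cmod (cinner (b x) y) = norm (b x)"
    by (simp add: y_def cinner_scaleC_right cinner_self norm_mult norm_inverse
        power2_eq_square flip: scaleC_of_real)
  moreover have "norm x \<le> 1" "norm y \<le> 1"
    using z0 bx0 by (simp add: x_def, simp add: y_def)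
  ultimately show ?thesis
    using that[of x y] bx by simp
qed

text \<open>If \<open>R\<^sub>n a\<close> does not converge in norm, a weak limit of vector functionals that almost
  attain the norms of \<open>a - R\<^sub>n a\<close> vanishes on all \<open>R\<^sub>m a\<close> but not at \<open>a\<close>. Passing to a
  subsequence, which is possible by separability, replaces the Hahn--Banach theorem.\<close>

lemma weakly_convergent_imp_convergent:
  fixes A :: "'h::complex_hilbert endo set" and R :: "nat \<Rightarrow> 'h endo \<Rightarrow> 'h endo"
  assumes A: "operator_algebra A" and sep: "separable_space (top_of_set A)"
    and mem: "\<And>n c. c \<in> A \<Longrightarrow> R n c \<in> A"
    and add: "\<And>n c d. c \<in> A \<Longrightarrow> d \<in> A \<Longrightarrow> R n (c + d) = R n c + R n d"
    and scale: "\<And>n z c. c \<in> A \<Longrightarrow> R n (op_scaleC z c) = op_scaleC z (R n c)"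
    and contr: "\<And>n c. c \<in> A \<Longrightarrow> norm (R n c) \<le> norm c"
    and absorb: "\<And>n m c. c \<in> A \<Longrightarrow> m \<le> n \<Longrightarrow> R n (R m c) = R m c"
    and a: "a \<in> A"
    and weak: "\<And>\<phi>. \<phi> \<in> dual A \<Longrightarrow> (\<lambda>n. \<phi> (R n a)) \<longlonglongrightarrow> \<phi> a"
  shows "(\<lambda>n. R n a) \<longlonglongrightarrow> a"
proof (rule ccontr)
  assume "\<not> ?thesis"
  then obtain \<delta> where \<delta>: "\<delta> > 0" "\<And>N. \<exists>n\<ge>N. norm (R n a - a) \<ge> \<delta>"
    unfolding lim_sequentially dist_norm not_all not_ex not_le by (metis not_le)
  then have "infinite {n. norm (R n a - a) \<ge> \<delta>}"
    by (auto simp: infinite_nat_iff_unbounded_le)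
  then obtain r :: "nat \<Rightarrow> nat" where r: "strict_mono r" "\<And>n. norm (R (r n) a - a) \<ge> \<delta>"
    by (metis (mono_tags) infinite_enumerate mem_Collect_eq)
  have "\<exists>x y. norm x \<le> 1 \<and> norm y \<le> 1 \<and> \<delta> / 2 \<le> cmod (cinner ((a - R (r n) a) x) y)" for n
  proof -
    have "\<delta> / 2 < norm (a - R (r n) a)"
      using \<delta>(1) r(2)[of n] by (simp add: norm_minus_commute)
    then show ?thesis
      using norm_attaining_vectors[of "\<delta> / 2" "a - R (r n) a"] \<delta>(1) by (metis half_gt_zero less_imp_le)
  qed
  then obtain x y where x: "\<And>n. norm (x n) \<le> 1" and y: "\<And>n. norm (y n) \<le> 1"
    and xy: "\<And>n. \<delta> / 2 \<le> cmod (cinner ((a - R (r n) a) (x n)) (y n))"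
    by metis
  define \<Phi> where "\<Phi> n c = cinner ((c - R (r n) c) (x n)) (y n)" for n c
  have \<Phi>_le: "cmod (\<Phi> n c) \<le> 2 * norm c" if c: "c \<in> A" for n c
  proof -
    have "cmod (\<Phi> n c) \<le> norm ((c - R (r n) c) (x n)) * norm (y n)"
      unfolding \<Phi>_def by (rule cmod_cinner_le)
    also have "\<dots> \<le> norm (c - R (r n) c) * norm (x n) * 1"
      by (intro mult_mono norm_blinfun y) auto
    also have "\<dots> \<le> norm (c - R (r n) c) * 1 * 1"
      by (intro mult_mono x) auto
    also have "\<dots> \<le> norm c + norm (R (r n) c)"
      by (simp add: norm_triangle_ineq4)
    finally show ?thesis
      using contr[OF c, of "r n"] by simp
  qed
  have \<Phi>_add: "\<Phi> n (c + d) = \<Phi> n c + \<Phi> n d" if "c \<in> A" "d \<in> A" for n c d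
    using that by (simp add: \<Phi>_def add blinfun.bilinear_simps cinner_add_left cinner_diff_left)
  have \<Phi>_scale: "\<Phi> n (op_scaleC z c) = z * \<Phi> n c" if "c \<in> A" for n z c
    using that
    by (simp add: \<Phi>_def scale blinfun.bilinear_simps cinner_diff_left cinner_scaleC_left
        right_diff_distrib)
  have \<Phi>_diff: "\<Phi> n (c - d) = \<Phi> n c - \<Phi> n d" if "c \<in> A" "d \<in> A" for n c d
    using \<Phi>_add[of "c - d" d] that operator_algebra_diff[OF A] by simp
  obtain C where C: "countable C" "C \<subseteq> A" "A \<subseteq> closure C"
    using separable_dense[OF sep] .
  \<comment> \<open>Dividing by \<open>norm c\<close> gives one bound for all
    \<open>c \<in> C\<close>, as the diagonal argument requires; for \<open>c = 0\<close> the
    quotient is \<open>0\<close>.\<close>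
  have "norm (\<Phi> n c / norm c) \<le> 2" if "c \<in> C" for n c
    using \<Phi>_le[of c n] that C(2) by (cases "c = 0") (auto simp: norm_divide field_simps)
  then obtain k :: "nat \<Rightarrow> nat" where k: "strict_mono k"
    and kC: "\<And>c. c \<in> C \<Longrightarrow> \<exists>l. (\<lambda>n. \<Phi> (k n) c / norm c) \<longlonglongrightarrow> l"
    using function_convergent_subsequence[OF C(1), of "\<lambda>n c. \<Phi> n c / norm c" 2] by metis
  have convC: "Cauchy (\<lambda>n. \<Phi> (k n) c)" if c: "c \<in> C" for c
  proof (cases "c = 0")
    case True
    then have "\<Phi> (k n) c = 0" for n
      using \<Phi>_le[OF operator_algebra_zero[OF A], of "k n"] by simp
    then show ?thesis by (simp add: Cauchy_def)
  next
    case False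
    obtain l where "(\<lambda>n. \<Phi> (k n) c / norm c) \<longlonglongrightarrow> l"
      using kC[OF c] by blast
    then have "(\<lambda>n. \<Phi> (k n) c / norm c * norm c) \<longlonglongrightarrow> l * norm c"
      by (intro tendsto_intros)
    with False show ?thesis
      by (auto intro!: LIMSEQ_imp_Cauchy)
  qed
  \<comment> \<open>Equicontinuity carries convergence from the dense set \<open>C\<close> to
    \<open>A\<close>. The distance \<open>e / 6\<close> is \<open>e / 3\<close> divided by the
    constant \<open>2\<close> of \<open>\<Phi>_le\<close>.\<close>
  have Cau: "Cauchy (\<lambda>n. \<Phi> (k n) c)" if c: "c \<in> A" for c
  proof (rule CauchyI)
    fix e :: real assume e: "e > 0"
    obtain d where d: "d \<in> C" "dist d c < e / 6"
      using c C(3) e closure_approachable[of c C] by (meson divide_pos_pos subsetD zero_less_numeral)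
    obtain M where M: "\<And>m n. m \<ge> M \<Longrightarrow> n \<ge> M \<Longrightarrow> norm (\<Phi> (k m) d - \<Phi> (k n) d) < e / 3"
      using CauchyD[OF convC[OF d(1)], of "e / 3"] e by auto
    have "norm (\<Phi> (k m) c - \<Phi> (k n) c) < e" if "m \<ge> M" "n \<ge> M" for m n
    proof -
      have "norm (\<Phi> i (c - d)) < e / 3" for i
        using \<Phi>_le[of "c - d" i] d C(2) c operator_algebra_diff[OF A]
        by (auto simp: dist_norm norm_minus_commute intro: order_le_less_trans)
      then have *: "norm (\<Phi> i c - \<Phi> i d) < e / 3" for i
        using \<Phi>_diff[of c d] c d C(2) by (metis subsetD)
      show ?thesis
        using *[of "k m"] *[of "k n"] M[OF that]
        by (simp add: norm_diff_triangle_less dist_norm[symmetric]) 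
          (smt (verit) dist_commute dist_triangle)
    qed
    then show "\<exists>M. \<forall>m\<ge>M. \<forall>n\<ge>M. norm (\<Phi> (k m) c - \<Phi> (k n) c) < e"
      by blast
  qed
  define \<phi> where "\<phi> c = (if c \<in> A then lim (\<lambda>n. \<Phi> (k n) c) else 0)" for c
  have lim: "(\<lambda>n. \<Phi> (k n) c) \<longlonglongrightarrow> \<phi> c" if "c \<in> A" for c
    using Cau[OF that] that by (simp add: \<phi>_def Cauchy_convergent_iff convergent_LIMSEQ_iff)
  have "\<phi> \<in> dual A"
  proof (rule dualI[where C = 2])
    show "\<phi> (c + d) = \<phi> c + \<phi> d" if "c \<in> A" "d \<in> A" for c d
    proof (rule LIMSEQ_unique[OF lim])
      show "(\<lambda>n. \<Phi> (k n) (c + d)) \<longlonglongrightarrow> \<phi> c + \<phi> d"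
        unfolding \<Phi>_add[OF that] by (intro tendsto_add lim that)
    qed (intro operator_algebra_add A that)
    show "\<phi> (op_scaleC z c) = z * \<phi> c" if "c \<in> A" for z c
    proof (rule LIMSEQ_unique[OF lim])
      show "(\<lambda>n. \<Phi> (k n) (op_scaleC z c)) \<longlonglongrightarrow> z * \<phi> c"
        unfolding \<Phi>_scale[OF that] by (intro tendsto_mult tendsto_const lim that)
    qed (intro operator_algebra_scaleC A that)
    show "cmod (\<phi> c) \<le> 2 * norm c" if "c \<in> A" for c
      using LIMSEQ_le_const2[OF tendsto_norm[OF lim[OF that]]] \<Phi>_le[OF that] by blast
  qed (simp add: \<phi>_def)
  then have "(\<lambda>m. \<phi> (R m a)) \<longlonglongrightarrow> \<phi> a"
    by (rule weak)
  moreover have "\<phi> (R m a) = 0" for m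
  proof (rule LIMSEQ_unique[OF lim])
    \<comment> \<open>As soon as the index \<open>r (k n)\<close> has reached \<open>m\<close>,
      absorption makes \<open>R m a\<close> a fixed point, and \<open>\<Phi>\<close> only sees the
      deviation from being fixed.\<close>
    have "\<Phi> (k n) (R m a) = 0" if "n \<ge> m" for n
    proof -
      have "m \<le> r (k n)"
        using that seq_suble[OF r(1), of "k n"] seq_suble[OF k, of n] by linarith
      then show ?thesis
        using absorb[OF a, of m "r (k n)"] by (simp add: \<Phi>_def) (metis cinner_diff_left diff_self)
    qed
    then show "(\<lambda>n. \<Phi> (k n) (R m a)) \<longlonglongrightarrow> 0"
      by (intro tendsto_eventually) (auto simp: eventually_sequentially)
  qed (rule mem[OF a])
  ultimately have "\<phi> a = 0"
    by (simp add: LIMSEQ_const_iff)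
  moreover have "\<delta> / 2 \<le> cmod (\<phi> a)"
    using LIMSEQ_le_const[OF tendsto_norm[OF lim[OF a]], of "\<delta> / 2"] xy unfolding \<Phi>_def by blast
  ultimately show False
    using \<delta>(1) by simp
qed

text \<open>For \<open>y\<close> in the range of \<open>p\<close>, expand the inequality \<open>\<parallel>u (y + t x)\<parallel>\<^sup>2 \<le> \<parallel>y + t x\<parallel>\<^sup>2\<close>.\<close>

lemma contraction_projection:
  fixes u p :: "'h::complex_hilbert endo"
  assumes p: "is_projection p" and u: "norm u \<le> 1"
    and t: "0 < t" "t \<le> 1" and near: "norm ((u o\<^sub>L p) - p) \<le> t\<^sup>2"
  shows "norm ((p o\<^sub>L u) - p) \<le> sqrt (7 * t)"
proof (rule norm_blinfun_bound)
  fix x :: 'h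
  have ule: "norm (u z) \<le> norm z" for z
    using norm_blinfun[of u z] mult_right_mono[OF u norm_ge_zero[of z]] by simp
  \<comment> \<open>The vector to be estimated, \<open>(p u - p) x\<close>. It lies in the range of
    \<open>p\<close>, so \<open>u\<close> nearly fixes it.\<close>
  define y where "y = p (u x - x)"
  define \<delta> where "\<delta> = t\<^sup>2"
  have \<delta>: "\<delta> \<ge> 0" "\<delta> \<le> t" "t * t = \<delta>"
    using t by (simp_all add: \<delta>_def power2_eq_square mult_left_le)
  have py: "p y = y"
    by (simp add: y_def projection_apply_idem[OF p])
  have y2: "norm y \<le> 2 * norm x"
    using projection_apply_le[OF p, of "u x - x"] norm_triangle_ineq4[of "u x" x] ule[of x]
    by (simp add: y_def)
  have uy: "norm (u y - y) \<le> \<delta> * norm y"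
  proof -
    have "u y - y = ((u o\<^sub>L p) - p) y"
      by (simp add: blinfun.diff_left py)
    then show ?thesis
      using norm_blinfun[of "(u o\<^sub>L p) - p" y] mult_right_mono[OF near norm_ge_zero[of y]]
      by (simp add: \<delta>_def)
  qed
  have "norm y - norm (u y) \<le> \<delta> * norm y"
    using uy norm_triangle_ineq2[of y "u y"] by (simp add: norm_minus_commute)
  then have "(norm y - norm (u y)) * (norm y + norm (u y)) \<le> (\<delta> * norm y) * (2 * norm y)"
    using ule[of y] \<delta> by (intro mult_mono) auto
  then have a1: "(norm y)\<^sup>2 - (norm (u y))\<^sup>2 \<le> 2 * \<delta> * (norm y)\<^sup>2"
    by (simp add: power2_eq_square algebra_simps)
  have "\<bar>inner (u y - y) (u x)\<bar> \<le> norm (u y - y) * norm (u x)"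
    by (rule Cauchy_Schwarz_ineq2)
  also have "\<dots> \<le> (\<delta> * norm y) * norm x"
    using \<delta> by (intro mult_mono uy ule) auto
  finally have a2: "inner y (u x) - \<delta> * norm y * norm x \<le> inner (u y) (u x)"
    by (simp add: inner_diff_left)
  have "norm (u (y + t *\<^sub>R x)) \<le> norm (y + t *\<^sub>R x)"
    by (rule ule)
  then have "(norm (u y + t *\<^sub>R u x))\<^sup>2 \<le> (norm (y + t *\<^sub>R x))\<^sup>2"
    by (simp add: blinfun.bilinear_simps power_mono)
  then have "(norm (u y))\<^sup>2 + 2 * t * inner (u y) (u x) + t * t * (norm (u x))\<^sup>2
      \<le> (norm y)\<^sup>2 + 2 * t * inner y x + t * t * (norm x)\<^sup>2"
    by (simp add: power2_norm_eq_inner inner_add algebra_simps inner_commute)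
  moreover have "0 \<le> t * t * (norm (u x))\<^sup>2"
    by simp
  moreover have "2 * t * (inner y (u x) - \<delta> * norm y * norm x) \<le> 2 * t * inner (u y) (u x)"
    using a2 t by (intro mult_left_mono) auto
  ultimately have "2 * t * (inner y (u x) - inner y x)
      \<le> 2 * \<delta> * (norm y)\<^sup>2 + 2 * t * \<delta> * (norm y * norm x) + t * t * (norm x)\<^sup>2"
    using a1 by (simp add: algebra_simps)
  moreover have "inner y (u x) - inner y x = (norm y)\<^sup>2"
  proof -
    have "(norm y)\<^sup>2 = inner y (p (u x - x))"
      by (simp add: power2_norm_eq_inner flip: y_def)
    also have "\<dots> = inner y (u x - x)"
      by (metis projection_inner[OF p] py)
    finally show ?thesis
      by (simp add: inner_diff_right)
  qed
  moreover have "2 * \<delta> * (norm y)\<^sup>2 \<le> 2 * \<delta> * (4 * (norm x)\<^sup>2)"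
    using power_mono[OF y2, of 2] \<delta> by (intro mult_left_mono) (auto simp: power_mult_distrib)
  moreover have "2 * t * \<delta> * (norm y * norm x) \<le> 2 * 1 * \<delta> * (2 * (norm x)\<^sup>2)"
  proof (rule mult_mono)
    show "2 * t * \<delta> \<le> 2 * 1 * \<delta>"
      using t \<delta> by (simp add: mult_left_le_one_le)
    show "norm y * norm x \<le> 2 * (norm x)\<^sup>2"
      using mult_right_mono[OF y2, of "norm x"] by (simp add: power2_eq_square)
  qed (use \<delta> in auto)
  \<comment> \<open>\<open>13 = 8 + 4 + 1\<close> collects the three error terms, all of order
    \<open>\<delta>\<close> because the hypothesis is quadratic in \<open>t\<close>. Dividing by
    \<open>2 * t\<close> leaves \<open>13 / 2\<close>, rounded up to the \<open>7\<close> of the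
    statement.\<close>
  ultimately have "2 * t * (norm y)\<^sup>2 \<le> 13 * \<delta> * (norm x)\<^sup>2"
    using \<delta>(3) by (simp add: algebra_simps)
  then have "t * (2 * (norm y)\<^sup>2) \<le> t * (13 * t * (norm x)\<^sup>2)"
    unfolding \<delta>(3)[symmetric] by (simp add: mult_ac)
  then have "2 * (norm y)\<^sup>2 \<le> 13 * t * (norm x)\<^sup>2"
    using t by simp
  moreover have "0 \<le> t * (norm x)\<^sup>2"
    using t by simp
  ultimately have "(norm y)\<^sup>2 \<le> 7 * (t * (norm x)\<^sup>2)"
    by linarith
  then have "(norm y)\<^sup>2 \<le> (sqrt (7 * t) * norm x)\<^sup>2"
    using t by (simp add: power_mult_distrib mult.assoc)
  then have "norm y \<le> sqrt (7 * t) * norm x"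
    by (rule power2_le_imp_le) (use t in simp)
  then show "norm (((p o\<^sub>L u) - p) x) \<le> sqrt (7 * t) * norm x"
    by (simp add: y_def blinfun.bilinear_simps)
qed (use t in simp)

text \<open>Substitute for passing to adjoints: a left approximate identity controls
  \<open>u p\<close>, and contractivity transfers this to \<open>p u\<close>.\<close>

lemma contraction_projection_tendsto:
  fixes p :: "'h::complex_hilbert endo"
  assumes p: "is_projection p" and U: "\<forall>\<^sub>F u in U. norm u \<le> 1"
    and lim: "((\<lambda>u. u o\<^sub>L p) \<longlongrightarrow> p) U"
  shows "((\<lambda>u. p o\<^sub>L u) \<longlongrightarrow> p) U"
proof (rule tendstoI)
  fix e :: real assume e: "e > 0"
  \<comment> \<open>Small enough for \<open>sqrt (7 * t) < e\<close>;
    \<open>contraction_projection\<close> also asks for \<open>t \<le> 1\<close>.\<close>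
  define t where "t = min 1 (e\<^sup>2 / 8)"
  have t: "0 < t" "t \<le> 1" "7 * t < e\<^sup>2"
    using e by (auto simp: t_def min_def)
  have le: "sqrt (7 * t) < e"
    using t e real_sqrt_less_mono[OF t(3)] by simp
  have "\<forall>\<^sub>F u in U. dist (u o\<^sub>L p) p < t\<^sup>2"
    using tendstoD[OF lim, of "t\<^sup>2"] t by simp
  with U show "\<forall>\<^sub>F u in U. dist (p o\<^sub>L u) p < e"
  proof eventually_elim
    case (elim u)
    then show ?case
      using contraction_projection[OF p _ t(1,2), of u] le by (simp add: dist_norm)
  qed
qed

text \<open>The functional \<open>F\<cdot>\<phi>\<close> of the Arens product. It is bounded because
  \<open>\<phi>\<cdot>a\<close> depends linearly on \<open>a\<close>, with norm at most a constant
  times \<open>norm a\<close>.\<close>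

lemma bidual_compose_mem_dual:
  assumes A: "operator_algebra A" and F: "F \<in> bidual A" and \<phi>: "\<phi> \<in> dual A"
  shows "(\<lambda>a. if a \<in> A then F (\<lambda>b. if b \<in> A then \<phi> (a o\<^sub>L b) else 0) else 0) \<in> dual A"
proof -
  define L where "L a = (\<lambda>b. if b \<in> A then \<phi> (a o\<^sub>L b) else 0)" for a
  have L: "L a \<in> dual A" if "a \<in> A" for a
    unfolding L_def by (rule dual_compose_left[OF A \<phi> that])
  obtain C where C: "C \<ge> 0" "\<And>a. a \<in> A \<Longrightarrow> cmod (\<phi> a) \<le> C * norm a"
    using dual_bound[OF \<phi>] by blast
  obtain D where D: "\<And>\<psi>. \<psi> \<in> dual A \<Longrightarrow> cmod (F \<psi>) \<le> D * dual_norm A \<psi>"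
    using F unfolding bidual_def by blast
  have F_add: "F (\<lambda>a. \<psi> a + \<psi>' a) = F \<psi> + F \<psi>'" if "\<psi> \<in> dual A" "\<psi>' \<in> dual A" for \<psi> \<psi>'
    using F that by (simp add: bidual_def)
  have F_scale: "F (\<lambda>a. c * \<psi> a) = c * F \<psi>" if "\<psi> \<in> dual A" for c \<psi>
    using F that by (simp add: bidual_def)
  have bound: "cmod (F (L a)) \<le> \<bar>D\<bar> * C * norm a" if a: "a \<in> A" for a
  proof -
    have "dual_norm A (L a) \<le> C * norm a"
      unfolding dual_norm_def
    proof (rule cSUP_least)
      fix b assume b: "b \<in> {b \<in> A. norm b \<le> 1}"
      have "cmod (L a b) \<le> C * norm (a o\<^sub>L b)"
        using a b C(2)[of "a o\<^sub>L b"] by (simp add: L_def operator_algebra_compose A)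
      also have "\<dots> \<le> C * (norm a * norm b)"
        by (intro mult_left_mono norm_blinfun_compose C)
      also have "\<dots> \<le> C * (norm a * 1)"
        using b by (intro mult_left_mono C) auto
      finally show "cmod (L a b) \<le> C * norm a"
        by simp
    qed (use operator_algebra_zero[OF A] in auto)
    moreover have "0 \<le> dual_norm A (L a)"
      using dual_norm_upper[OF L[OF a] operator_algebra_zero[OF A]] norm_ge_zero
      by (metis norm_zero order_trans zero_le_one)
    moreover have "cmod (F (L a)) \<le> \<bar>D\<bar> * dual_norm A (L a)"
      using D[OF L[OF a]] calculation(2) by (meson abs_ge_self mult_right_mono order_trans)
    ultimately show ?thesis
      using mult_left_mono[of "dual_norm A (L a)" "C * norm a" "\<bar>D\<bar>"] by (simp add: mult.assoc)
  qed
  show ?thesis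
    unfolding L_def[symmetric]
  proof (rule dualI[where C = "\<bar>D\<bar> * C"])
    fix a b assume ab: "a \<in> A" "b \<in> A"
    have "L (a + b) = (\<lambda>c. L a c + L b c)"
      using ab by (auto simp: L_def fun_eq_iff compose_simps dual_add[OF \<phi>] operator_algebra_compose A)
    then show "(if a + b \<in> A then F (L (a + b)) else 0) =
        (if a \<in> A then F (L a) else 0) + (if b \<in> A then F (L b) else 0)"
      using ab by (simp add: F_add L operator_algebra_add A)
  next
    fix c a assume a: "a \<in> A"
    have "L (op_scaleC c a) = (\<lambda>b. c * L a b)"
      using a by (auto simp: L_def fun_eq_iff op_scaleC_compose_left dual_scaleC[OF \<phi>]
          operator_algebra_compose A)
    then show "(if op_scaleC c a \<in> A then F (L (op_scaleC c a)) else 0) =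
        c * (if a \<in> A then F (L a) else 0)"
      using a by (simp add: F_scale L operator_algebra_scaleC A)
  qed (simp_all add: bound)
qed

section \<open>Increasing sequences of projections\<close>

locale projection_sequence =
  fixes A :: "'h::complex_hilbert endo set" and s :: "nat \<Rightarrow> 'h endo"
  assumes algebra: "operator_algebra A"
    and s_mem: "s n \<in> A"
    and s_projection: "is_projection (s n)"
    and s_compose: "s m o\<^sub>L s n = s (min m n)"
begin

lemma s_apply: "blinfun_apply (s m) (blinfun_apply (s n) x) = s (min m n) x"
  by (metis blinfun_apply_blinfun_compose s_compose)

lemma s_absorb: "m \<le> n \<Longrightarrow> s n o\<^sub>L (s m o\<^sub>L a) = s m o\<^sub>L a"
  and s_absorb_right: "m \<le> n \<Longrightarrow> (a o\<^sub>L s m) o\<^sub>L s n = a o\<^sub>L s m"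
  by (simp_all add: s_compose min_absorb2 min_absorb1 compose_assoc flip: compose_assoc[of _ _ a])

lemma norm_s_le: "norm (s n) \<le> 1"
  by (rule norm_projection_le[OF s_projection])

lemma s_diff_apply_le: "norm (s n x - s m x) \<le> norm x"
proof -
  have *: "norm (s n x - s m x) \<le> norm x" if "m \<le> n" for m n
  proof -
    have "s m x = s m (s n x)"
      using that by (simp add: s_apply min_absorb1)
    then have "(norm (s n x - s m x))\<^sup>2 \<le> (norm (s n x))\<^sup>2"
      using projection_pythagoras[OF s_projection, of "s n x" m] by simp
    then show ?thesis
      using projection_apply_le[OF s_projection, of n x] by (auto dest: power2_le_imp_le)
  qed
  show ?thesis
    using *[of m n] *[of n m] by (cases "m \<le> n") (auto simp: norm_minus_commute)
qed

text \<open>If \<open>\<phi>\<close> were of size \<open>\<epsilon>\<close> on infinitely many blocks \<open>D\<^sub>k u\<^sub>k\<close> with orthogonal projections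
  \<open>D\<^sub>k\<close> and contractions \<open>u\<^sub>k\<close>, then with suitable phases \<open>c\<^sub>k\<close> it would be at least \<open>K \<epsilon>\<close> on
  \<open>c\<^sub>1 D\<^sub>1 u\<^sub>1 + \<dots> + c\<^sub>K D\<^sub>K u\<^sub>K\<close>, an operator of norm at most \<open>\<surd>K\<close>.\<close>

lemma dual_uniformly_Cauchy:
  assumes \<phi>: "\<phi> \<in> dual A" and \<epsilon>: "\<epsilon> > 0"
  shows "\<exists>N. \<forall>m\<ge>N. \<forall>n\<ge>N. \<forall>u\<in>A. norm u \<le> 1 \<longrightarrow> cmod (\<phi> ((s n - s m) o\<^sub>L u)) < \<epsilon>"
proof (rule ccontr)
  assume "\<not> ?thesis"
  then have block: "\<exists>m\<ge>N. \<exists>n\<ge>N. \<exists>u\<in>A. norm u \<le> 1 \<and> \<epsilon> \<le> cmod (\<phi> ((s n - s m) o\<^sub>L u))" for N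
    by (metis not_less)
  \<comment> \<open>The condition \<open>s M (w x) = w x\<close> keeps \<open>w\<close> in the range
    of \<open>s M\<close>. A further block taken beyond \<open>M\<close> has its range orthogonal to
    that, so squared norms add up while \<open>\<phi>\<close> gains at least
    \<open>\<epsilon>\<close> in each step.\<close>
  have sum: "\<exists>w M. w \<in> A \<and> (\<forall>x. s M (w x) = w x) \<and>
      (\<forall>x. (norm (w x))\<^sup>2 \<le> real K * (norm x)\<^sup>2) \<and> real K * \<epsilon> \<le> Re (\<phi> w)" for K
  proof (induction K)
    case 0
    have "\<phi> 0 = 0"
      using dual_scaleC[OF \<phi>, of 0 0] operator_algebra_zero[OF algebra] by simp
    then show ?case
      by (intro exI[of _ 0]) (simp add: operator_algebra_zero[OF algebra])
  next
    case (Suc K)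
    then obtain w M where w: "w \<in> A" "\<And>x. s M (w x) = w x"
      "\<And>x. (norm (w x))\<^sup>2 \<le> real K * (norm x)\<^sup>2" "real K * \<epsilon> \<le> Re (\<phi> w)"
      by blast
    obtain m n u where mn: "M \<le> m" "M \<le> n" and u: "u \<in> A" "norm u \<le> 1"
      and big: "\<epsilon> \<le> cmod (\<phi> ((s n - s m) o\<^sub>L u))"
      using block[of M] by blast
    define v where "v = (s n - s m) o\<^sub>L u"
    have v: "v \<in> A"
      unfolding v_def by (intro operator_algebra_intros algebra s_mem u)
    have \<phi>v: "\<phi> v \<noteq> 0"
      using big \<epsilon> by (auto simp: v_def)
    define c where "c = cnj (\<phi> v) / cmod (\<phi> v)"
    have c: "cmod c = 1"
      using \<phi>v by (simp add: c_def norm_divide)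
    have c\<phi>: "c * \<phi> v = cmod (\<phi> v)"
      using \<phi>v by (simp add: c_def complex_norm_square[symmetric] field_simps power2_eq_square)
    define w' where "w' = w + op_scaleC c v"
    have w'_apply: "w' x = w x + c *\<^sub>C v x" for x
      by (simp add: w'_def blinfun.add_left)
    have scale: "s i (z *\<^sub>C x) = z *\<^sub>C s i x" for i z x
      using projection_BH[OF s_projection] by (auto simp: BH_def)
    have v_apply: "v x = s n (u x) - s m (u x)" for x
      by (simp add: v_def blinfun.diff_left)
    have v_le: "norm (v x) \<le> norm x" for x
    proof -
      have "norm (v x) \<le> norm (u x)"
        unfolding v_apply by (rule s_diff_apply_le)
      also have "\<dots> \<le> norm x"
        using norm_blinfun[of u x] mult_right_mono[OF u(2) norm_ge_zero[of x]] by simp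
      finally show ?thesis .
    qed
    have "w' \<in> A"
      unfolding w'_def by (intro operator_algebra_intros algebra v w)
    moreover have "s (max m n) (w' x) = w' x" for x
    proof -
      have "s (max m n) (s M (w x)) = s M (w x)"
        using mn by (simp add: s_apply min_def)
      then show ?thesis
        by (simp add: w'_apply w(2) blinfun.add_right blinfun.diff_right v_apply scale s_apply)
    qed
    moreover have "(norm (w' x))\<^sup>2 \<le> real (Suc K) * (norm x)\<^sup>2" for x
    proof -
      have "s M (c *\<^sub>C v x) = 0"
        using mn by (simp add: scale v_apply blinfun.diff_right s_apply min_def)
      then have "inner (w x) (c *\<^sub>C v x) = 0"
        by (metis inner_zero_right projection_inner s_projection w(2))
      then have "(norm (w' x))\<^sup>2 = (norm (w x))\<^sup>2 + (norm (v x))\<^sup>2"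
        by (simp add: w'_apply norm_add_Pythagorean orthogonal_def norm_scaleC c)
      also have "\<dots> \<le> real K * (norm x)\<^sup>2 + (norm x)\<^sup>2"
        by (intro add_mono w power_mono v_le) simp
      finally show ?thesis
        by (simp add: algebra_simps)
    qed
    moreover have "real (Suc K) * \<epsilon> \<le> Re (\<phi> w')"
    proof -
      have "\<phi> w' = \<phi> w + cmod (\<phi> v)"
        using v w(1) operator_algebra_scaleC[OF algebra]
        by (simp add: w'_def dual_add[OF \<phi>] dual_scaleC[OF \<phi>] c\<phi>)
      then show ?thesis
        using w(4) big by (simp add: v_def algebra_simps)
    qed
    ultimately show ?case
      by blast
  qed
  obtain C where C: "C \<ge> 0" "\<And>a. a \<in> A \<Longrightarrow> cmod (\<phi> a) \<le> C * norm a"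
    using dual_bound[OF \<phi>] by blast
  \<comment> \<open>\<open>K \<epsilon> \<le> C \<surd>K\<close> would force
    \<open>K \<le> C\<^sup>2 / \<epsilon>\<^sup>2\<close>.\<close>
  obtain K :: nat where K: "C\<^sup>2 / \<epsilon>\<^sup>2 < real K"
    using reals_Archimedean2 by blast
  then have K0: "real K > 0"
    by (smt (verit) zero_le_divide_iff zero_le_power2)
  obtain w where w: "w \<in> A" "\<And>x. (norm (w x))\<^sup>2 \<le> real K * (norm x)\<^sup>2" "real K * \<epsilon> \<le> Re (\<phi> w)"
    using sum[of K] by blast
  have "norm w \<le> sqrt (real K)"
  proof (rule norm_blinfun_bound)
    show "norm (w x) \<le> sqrt (real K) * norm x" for x
      by (rule power2_le_imp_le) (use w(2)[of x] in \<open>simp_all add: power_mult_distrib\<close>)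
  qed simp
  then have "real K * \<epsilon> \<le> C * sqrt (real K)"
    using w(3) C(2)[OF w(1)] complex_Re_le_cmod[of "\<phi> w"] mult_left_mono[OF _ C(1)]
    by (meson order_trans)
  then have "(real K * \<epsilon>)\<^sup>2 \<le> (C * sqrt (real K))\<^sup>2"
    using \<epsilon> by (intro power_mono) auto
  then have "real K * (real K * \<epsilon>\<^sup>2) \<le> real K * C\<^sup>2"
    by (simp add: power_mult_distrib power2_eq_square algebra_simps)
  then have "real K * \<epsilon>\<^sup>2 \<le> C\<^sup>2"
    using K0 by simp
  with K \<epsilon> show False
    by (simp add: field_simps)
qed

section \<open>The weak* limit of the projections and its Arens products\<close>

lemma dual_Cauchy:
  assumes \<phi>: "\<phi> \<in> dual A"
  shows "Cauchy (\<lambda>n. \<phi> (s n))"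
proof (rule CauchyI)
  fix e :: real assume "e > 0"
  then obtain N where N: "\<And>m n u. m \<ge> N \<Longrightarrow> n \<ge> N \<Longrightarrow> u \<in> A \<Longrightarrow> norm u \<le> 1
      \<Longrightarrow> cmod (\<phi> ((s n - s m) o\<^sub>L u)) < e"
    using dual_uniformly_Cauchy[OF \<phi>] by meson
  have "norm (\<phi> (s m) - \<phi> (s n)) < e" if "m \<ge> N" "n \<ge> N" for m n
  proof -
    \<comment> \<open>The contraction \<open>u = s (max m n)\<close> turns the uniform estimate into
      one for \<open>s m - s n\<close> itself.\<close>
    have "(s m - s n) o\<^sub>L s (max m n) = s m - s n"
      by (simp add: compose_simps s_compose)
    then show ?thesis
      using N[OF that(2,1) s_mem[of "max m n"] norm_s_le] dual_diff[OF algebra \<phi> s_mem s_mem]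
      by simp
  qed
  then show "\<exists>M. \<forall>m\<ge>M. \<forall>n\<ge>M. norm (\<phi> (s m) - \<phi> (s n)) < e"
    by blast
qed

text \<open>The candidate for the support projection, called \<open>f\<close> below. It is
  \<open>0\<close> off \<open>dual A\<close> because membership in \<open>bidual\<close> demands
  that.\<close>

definition limit_functional :: "('h endo \<Rightarrow> complex) \<Rightarrow> complex"
  where "limit_functional \<phi> = (if \<phi> \<in> dual A then lim (\<lambda>n. \<phi> (s n)) else 0)"

lemma limit_functional_tendsto:
  "\<phi> \<in> dual A \<Longrightarrow> (\<lambda>n. \<phi> (s n)) \<longlonglongrightarrow> limit_functional \<phi>"
  using dual_Cauchy[of \<phi>]
  by (simp add: limit_functional_def Cauchy_convergent_iff convergent_LIMSEQ_iff)

lemma limit_functional_bound: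
  assumes \<phi>: "\<phi> \<in> dual A"
  shows "cmod (limit_functional \<phi>) \<le> dual_norm A \<phi>"
  using LIMSEQ_le_const2[OF tendsto_norm[OF limit_functional_tendsto[OF \<phi>]]]
    dual_norm_upper[OF \<phi> s_mem norm_s_le] by blast

lemma limit_functional_bidual: "limit_functional \<in> bidual A"
proof -
  have "limit_functional (\<lambda>a. \<phi> a + \<psi> a) = limit_functional \<phi> + limit_functional \<psi>"
    if "\<phi> \<in> dual A" "\<psi> \<in> dual A" for \<phi> \<psi>
    by (rule LIMSEQ_unique[OF limit_functional_tendsto[OF dual_plus[OF that]]])
      (intro tendsto_add limit_functional_tendsto that)
  moreover have "limit_functional (\<lambda>a. c * \<phi> a) = c * limit_functional \<phi>"
    if "\<phi> \<in> dual A" for c \<phi>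
    by (rule LIMSEQ_unique[OF limit_functional_tendsto[OF dual_times[OF that]]])
      (intro tendsto_mult tendsto_const limit_functional_tendsto that)
  moreover have "\<forall>\<phi>. \<phi> \<notin> dual A \<longrightarrow> limit_functional \<phi> = 0"
    by (simp add: limit_functional_def)
  moreover have "\<forall>\<phi>\<in>dual A. cmod (limit_functional \<phi>) \<le> 1 * dual_norm A \<phi>"
    by (simp add: limit_functional_bound)
  ultimately show ?thesis
    unfolding bidual_def by blast
qed

text \<open>The functional \<open>f\<cdot>\<phi>\<close> of the Arens product, with the values
  \<open>lim \<phi> (a s n)\<close>. Multiplying by \<open>f\<close> on the right in the bidual is
  composition with this map.\<close>

definition right_limit :: "('h endo \<Rightarrow> complex) \<Rightarrow> 'h endo \<Rightarrow> complex"
  where "right_limit \<phi> =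
    (\<lambda>a. if a \<in> A then limit_functional (\<lambda>b. if b \<in> A then \<phi> (a o\<^sub>L b) else 0) else 0)"

lemma right_limit_tendsto:
  assumes "\<phi> \<in> dual A" "a \<in> A"
  shows "(\<lambda>n. \<phi> (a o\<^sub>L s n)) \<longlonglongrightarrow> right_limit \<phi> a"
  using limit_functional_tendsto[OF dual_compose_left[OF algebra assms]] assms(2)
  by (simp add: right_limit_def s_mem)

lemma right_limit_mem:
  assumes \<phi>: "\<phi> \<in> dual A"
  shows "right_limit \<phi> \<in> dual A"
proof -
  obtain C where C: "C \<ge> 0" "\<And>a. a \<in> A \<Longrightarrow> cmod (\<phi> a) \<le> C * norm a"
    using dual_bound[OF \<phi>] by blast
  have as: "a o\<^sub>L s n \<in> A" if "a \<in> A" for a n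
    by (intro operator_algebra_compose algebra that s_mem)
  show ?thesis
  proof (rule dualI[where C = C])
    show "right_limit \<phi> (a + b) = right_limit \<phi> a + right_limit \<phi> b" if "a \<in> A" "b \<in> A" for a b
    proof (rule LIMSEQ_unique[OF right_limit_tendsto[OF \<phi>]])
      show "(\<lambda>n. \<phi> ((a + b) o\<^sub>L s n)) \<longlonglongrightarrow> right_limit \<phi> a + right_limit \<phi> b"
        unfolding compose_simps dual_add[OF \<phi> as[OF that(1)] as[OF that(2)]]
        by (intro tendsto_add right_limit_tendsto \<phi> that)
    qed (intro operator_algebra_add algebra that)
    show "right_limit \<phi> (op_scaleC c a) = c * right_limit \<phi> a" if "a \<in> A" for c a
    proof (rule LIMSEQ_unique[OF right_limit_tendsto[OF \<phi>]])
      show "(\<lambda>n. \<phi> (op_scaleC c a o\<^sub>L s n)) \<longlonglongrightarrow> c * right_limit \<phi> a"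
        unfolding op_scaleC_compose_left dual_scaleC[OF \<phi> as[OF that]]
        by (intro tendsto_mult tendsto_const right_limit_tendsto \<phi> that)
    qed (intro operator_algebra_scaleC algebra that)
    show "cmod (right_limit \<phi> a) \<le> C * norm a" if "a \<in> A" for a
    proof (rule LIMSEQ_le_const2[OF tendsto_norm[OF right_limit_tendsto[OF \<phi> that]]])
      have "norm (a o\<^sub>L s n) \<le> norm a" for n
        using norm_blinfun_compose[of a "s n"] mult_left_mono[OF norm_s_le[of n] norm_ge_zero[of a]]
        by simp
      then have "cmod (\<phi> (a o\<^sub>L s n)) \<le> C * norm a" for n
        using C(2)[OF as[OF that, of n]] mult_left_mono[OF _ C(1)] by (meson order_trans)
      then show "\<exists>N. \<forall>n\<ge>N. cmod (\<phi> (a o\<^sub>L s n)) \<le> C * norm a"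
        by blast
    qed
  qed (simp add: right_limit_def)
qed

text \<open>This is \<open>(a s n) f = a s n\<close>, tested on functionals: the sequence defining
  the limit is stationary from index \<open>n\<close> on.\<close>

lemma right_limit_compose:
  assumes "\<phi> \<in> dual A" "a \<in> A"
  shows "right_limit \<phi> (a o\<^sub>L s n) = \<phi> (a o\<^sub>L s n)"
proof (rule LIMSEQ_unique[OF right_limit_tendsto])
  have "\<forall>\<^sub>F k in sequentially. \<phi> ((a o\<^sub>L s n) o\<^sub>L s k) = \<phi> (a o\<^sub>L s n)"
    by (auto simp: eventually_sequentially s_absorb_right intro!: exI[of _ n])
  then show "(\<lambda>k. \<phi> ((a o\<^sub>L s n) o\<^sub>L s k)) \<longlonglongrightarrow> \<phi> (a o\<^sub>L s n)"
    by (rule tendsto_eventually)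
qed (use assms in \<open>auto intro: operator_algebra_compose algebra s_mem\<close>)

lemma right_limit_idem:
  assumes \<phi>: "\<phi> \<in> dual A"
  shows "right_limit (right_limit \<phi>) = right_limit \<phi>"
proof
  fix a
  show "right_limit (right_limit \<phi>) a = right_limit \<phi> a"
  proof (cases "a \<in> A")
    case True
    then show ?thesis
      using right_limit_tendsto[OF right_limit_mem[OF \<phi>] True] right_limit_tendsto[OF \<phi> True]
      by (auto simp: right_limit_compose \<phi> intro: LIMSEQ_unique)
  qed (simp add: right_limit_def)
qed

lemma arens_limit_functional_right:
  "arens A F limit_functional = (\<lambda>\<phi>. if \<phi> \<in> dual A then F (right_limit \<phi>) else 0)"
  by (simp add: arens_def right_limit_def fun_eq_iff)

lemma limit_functional_projection: "bidual_projection A limit_functional"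
  unfolding bidual_projection_def
proof (intro conjI)
  have "limit_functional (right_limit \<phi>) = limit_functional \<phi>" if \<phi>: "\<phi> \<in> dual A" for \<phi>
  proof -
    have "right_limit \<phi> (s n) = \<phi> (s n)" for n
      using right_limit_compose[OF \<phi> s_mem, of n n] by (simp add: s_compose)
    then show ?thesis
      using limit_functional_tendsto[OF \<phi>] limit_functional_tendsto[OF right_limit_mem[OF \<phi>]]
      by (auto intro: LIMSEQ_unique)
  qed
  then show "arens A limit_functional limit_functional = limit_functional"
    unfolding arens_limit_functional_right by (auto simp: fun_eq_iff limit_functional_def)
  show "bidual_norm A limit_functional \<le> 1"
    unfolding bidual_norm_def
  proof (rule cSUP_least)
    have "dual_norm A (\<lambda>a. 0) \<le> 1"
      unfolding dual_norm_def using operator_algebra_zero[OF algebra] by (intro cSUP_least) auto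
    then show "{\<phi> \<in> dual A. dual_norm A \<phi> \<le> 1} \<noteq> {}"
      using zero_mem_dual by blast
  qed (use limit_functional_bound in \<open>auto intro: order_trans\<close>)
qed (rule limit_functional_bidual)

text \<open>The sequence \<open>s\<close> itself supplies one admissible limit, and every other
  admissible \<open>f\<close> agrees with it. For contractions \<open>u \<in> J\<close> the value
  \<open>\<phi> u\<close> is close to \<open>\<phi> (s n u)\<close> uniformly in \<open>u\<close>;
  along \<open>U\<close> the latter tends to \<open>\<phi> (s n)\<close>, which is close to
  \<open>limit_functional \<phi>\<close>.\<close>

lemma support_projection_eq:
  assumes J: "J \<subseteq> A" "\<And>n. s n \<in> J" and cai: "\<And>x. x \<in> J \<Longrightarrow> (\<lambda>n. s n o\<^sub>L x) \<longlonglongrightarrow> x"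
  shows "support_projection A J = limit_functional"
  unfolding support_projection_def
proof (rule some_equality)
  have "left_cai J (filtermap s sequentially)"
    by (auto simp: left_cai_def filtermap_bot_iff eventually_filtermap filterlim_filtermap
        J norm_s_le cai)
  moreover have "weak_star_limit A (filtermap s sequentially) limit_functional"
    by (simp add: weak_star_limit_def filterlim_filtermap bidual_embed_def limit_functional_tendsto)
  ultimately show "bidual_projection A limit_functional \<and>
      (\<exists>U. left_cai J U \<and> weak_star_limit A U limit_functional)"
    using limit_functional_projection by blast
next
  fix f assume "bidual_projection A f \<and> (\<exists>U. left_cai J U \<and> weak_star_limit A U f)"
  then obtain U where f: "f \<in> bidual A" and U: "left_cai J U" and lim: "weak_star_limit A U f"
    by (auto simp: bidual_projection_def)
  have U_bot: "U \<noteq> bot" and U_ball: "\<forall>\<^sub>F u in U. u \<in> J \<and> norm u \<le> 1"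
    using U by (auto simp: left_cai_def)
  have "f \<phi> = limit_functional \<phi>" if \<phi>: "\<phi> \<in> dual A" for \<phi>
  proof (rule tendsto_unique[OF U_bot])
    show "(\<phi> \<longlongrightarrow> f \<phi>) U"
      using lim \<phi> by (simp add: weak_star_limit_def bidual_embed_def)
    show "(\<phi> \<longlongrightarrow> limit_functional \<phi>) U"
    proof (rule tendstoI)
      fix e :: real assume e: "e > 0"
      then obtain N where N: "\<And>m n u. m \<ge> N \<Longrightarrow> n \<ge> N \<Longrightarrow> u \<in> A \<Longrightarrow> norm u \<le> 1
          \<Longrightarrow> cmod (\<phi> ((s n - s m) o\<^sub>L u)) < e / 3"
        using dual_uniformly_Cauchy[OF \<phi>, of "e / 3"] by (auto simp: Ball_def)
      obtain n where n: "n \<ge> N" "dist (\<phi> (s n)) (limit_functional \<phi>) < e / 3"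
        using tendstoD[OF limit_functional_tendsto[OF \<phi>], of "e / 3"] e
        by (metis (no_types, lifting) divide_pos_pos eventually_sequentially nle_le zero_less_numeral)
      \<comment> \<open>The uniform estimate compares \<open>s k u\<close> with
        \<open>s n u\<close>. Since \<open>u \<in> J\<close>, letting \<open>k\<close> grow replaces
        \<open>s k u\<close> by \<open>u\<close>.\<close>
      have su: "dist (\<phi> u) (\<phi> (s n o\<^sub>L u)) \<le> e / 3" if u: "u \<in> J" "norm u \<le> 1" for u
      proof -
        have uA: "u \<in> A" using J u by blast
        have sA: "s k o\<^sub>L u \<in> A" for k
          by (intro operator_algebra_compose algebra s_mem uA)
        have "(\<lambda>k. dist (\<phi> (s k o\<^sub>L u)) (\<phi> (s n o\<^sub>L u))) \<longlonglongrightarrow> dist (\<phi> u) (\<phi> (s n o\<^sub>L u))"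
          using dual_tendsto[OF algebra \<phi> uA _ cai[OF u(1)]] sA by (intro tendsto_dist tendsto_const) auto
        moreover have "dist (\<phi> (s k o\<^sub>L u)) (\<phi> (s n o\<^sub>L u)) \<le> e / 3" if "k \<ge> N" for k
        proof -
          have "\<phi> ((s k - s n) o\<^sub>L u) = \<phi> (s k o\<^sub>L u) - \<phi> (s n o\<^sub>L u)"
            by (simp add: compose_simps dual_diff[OF algebra \<phi> sA sA])
          then show ?thesis
            using N[OF n(1) that uA u(2)] by (simp add: dist_norm)
        qed
        ultimately show ?thesis
          using LIMSEQ_le_const2 by blast
      qed
      \<comment> \<open>Membership \<open>s n \<in> J\<close> yields convergence of
        \<open>u (s n)\<close> only; the reversed product relies on the contractivity of
        \<open>u\<close>.\<close>
      have "((\<lambda>u. s n o\<^sub>L u) \<longlongrightarrow> s n) U"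
      proof (rule contraction_projection_tendsto[OF s_projection])
        show "\<forall>\<^sub>F u in U. norm u \<le> 1"
          using U_ball by (rule eventually_mono) simp
        show "((\<lambda>u. u o\<^sub>L s n) \<longlongrightarrow> s n) U"
          using U J by (simp add: left_cai_def)
      qed
      then have "((\<lambda>u. \<phi> (s n o\<^sub>L u)) \<longlongrightarrow> \<phi> (s n)) U"
      proof (rule dual_tendsto[OF algebra \<phi> s_mem, rotated])
        show "\<forall>\<^sub>F u in U. s n o\<^sub>L u \<in> A"
          using U_ball by (rule eventually_mono)
            (use J in \<open>auto intro: operator_algebra_compose algebra s_mem\<close>)
      qed
      then have "\<forall>\<^sub>F u in U. dist (\<phi> (s n o\<^sub>L u)) (\<phi> (s n)) < e / 3"
        using e by (intro tendstoD) auto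
      with U_ball show "\<forall>\<^sub>F u in U. dist (\<phi> u) (limit_functional \<phi>) < e"
      proof eventually_elim
        case (elim u)
        then show ?case
          using su[of u] n(2) dist_triangle[of "\<phi> u" "limit_functional \<phi>" "\<phi> (s n o\<^sub>L u)"]
            dist_triangle[of "\<phi> (s n o\<^sub>L u)" "limit_functional \<phi>" "\<phi> (s n)"]
          by simp
      qed
    qed
  qed
  then show "f = limit_functional"
    using f by (auto simp: fun_eq_iff bidual_def limit_functional_def)
qed

section \<open>The h-socle described by norm limits\<close>

definition corner :: "'h endo set"
  where "corner = {a \<in> A. (\<lambda>n. s n o\<^sub>L a) \<longlonglongrightarrow> a \<and> (\<lambda>n. a o\<^sub>L s n) \<longlonglongrightarrow> a}"

text \<open>For \<open>a = (f F) f\<close> the Arens formula expresses \<open>\<phi> a\<close>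
  through limits over \<open>s n\<close>, which shows that \<open>s n a\<close> and
  \<open>a s n\<close> converge weakly to \<open>a\<close>;
  \<open>weakly_convergent_imp_convergent\<close> then applies to left and to right multiplication.
  In the converse direction the image of \<open>a\<close> in the bidual serves as
  \<open>F\<close>.\<close>

lemma h_soc_eq_corner:
  assumes supp: "support_projection A (r_soc A) = limit_functional"
    and sep: "separable_space (top_of_set A)"
  shows "h_soc A = corner"
proof (intro equalityI subsetI)
  fix a assume "a \<in> h_soc A"
  then obtain F where a: "a \<in> A" and F: "F \<in> bidual A"
    and "bidual_embed A a = arens A (arens A limit_functional F) limit_functional"
    by (auto simp: h_soc_def supp Let_def)
  then have eq: "\<phi> a = arens A limit_functional F (right_limit \<phi>)" if "\<phi> \<in> dual A" for \<phi>
    using that by (simp add: fun_eq_iff bidual_embed_def arens_limit_functional_right split: if_splits)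
  \<comment> \<open>Since \<open>f\<cdot>(f\<cdot>\<phi>) = f\<cdot>\<phi>\<close>, the element
    \<open>a\<close>, having \<open>f\<close> as its last factor, is fixed by \<open>f\<close> on
    the right.\<close>
  have right: "\<phi> a = right_limit \<phi> a" if \<phi>: "\<phi> \<in> dual A" for \<phi>
    using eq[OF \<phi>] eq[OF right_limit_mem[OF \<phi>]] by (simp add: right_limit_idem[OF \<phi>])
  have left: "(\<lambda>n. \<phi> (s n o\<^sub>L a)) \<longlonglongrightarrow> \<phi> a" if \<phi>: "\<phi> \<in> dual A" for \<phi>
  proof -
    \<comment> \<open>\<open>G\<close> is \<open>F\<cdot>(f\<cdot>\<phi>)\<close>, and
      \<open>\<phi> a\<close> is the limit of \<open>G (s m)\<close>. The claim
      \<open>\<phi> (s m a) = G (s m)\<close> amounts to \<open>s m (f F f) = s m F f\<close>, that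
      is, to the absorption \<open>s m f = s m\<close>.\<close>
    define G where "G = (\<lambda>c. if c \<in> A then F (\<lambda>b. if b \<in> A then right_limit \<phi> (c o\<^sub>L b) else 0) else 0)"
    have "\<phi> (s m o\<^sub>L a) = G (s m)" for m
    proof -
      define \<psi> where "\<psi> = (\<lambda>b. if b \<in> A then \<phi> (s m o\<^sub>L b) else 0)"
      have \<psi>: "\<psi> \<in> dual A"
        unfolding \<psi>_def by (rule dual_compose_left[OF algebra \<phi> s_mem])
      have \<psi>r: "right_limit \<psi> c = right_limit \<phi> (s m o\<^sub>L c)" if c: "c \<in> A" for c
      proof (rule LIMSEQ_unique[OF right_limit_tendsto[OF \<psi> c]])
        have "\<psi> (c o\<^sub>L s n) = \<phi> ((s m o\<^sub>L c) o\<^sub>L s n)" for n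
          using c by (simp add: \<psi>_def operator_algebra_compose algebra s_mem compose_assoc)
        then show "(\<lambda>n. \<psi> (c o\<^sub>L s n)) \<longlonglongrightarrow> right_limit \<phi> (s m o\<^sub>L c)"
          using right_limit_tendsto[OF \<phi> operator_algebra_compose[OF algebra s_mem[of m] c]] by simp
      qed
      define H where "H = (\<lambda>c. if c \<in> A then F (\<lambda>b. if b \<in> A then right_limit \<psi> (c o\<^sub>L b) else 0) else 0)"
      have H: "H \<in> dual A"
        unfolding H_def by (intro bidual_compose_mem_dual algebra F right_limit_mem \<psi>)
      have "\<phi> (s m o\<^sub>L a) = \<psi> a"
        using a by (simp add: \<psi>_def)
      also have "\<dots> = limit_functional H"
        unfolding eq[OF \<psi>] H_def by (simp add: arens_def right_limit_mem[OF \<psi>])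
      also have "\<dots> = G (s m)"
      proof -
        \<comment> \<open>For \<open>n \<ge> m\<close> the product \<open>s m (s n b)\<close> is
          \<open>s m b\<close>, so \<open>n\<close> disappears and the limit over \<open>n\<close>
          is attained.\<close>
        have "H (s n) = G (s m)" if "n \<ge> m" for n
        proof -
          have "right_limit \<psi> (s n o\<^sub>L b) = right_limit \<phi> (s m o\<^sub>L b)" if "b \<in> A" for b
            using that \<open>n \<ge> m\<close>
            by (simp add: \<psi>r operator_algebra_compose algebra s_mem s_compose min_absorb1
              flip: compose_assoc)
          then show ?thesis
            by (simp add: H_def G_def s_mem cong: if_cong)
        qed
        then have "(\<lambda>n. H (s n)) \<longlonglongrightarrow> G (s m)"
          by (intro tendsto_eventually) (auto simp: eventually_sequentially)
        with limit_functional_tendsto[OF H] show ?thesis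
          by (rule LIMSEQ_unique)
      qed
      finally show ?thesis .
    qed
    moreover have "\<phi> a = limit_functional G"
      unfolding eq[OF \<phi>] G_def by (simp add: arens_def right_limit_mem[OF \<phi>])
    moreover have "G \<in> dual A"
      unfolding G_def by (intro bidual_compose_mem_dual algebra F right_limit_mem \<phi>)
    ultimately show ?thesis
      using limit_functional_tendsto by simp
  qed
  have "(\<lambda>n. s n o\<^sub>L a) \<longlonglongrightarrow> a"
  proof (rule weakly_convergent_imp_convergent[OF algebra sep _ _ _ _ _ a, where R = "\<lambda>n c. s n o\<^sub>L c"])
    show "(\<lambda>n. \<phi> (s n o\<^sub>L a)) \<longlonglongrightarrow> \<phi> a" if "\<phi> \<in> dual A" for \<phi>
      using that by (rule left)
    show "norm (s n o\<^sub>L c) \<le> norm c" for n c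
      using norm_blinfun_compose[of "s n" c] mult_right_mono[OF norm_s_le[of n] norm_ge_zero[of c]]
      by simp
  qed (simp_all add: operator_algebra_compose algebra s_mem compose_simps s_absorb
      op_scaleC_compose_right projection_BH[OF s_projection])
  moreover have "(\<lambda>n. a o\<^sub>L s n) \<longlonglongrightarrow> a"
  proof (rule weakly_convergent_imp_convergent[OF algebra sep _ _ _ _ _ a, where R = "\<lambda>n c. c o\<^sub>L s n"])
    show "norm (c o\<^sub>L s n) \<le> norm c" for n c
      using norm_blinfun_compose[of c "s n"] mult_left_mono[OF norm_s_le[of n] norm_ge_zero[of c]]
      by simp
    show "(\<lambda>n. \<phi> (a o\<^sub>L s n)) \<longlonglongrightarrow> \<phi> a" if "\<phi> \<in> dual A" for \<phi>
      using right_limit_tendsto[OF that a] right[OF that] by simp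
    show "c o\<^sub>L s m o\<^sub>L s n = c o\<^sub>L s m" if "m \<le> n" for m n and c :: "'h endo"
      by (rule s_absorb_right[OF that])
  qed (simp_all add: operator_algebra_compose algebra s_mem compose_simps
      op_scaleC_compose_left)
  ultimately show "a \<in> corner"
    using a by (simp add: corner_def)
next
  fix a assume "a \<in> corner"
  then have a: "a \<in> A" "(\<lambda>n. s n o\<^sub>L a) \<longlonglongrightarrow> a" "(\<lambda>n. a o\<^sub>L s n) \<longlonglongrightarrow> a"
    by (auto simp: corner_def)
  have sa: "s n o\<^sub>L a \<in> A" "a o\<^sub>L s n \<in> A" for n
    by (auto intro: operator_algebra_compose algebra s_mem a)
  have "\<phi> a = arens A limit_functional (bidual_embed A a) (right_limit \<phi>)" if \<phi>: "\<phi> \<in> dual A" for \<phi>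
  proof -
    note \<psi> = right_limit_mem[OF \<phi>]
    define H where "H = (\<lambda>c. if c \<in> A then right_limit \<phi> (c o\<^sub>L a) else 0)"
    have H: "H \<in> dual A"
      unfolding H_def by (rule dual_compose_right[OF algebra \<psi> a(1)])
    have "right_limit \<phi> a = \<phi> a"
      using right_limit_tendsto[OF \<phi> a(1)] dual_tendsto[OF algebra \<phi> a(1) _ a(3)] sa
      by (auto intro: LIMSEQ_unique)
    moreover have "(\<lambda>n. H (s n)) \<longlonglongrightarrow> right_limit \<phi> a"
      using dual_tendsto[OF algebra \<psi> a(1) _ a(2)] by (simp add: H_def s_mem sa)
    ultimately have "limit_functional H = \<phi> a"
      using limit_functional_tendsto[OF H] LIMSEQ_unique by metis
    moreover have "(\<lambda>c. if c \<in> A then bidual_embed A a (\<lambda>b. if b \<in> A then right_limit \<phi> (c o\<^sub>L b) else 0) else 0) = H"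
      using dual_compose_left[OF algebra \<psi>] a(1) by (auto simp: H_def bidual_embed_def)
    ultimately show ?thesis
      by (simp add: arens_def \<psi>)
  qed
  then have "bidual_embed A a = arens A (arens A limit_functional (bidual_embed A a)) limit_functional"
    by (auto simp: arens_limit_functional_right bidual_embed_def fun_eq_iff)
  then show "a \<in> h_soc A"
    using bidual_embed_mem[OF algebra a(1)] a(1) by (auto simp: h_soc_def supp Let_def)
qed

end

text \<open>Contractivity makes the \<open>R n\<close> equicontinuous, which lets the convergence
  pass to norm limits of \<open>x\<close>.\<close>

lemma closed_fixed_limit:
  fixes R :: "nat \<Rightarrow> 'h::complex_hilbert endo \<Rightarrow> 'h endo"
  assumes diff: "\<And>n x y. R n (x - y) = R n x - R n y" and contr: "\<And>n x. norm (R n x) \<le> norm x"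
  shows "closed {x. (\<lambda>n. R n x) \<longlonglongrightarrow> x}"
proof -
  have "(\<lambda>n. R n x) \<longlonglongrightarrow> x" if x: "x \<in> closure {x. (\<lambda>n. R n x) \<longlonglongrightarrow> x}" for x
  proof (rule tendstoI)
    fix e :: real assume e: "e > 0"
    obtain y where y: "(\<lambda>n. R n y) \<longlonglongrightarrow> y" "dist y x < e / 3"
      using x e by (auto simp: closure_approachable dest!: spec[of _ "e / 3"])
    have "\<forall>\<^sub>F n in sequentially. dist (R n y) y < e / 3"
      using y(1) e by (intro tendstoD) auto
    then show "\<forall>\<^sub>F n in sequentially. dist (R n x) x < e"
    proof eventually_elim
      case (elim n)
      have "dist (R n x) (R n y) < e / 3"
        using contr[of n "x - y"] y(2) by (simp add: diff dist_norm norm_minus_commute)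
      with elim y(2) show ?case
        using dist_triangle[of "R n x" x y] dist_triangle[of "R n x" y "R n y"] by linarith
    qed
  qed
  then have "closure {x. (\<lambda>n. R n x) \<longlonglongrightarrow> x} \<subseteq> {x. (\<lambda>n. R n x) \<longlonglongrightarrow> x}"
    by blast
  then show ?thesis
    by (simp only: closure_subset_eq)
qed

lemma compose_contraction_left: "norm p \<le> 1 \<Longrightarrow> norm (p o\<^sub>L x) \<le> norm x"
  using norm_blinfun_compose[of p x] mult_right_mono[of "norm p" 1 "norm x"] by simp

lemma compose_contraction_right: "norm p \<le> 1 \<Longrightarrow> norm (x o\<^sub>L p) \<le> norm x"
  using norm_blinfun_compose[of x p] mult_left_mono[of "norm p" 1 "norm x"] by simp

context projection_sequence
begin

lemma csubspace_left_fixed: "op_csubspace {x. (\<lambda>n. s n o\<^sub>L x) \<longlonglongrightarrow> x}"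
  and csubspace_right_fixed: "op_csubspace {x. (\<lambda>n. x o\<^sub>L s n) \<longlonglongrightarrow> x}"
  by (auto intro!: ops.subspaceI tendsto_add tendsto_op_scaleC
      simp: compose_simps op_scaleC_compose_left op_scaleC_compose_right projection_BH[OF s_projection])

lemma closed_left_fixed: "closed {x :: 'h endo. (\<lambda>n. s n o\<^sub>L x) \<longlonglongrightarrow> x}"
  by (rule closed_fixed_limit) (simp_all add: compose_simps compose_contraction_left norm_s_le)

lemma closed_right_fixed: "closed {x :: 'h endo. (\<lambda>n. x o\<^sub>L s n) \<longlonglongrightarrow> x}"
  by (rule closed_fixed_limit) (simp_all add: compose_simps compose_contraction_right norm_s_le)

lemma corner_Int:
  "corner = A \<inter> {x. (\<lambda>n. s n o\<^sub>L x) \<longlonglongrightarrow> x} \<inter> {x. (\<lambda>n. x o\<^sub>L s n) \<longlonglongrightarrow> x}"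
  by (auto simp: corner_def)

lemma operator_algebra_corner: "operator_algebra corner"
  unfolding operator_algebra_def
proof (intro conjI ballI)
  show "corner \<subseteq> BH"
    using operator_algebra_subset_BH[OF algebra] by (auto simp: corner_def)
  show "closed corner"
    unfolding corner_Int
    by (intro closed_Int closed_left_fixed closed_right_fixed operator_algebra_closed algebra)
  show "op_csubspace corner"
    unfolding corner_Int
    by (intro ops.subspace_inter csubspace_left_fixed csubspace_right_fixed
        operator_algebra_csubspace algebra)
  fix a b assume ab: "a \<in> corner" "b \<in> corner"
  have "(\<lambda>n. (s n o\<^sub>L a) o\<^sub>L b) \<longlonglongrightarrow> (a o\<^sub>L b)" "(\<lambda>n. a o\<^sub>L (b o\<^sub>L s n)) \<longlonglongrightarrow> (a o\<^sub>L b)"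
    using ab by (auto simp: corner_def intro!: tendsto_compose_op)
  then show "a o\<^sub>L b \<in> corner"
    using ab by (auto simp: corner_def compose_assoc intro: operator_algebra_compose algebra)
qed

text \<open>\<open>s n x s n\<close> differs from \<open>s n x\<close> by
  \<open>s n (x s n - x)\<close>, and \<open>s n\<close> is a contraction.\<close>

lemma corner_two_sided:
  assumes "x \<in> corner"
  shows "(\<lambda>n. s n o\<^sub>L (x o\<^sub>L s n)) \<longlonglongrightarrow> x"
proof -
  have "(\<lambda>n. s n o\<^sub>L x) \<longlonglongrightarrow> x" and right: "(\<lambda>n. x o\<^sub>L s n) \<longlonglongrightarrow> x"
    using assms by (auto simp: corner_def)
  moreover have "(\<lambda>n. s n o\<^sub>L ((x o\<^sub>L s n) - x)) \<longlonglongrightarrow> 0"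
    by (rule Lim_null_comparison[OF always_eventually tendsto_norm_zero[OF LIM_zero[OF right]]])
      (intro allI compose_contraction_left norm_s_le)
  ultimately have "(\<lambda>n. (s n o\<^sub>L x) + (s n o\<^sub>L ((x o\<^sub>L s n) - x))) \<longlonglongrightarrow> x + 0"
    by (intro tendsto_add)
  then show ?thesis
    by (simp add: compose_simps)
qed

end

section \<open>Minimal projections\<close>

text \<open>The countable set \<open>C\<close> need not meet \<open>E\<close>. For each
  \<open>c \<in> C\<close> and each radius \<open>1 / (n + 1)\<close>, a point of \<open>E\<close>
  within this radius of \<open>c\<close> is selected if there is one, and an arbitrary point of
  \<open>E\<close> otherwise.\<close>

lemma dense_sequence_subset:
  fixes E :: "'a::metric_space set"
  assumes C: "countable C" "E \<subseteq> closure C" and E: "E \<noteq> {}"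
  shows "\<exists>e :: nat \<Rightarrow> 'a. (\<forall>n. e n \<in> E) \<and> (\<forall>x\<in>E. \<forall>\<epsilon>>0. \<exists>n. dist (e n) x < \<epsilon>)"
proof -
  define near where "near c (n::nat) = (SOME e. e \<in> E \<and> ((\<exists>e\<in>E. dist c e < inverse (Suc n)) \<longrightarrow> dist c e < inverse (Suc n)))" for c n
  have near: "near c n \<in> E \<and> ((\<exists>e\<in>E. dist c e < inverse (Suc n)) \<longrightarrow> dist c (near c n) < inverse (Suc n))" for c n
    unfolding near_def by (rule someI_ex) (use E in blast)
  define D where "D = (\<Union>c\<in>C. range (near c))"
  have D: "countable D" "D \<subseteq> E"
    using C near by (auto simp: D_def)
  have dense: "\<exists>d\<in>D. dist d x < \<epsilon>" if x: "x \<in> E" and \<epsilon>: "\<epsilon> > 0" for x \<epsilon>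
  proof -
    obtain n where n: "inverse (Suc n) < \<epsilon> / 2"
      using reals_Archimedean[of "\<epsilon> / 2"] \<epsilon> by auto
    obtain c where c: "c \<in> C" "dist c x < inverse (Suc n)"
      using x C(2) unfolding closure_approachable subset_iff
      by (metis inverse_positive_iff_positive of_nat_0_less_iff zero_less_Suc)
    then have "dist c (near c n) < inverse (Suc n)"
      using near x by blast
    then have "dist (near c n) x < \<epsilon>"
      using c(2) n dist_triangle3[of "near c n" x c] by simp
    then show ?thesis
      using c(1) by (auto simp: D_def)
  qed
  have "D \<noteq> {}"
    using E dense[of _ 1] by fastforce
  then have "range (from_nat_into D) = D"
    using D(1) by (rule range_from_nat_into)
  then show ?thesis
    using D(2) dense by (intro exI[of _ "from_nat_into D"]) (metis rangeE rangeI subsetD)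
qed

text \<open>The last conclusion speaks of an approximant \<open>f\<close> because only the members
  of the dense sequence are fixed exactly by some partial sum. Some \<open>q i\<close> may be
  \<open>0\<close>, namely where a member already lies below the preceding sum.\<close>

lemma exists_minimal_sequence:
  fixes A :: "'h::complex_hilbert endo set"
  assumes A: "operator_algebra A" and sep: "separable_space (top_of_set A)"
  obtains q :: "nat \<Rightarrow> 'h endo" where "\<And>i. alg_minimal A (q i)" "\<And>i j. i \<noteq> j \<Longrightarrow> q i o\<^sub>L q j = 0"
    "\<And>e \<epsilon>. alg_minimal A e \<Longrightarrow> \<epsilon> > 0 \<Longrightarrow>
      \<exists>f n. norm (f - e) < \<epsilon> \<and> (\<Sum>i<n. q i) o\<^sub>L f = f"
proof -
  obtain C where C: "countable C" "C \<subseteq> A" "A \<subseteq> closure C"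
    using separable_dense[OF sep] .
  have "Collect (alg_minimal A) \<subseteq> closure C"
    using C(3) alg_minimal_mem by blast
  moreover have "Collect (alg_minimal A) \<noteq> {}"
    using alg_minimal_zero[OF A] by blast
  ultimately obtain e where "\<forall>n::nat. e n \<in> Collect (alg_minimal A)"
    "\<forall>x\<in>Collect (alg_minimal A). \<forall>\<epsilon>>0. \<exists>n. dist (e n) x < \<epsilon>"
    using dense_sequence_subset[OF C(1)] by meson
  then have e: "\<And>n. alg_minimal A (e n)" "\<And>x \<epsilon>. alg_minimal A x \<Longrightarrow> \<epsilon> > 0 \<Longrightarrow> \<exists>n. dist (e n) x < \<epsilon>"
    by simp_all
  \<comment> \<open>The clause for \<open>n = 0\<close> makes the sequence start at
    \<open>0\<close>, so that \<open>s n\<close> telescopes to the sum of the \<open>q i\<close>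
    with \<open>i < n\<close>.\<close>
  define P where "P n x \<longleftrightarrow> x \<in> A \<and> is_projection x \<and> (n = 0 \<longrightarrow> x = 0)" for n :: nat and x :: "'h endo"
  define Q where "Q n x y \<longleftrightarrow> (\<exists>q. alg_minimal A q \<and> x o\<^sub>L q = 0 \<and> q o\<^sub>L x = 0 \<and> y = x + q \<and> y o\<^sub>L e n = e n)"
    for n x y
  have "\<exists>y. P (Suc n) y \<and> Q n x y" if "P n x" for n x
  proof -
    have x: "x \<in> A" "is_projection x"
      using that by (simp_all add: P_def)
    obtain q where q: "alg_minimal A q" "x o\<^sub>L q = 0" "q o\<^sub>L x = 0" "(x + q) o\<^sub>L e n = e n"
      using gram_schmidt_step[OF A x e(1)[of n]] .
    have "P (Suc n) (x + q)"
      unfolding P_def using x q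
      by (simp add: operator_algebra_add[OF A] alg_minimal_mem projection_add alg_minimal_projection)
    moreover have "Q n x (x + q)"
      unfolding Q_def using q by blast
    ultimately show ?thesis
      by blast
  qed
  moreover have "\<exists>x. P 0 x"
    by (simp add: P_def operator_algebra_zero A is_projection_zero)
  ultimately obtain s where s: "\<And>n. P n (s n)" "\<And>n. Q n (s n) (s (Suc n))"
    using dependent_nat_choice[of P Q] by metis
  define q where "q n = s (Suc n) - s n" for n
  have q: "alg_minimal A (q n)" "s n o\<^sub>L q n = 0" "q n o\<^sub>L s n = 0" "s (Suc n) o\<^sub>L e n = e n" for n
    using s(2)[of n] unfolding Q_def q_def by auto
  have s_sum: "s n = (\<Sum>i<n. q i)" for n
    using s(1)[of 0] sum_lessThan_telescope[of s n] by (simp add: P_def q_def)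
  have s_idem: "s n o\<^sub>L s n = s n" for n
    using s(1)[of n] projection_idem unfolding P_def by blast
  \<comment> \<open>The construction gives \<open>q n\<close> orthogonal to \<open>s n\<close> only.
    As \<open>s\<close> increases, every earlier \<open>q i\<close> lies below \<open>s n\<close>,
    and pairwise orthogonality follows.\<close>
  have s_le: "s n o\<^sub>L s (n + k) = s n \<and> s (n + k) o\<^sub>L s n = s n" for n k
  proof (induction k)
    case (Suc k)
    have "s n o\<^sub>L q (n + k) = (s n o\<^sub>L s (n + k)) o\<^sub>L q (n + k)"
      "q (n + k) o\<^sub>L s n = q (n + k) o\<^sub>L (s (n + k) o\<^sub>L s n)"
      using Suc by simp_all
    then have "s n o\<^sub>L q (n + k) = 0" "q (n + k) o\<^sub>L s n = 0"
      by (simp add: compose_assoc q, simp add: q flip: compose_assoc)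
    moreover have "s (n + Suc k) = s (n + k) + q (n + k)"
      by (simp add: q_def)
    ultimately show ?case
      using Suc by (simp add: compose_simps)
  qed (simp add: s_idem)
  have "q i o\<^sub>L q j = 0 \<and> q j o\<^sub>L q i = 0" if "i < j" for i j
  proof -
    obtain k where k: "j = Suc i + k"
      using \<open>i < j\<close> by (auto dest: less_imp_Suc_add)
    have "q i o\<^sub>L s j = q i" "s j o\<^sub>L q i = q i"
      using s_le[of "Suc i" k] s_le[of i "Suc k"] by (simp_all add: k q_def compose_simps)
    then have "q i o\<^sub>L q j = q i o\<^sub>L (s j o\<^sub>L q j)" "q j o\<^sub>L q i = (q j o\<^sub>L s j) o\<^sub>L q i"
      by (simp add: flip: compose_assoc, simp add: compose_assoc)
    then show ?thesis
      by (simp add: q)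
  qed
  then have "q i o\<^sub>L q j = 0" if "i \<noteq> j" for i j
    using that by (metis linorder_neqE_nat)
  moreover have "\<exists>f n. norm (f - x) < \<epsilon> \<and> (\<Sum>i<n. q i) o\<^sub>L f = f" if x: "alg_minimal A x" "\<epsilon> > 0" for x \<epsilon>
  proof -
    obtain n where "dist (e n) x < \<epsilon>"
      using e(2)[OF x] by blast
    \<comment> \<open>\<open>e n\<close> is absorbed only after step \<open>n\<close>, hence the
      bound \<open>Suc n\<close>.\<close>
    then show ?thesis
      using q(4)[of n] by (auto simp: dist_norm s_sum intro!: exI[of _ "e n"] exI[of _ "Suc n"])
  qed
  ultimately show ?thesis
    using that q(1) by blast
qed

text \<open>If \<open>x A x\<close> were zero, the closed span of \<open>A x A\<close> would be an
  ideal of square zero, because products of generators contain a factor \<open>x (b c) x\<close>.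
  The equation \<open>p x r = x\<close> places \<open>x\<close> in \<open>A x A\<close>, which is
  not automatic without a unit.\<close>

lemma semiprime_imp_nonzero:
  assumes A: "operator_algebra A" and semi: "semiprime A" and x: "x \<in> A" "x \<noteq> 0"
    and p: "p \<in> A" "r \<in> A" "p o\<^sub>L (x o\<^sub>L r) = x"
  shows "\<exists>b\<in>A. x o\<^sub>L (b o\<^sub>L x) \<noteq> 0"
proof (rule ccontr)
  assume *: "\<not> ?thesis"
  define S where "S = {a o\<^sub>L (x o\<^sub>L b) |a b. a \<in> A \<and> b \<in> A}"
  have SA: "S \<subseteq> A"
    by (auto simp: S_def intro!: operator_algebra_compose A x)
  then have SBH: "S \<subseteq> BH"
    using operator_algebra_subset_BH[OF A] by blast
  have sub: "op_csubspace (closure (op_cspan S))"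
    by (intro csubspace_closure ops.subspace_span)
  have A_closure: "a \<in> closure (op_cspan A)" if "a \<in> A" for a
    using closure_subset ops.span_base[OF that] by blast
  have "closed_ideal A (closure (op_cspan S))"
    unfolding closed_ideal_def
  proof (intro conjI ballI)
    show "closure (op_cspan S) \<subseteq> A"
      by (intro closed_span_subset operator_algebra_csubspace operator_algebra_closed A SA)
    fix a y assume a: "a \<in> A" and y: "y \<in> closure (op_cspan S)"
    show "a o\<^sub>L y \<in> closure (op_cspan S)"
    proof (rule closed_span_compose_mem[OF _ sub _ operator_algebra_subset_BH[OF A] A_closure[OF a] y])
      fix c z assume "c \<in> A" "z \<in> S"
      then have "c o\<^sub>L z \<in> S"
        unfolding S_def by (auto simp flip: compose_assoc) (metis A compose_assoc operator_algebra_compose)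
      then show "c o\<^sub>L z \<in> closure (op_cspan S)"
        using closure_subset ops.span_base by blast
    qed simp
    show "y o\<^sub>L a \<in> closure (op_cspan S)"
    proof (rule closed_span_compose_mem[OF _ sub _ SBH y A_closure[OF a]])
      fix c z assume "c \<in> A" "z \<in> S"
      then have "z o\<^sub>L c \<in> S"
        unfolding S_def by (auto simp: compose_assoc) (metis A operator_algebra_compose)
      then show "z o\<^sub>L c \<in> closure (op_cspan S)"
        using closure_subset ops.span_base by blast
    qed simp
  qed (use sub in simp_all)
  moreover have "y o\<^sub>L z = 0" if yz: "y \<in> closure (op_cspan S)" "z \<in> closure (op_cspan S)" for y z
  proof -
    have "y o\<^sub>L z \<in> {0}"
    proof (rule closed_span_compose_mem[OF _ _ _ SBH yz])
      fix y z assume "y \<in> S" "z \<in> S"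
      then obtain a b c d where abcd: "a \<in> A" "b \<in> A" "c \<in> A" "d \<in> A"
        and "y = a o\<^sub>L (x o\<^sub>L b)" "z = c o\<^sub>L (x o\<^sub>L d)"
        by (auto simp: S_def)
      then have "y o\<^sub>L z = a o\<^sub>L ((x o\<^sub>L ((b o\<^sub>L c) o\<^sub>L x)) o\<^sub>L d)"
        by (simp add: compose_assoc)
      then show "y o\<^sub>L z \<in> {0}"
        using * abcd operator_algebra_compose[OF A] by simp
    qed (auto simp: ops.subspace_def)
    then show ?thesis by simp
  qed
  ultimately have "closure (op_cspan S) = {0}"
    using semi unfolding semiprime_def by blast
  moreover have "x \<in> S"
    unfolding S_def using p by force
  ultimately show False
    using x(2) closure_subset ops.span_base by blast
qed

section \<open>Partial sums of an orthogonal sequence of minimal projections\<close>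

locale minimal_sequence =
  fixes A :: "'h::complex_hilbert endo set" and q :: "nat \<Rightarrow> 'h endo"
  assumes algebra: "operator_algebra A"
    and minimal: "alg_minimal A (q i)"
    and ortho: "i \<noteq> j \<Longrightarrow> q i o\<^sub>L q j = 0"
begin

lemmas q_mem = alg_minimal_mem[OF minimal]
  and q_projection = alg_minimal_projection[OF minimal]

lemma q_idem: "q i o\<^sub>L q i = q i"
  by (rule projection_idem[OF q_projection])

text \<open>For \<open>S = UNIV\<close> these are the approximating projections of the r-socle; for
  a class \<open>S\<close> they are the parts of these that lie in one block.\<close>

definition partial :: "nat set \<Rightarrow> nat \<Rightarrow> 'h endo"
  where "partial S n = (\<Sum>i\<in>{..<n} \<inter> S. q i)"

lemma q_compose: "q i o\<^sub>L q j = (if i = j then q i else 0)"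
  by (simp add: q_idem ortho)

lemma q_partial: "q i o\<^sub>L partial S n = (if i < n \<and> i \<in> S then q i else 0)"
  and partial_q: "partial S n o\<^sub>L q i = (if i < n \<and> i \<in> S then q i else 0)"
  unfolding partial_def
  by (simp_all add: bounded_bilinear.sum_left[OF bounded_bilinear_blinfun_compose]
        bounded_bilinear.sum_right[OF bounded_bilinear_blinfun_compose] q_compose)

lemma partial_compose: "partial S m o\<^sub>L partial S' n = partial (S \<inter> S') (min m n)"
proof -
  have "partial S m o\<^sub>L partial S' n = (\<Sum>i\<in>{..<m} \<inter> S. q i o\<^sub>L partial S' n)"
    unfolding partial_def[of S]
    by (rule bounded_bilinear.sum_left[OF bounded_bilinear_blinfun_compose])
  also have "\<dots> = (\<Sum>i\<in>{..<m} \<inter> S. if i \<in> {..<n} \<inter> S' then q i else 0)"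
    by (simp add: q_partial)
  also have "\<dots> = (\<Sum>i\<in>({..<m} \<inter> S) \<inter> ({..<n} \<inter> S'). q i)"
    by (rule sum.inter_restrict[symmetric]) simp
  also have "({..<m} \<inter> S) \<inter> ({..<n} \<inter> S') = {..<min m n} \<inter> (S \<inter> S')"
    by auto
  finally show ?thesis
    by (simp add: partial_def)
qed

lemma partial_mem: "partial S n \<in> A"
  unfolding partial_def
  by (intro ops.subspace_sum operator_algebra_csubspace algebra q_mem)

lemma partial_projection: "is_projection (partial S n)"
proof -
  have "is_projection (sum q F)" if "finite F" for F
    using that
  proof (induction F)
    case (insert i F)
    have "q i o\<^sub>L sum q F = 0" "sum q F o\<^sub>L q i = 0"
      using insert.hyps
      by (auto simp: bounded_bilinear.sum_left[OF bounded_bilinear_blinfun_compose]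
          bounded_bilinear.sum_right[OF bounded_bilinear_blinfun_compose] q_compose
          intro!: sum.neutral)
    then show ?case
      using insert by (simp add: projection_add q_projection)
  qed (simp add: is_projection_zero)
  then show ?thesis
    by (simp add: partial_def)
qed

lemma partial_empty [simp]: "partial {} n = 0"
  by (simp add: partial_def)

lemma projection_sequence_partial: "projection_sequence A (partial S)"
  by standard (simp_all add: algebra partial_mem partial_projection partial_compose)

sublocale projection_sequence A "partial UNIV"
  by (rule projection_sequence_partial)

lemma partial_UNIV: "partial UNIV n = (\<Sum>i<n. q i)"
  by (simp add: partial_def)

text \<open>The \<open>x\<close> with \<open>partial UNIV n x \<rightarrow> x\<close> form a closed
  right-multiplication-invariant subspace. It contains all minimal projections by density, hence the
  whole r-socle, so the partial sums are a left approximate identity to which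
  \<open>support_projection_eq\<close> applies.\<close>

lemma h_soc_corner:
  assumes sep: "separable_space (top_of_set A)"
    and dense: "\<And>e \<epsilon>. alg_minimal A e \<Longrightarrow> \<epsilon> > 0 \<Longrightarrow>
      \<exists>f n. norm (f - e) < \<epsilon> \<and> (\<Sum>i<n. q i) o\<^sub>L f = f"
  shows "h_soc A = corner"
proof (rule h_soc_eq_corner[OF support_projection_eq sep])
  define Fix :: "'h endo set" where "Fix = {x. (\<lambda>n. partial UNIV n o\<^sub>L x) \<longlonglongrightarrow> x}"
  have "e \<in> Fix" if e: "alg_minimal A e" for e
  proof -
    have "e \<in> closure Fix"
      unfolding closure_approachable
    proof (intro allI impI)
      fix \<epsilon> :: real assume "\<epsilon> > 0"
      then obtain f n where f: "norm (f - e) < \<epsilon>" "partial UNIV n o\<^sub>L f = f"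
        unfolding partial_UNIV using dense[OF e] by blast
      have "partial UNIV m o\<^sub>L f = f" if "m \<ge> n" for m
        using s_absorb[OF that, of f] by (simp add: f)
      then have "\<forall>\<^sub>F m in sequentially. partial UNIV m o\<^sub>L f = f"
        unfolding eventually_sequentially by blast
      then have "f \<in> Fix"
        unfolding Fix_def by (simp add: tendsto_eventually)
      then show "\<exists>y\<in>Fix. dist y e < \<epsilon>"
        using f(1) by (auto simp: dist_norm)
    qed
    then show ?thesis
      using closed_left_fixed by (simp add: Fix_def)
  qed
  then have "e o\<^sub>L a \<in> Fix" if "alg_minimal A e" for e a
    using tendsto_compose_op[OF _ tendsto_const, of "\<lambda>n. partial UNIV n o\<^sub>L e" e sequentially a] that
    by (auto simp: Fix_def compose_assoc)
  then have "r_soc A \<subseteq> Fix"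
    unfolding r_soc_def Fix_def
    by (intro closed_span_subset csubspace_left_fixed closed_left_fixed) auto
  then show "(\<lambda>n. partial UNIV n o\<^sub>L x) \<longlonglongrightarrow> x" if "x \<in> r_soc A" for x
    using that by (auto simp: Fix_def)
  show "r_soc A \<subseteq> A"
    unfolding r_soc_def
    by (intro closed_span_subset operator_algebra_csubspace operator_algebra_closed algebra)
      (auto intro: operator_algebra_compose algebra alg_minimal_mem)
  show "partial UNIV n \<in> r_soc A" for n
  proof -
    have "q i \<in> (\<Union>e\<in>{e. alg_minimal A e}. {e o\<^sub>L a | a. a \<in> A})" for i
      using minimal[of i] q_mem[of i] q_idem[of i, symmetric] by blast
    then have "partial UNIV n \<in> op_cspan (\<Union>e\<in>{e. alg_minimal A e}. {e o\<^sub>L a | a. a \<in> A})"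
      unfolding partial_def by (intro ops.span_sum ops.span_base)
    then show ?thesis
      unfolding r_soc_def using closure_subset by blast
  qed
qed

text \<open>The condition \<open>q i A q j \<noteq> 0\<close>. It is reflexive exactly at the
  indices with \<open>q i \<noteq> 0\<close>, and semiprimeness makes it an equivalence relation on
  these.\<close>

definition linked :: "nat \<Rightarrow> nat \<Rightarrow> bool"
  where "linked i j \<longleftrightarrow> (\<exists>a\<in>A. q i o\<^sub>L (a o\<^sub>L q j) \<noteq> 0)"

text \<open>Indices \<open>i\<close> with \<open>q\<^sub>i = 0\<close> belong to no class.\<close>

definition linked_class :: "nat \<Rightarrow> nat set"
  where "linked_class k = {i. linked i i \<and> (LEAST j. linked j i) = k}"

end

section \<open>Linked indices and matrix units in the semiprime case\<close>

locale semiprime_minimal_sequence = minimal_sequence +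
  assumes semi: "semiprime A"
begin

text \<open>A non-zero \<open>u = q i a q j\<close> admits \<open>b\<close> with
  \<open>u b u \<noteq> 0\<close> by semiprimeness. For \<open>w = q j b q i\<close> the product
  \<open>u w\<close> is then a non-zero multiple of \<open>q i\<close> by minimality, and rescaling
  \<open>w\<close> gives an inverse of \<open>u\<close> between the two projections.\<close>

lemma linked_inverse:
  assumes "linked i j"
  shows "\<exists>u v. u \<in> A \<and> v \<in> A \<and> u \<noteq> 0 \<and> v \<noteq> 0 \<and> q i o\<^sub>L u = u \<and> u o\<^sub>L q j = u \<and>
    q j o\<^sub>L v = v \<and> v o\<^sub>L q i = v \<and> u o\<^sub>L v = q i \<and> v o\<^sub>L u = q j"
proof -
  obtain a where a: "a \<in> A" "q i o\<^sub>L (a o\<^sub>L q j) \<noteq> 0"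
    using assms by (auto simp: linked_def)
  define u where "u = q i o\<^sub>L (a o\<^sub>L q j)"
  have u: "u \<in> A" "u \<noteq> 0" "q i o\<^sub>L u = u" "u o\<^sub>L q j = u"
    using a by (auto simp: u_def q_idem compose_assoc simp flip: compose_assoc[of "q i" "q i"]
        intro!: operator_algebra_compose algebra q_mem)
  obtain b where b: "b \<in> A" "u o\<^sub>L (b o\<^sub>L u) \<noteq> 0"
    using semiprime_imp_nonzero[OF algebra semi u(1,2) q_mem q_mem, of i j] u by auto
  define w where "w = q j o\<^sub>L (b o\<^sub>L q i)"
  have w: "w \<in> A" "q j o\<^sub>L w = w" "w o\<^sub>L q i = w"
    using b by (auto simp: w_def q_idem compose_assoc simp flip: compose_assoc[of "q j" "q j"]
        intro!: operator_algebra_compose algebra q_mem)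
  have uwu: "u o\<^sub>L (w o\<^sub>L u) \<noteq> 0"
  proof -
    have "u o\<^sub>L (w o\<^sub>L u) = (u o\<^sub>L q j) o\<^sub>L (b o\<^sub>L (q i o\<^sub>L u))"
      by (simp only: w_def compose_assoc)
    then show ?thesis
      using b u by simp
  qed
  have corner_scalar: "\<exists>c. y = op_scaleC c (q k)" if "y \<in> A" "q k o\<^sub>L y = y" "y o\<^sub>L q k = y" for y k
    using alg_minimal_corner[OF minimal that(1), of k] that by (simp add: compose_assoc)
  obtain c where c: "u o\<^sub>L w = op_scaleC c (q i)"
    using corner_scalar[of "u o\<^sub>L w" i] u w
    by (metis algebra compose_assoc operator_algebra_compose)
  have c0: "c \<noteq> 0"
  proof
    assume "c = 0"
    then have "u o\<^sub>L w = 0" using c by simp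
    then show False using uwu by (simp flip: compose_assoc)
  qed
  define v where "v = op_scaleC (inverse c) w"
  have vBH: "u \<in> BH" "q i \<in> BH" "q j \<in> BH"
    using u(1) q_mem operator_algebra_subset_BH[OF algebra] by blast+
  have v: "v \<in> A" "q j o\<^sub>L v = v" "v o\<^sub>L q i = v" "u o\<^sub>L v = q i"
    using w c c0 vBH by (simp_all add: v_def operator_algebra_scaleC algebra op_scaleC_compose_left
        op_scaleC_compose_right)
  obtain d where d: "v o\<^sub>L u = op_scaleC d (q j)"
    using corner_scalar[of "v o\<^sub>L u" j] u v
    by (metis algebra compose_assoc operator_algebra_compose)
  \<comment> \<open>\<open>v u\<close> is already a multiple \<open>d\<close> of \<open>q j\<close>;
    comparing \<open>u = u v u\<close> with \<open>d u\<close> forces \<open>d = 1\<close>, so the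
    right inverse is two-sided.\<close>
  have "u = (u o\<^sub>L v) o\<^sub>L u"
    by (simp add: v u)
  also have "\<dots> = op_scaleC d u"
    by (simp add: compose_assoc d op_scaleC_compose_right vBH u)
  finally have "d = 1"
    using u(2) ops.scale_right_imp_eq[of u d 1] by simp
  moreover have "v \<noteq> 0"
    using v(4) u(2,3) by force
  ultimately show ?thesis
    using u v d by auto
qed

lemma linked_sym: "linked i j \<Longrightarrow> linked j i"
  by (drule linked_inverse) (metis linked_def)

text \<open>The product \<open>u u'\<close> of the two links cannot vanish, since multiplying by
  \<open>v'\<close> on the right restores \<open>u\<close>.\<close>

lemma linked_trans:
  assumes "linked i j" "linked j k"
  shows "linked i k"
proof -
  obtain u v where u: "u \<in> A" "v \<in> A" "u \<noteq> 0" "q i o\<^sub>L u = u" "u o\<^sub>L q j = u"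
    using linked_inverse[OF assms(1)] by blast
  obtain u' v' where u': "u' \<in> A" "v' \<in> A" "u' o\<^sub>L q k = u'" "u' o\<^sub>L v' = q j"
    using linked_inverse[OF assms(2)] by blast
  have "(u o\<^sub>L u') o\<^sub>L v' = u"
    by (simp add: compose_assoc u u')
  then have "u o\<^sub>L u' \<noteq> 0"
    using u(3) by force
  moreover have "q i o\<^sub>L ((u o\<^sub>L u') o\<^sub>L q k) = u o\<^sub>L u'"
    using u u' by (simp add: compose_assoc flip: compose_assoc[of "q i" u])
  ultimately show ?thesis
    unfolding linked_def using operator_algebra_compose[OF algebra u(1) u'(1)] by metis
qed

lemma linked_class_linked: "i \<in> linked_class k \<Longrightarrow> linked i k"
  unfolding linked_class_def by (auto intro: linked_sym LeastI)

text \<open>Classes are labelled by their least elements. Hence only labels below \<open>m\<close>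
  matter for indices below \<open>m\<close>, and class \<open>k\<close> lies in the tail starting at
  \<open>k\<close>; this yields finite block decompositions and the decay of the blocks.\<close>

lemma linked_class_le: "i \<in> linked_class k \<Longrightarrow> k \<le> i"
  unfolding linked_class_def by (auto intro: Least_le)

lemma linked_class_closed:
  assumes "i \<in> linked_class k" "linked i j"
  shows "j \<in> linked_class k"
proof -
  have "linked l i \<longleftrightarrow> linked l j" for l
    using assms(2) linked_sym linked_trans by blast
  moreover have "linked j j"
    using assms(2) linked_sym linked_trans by blast
  ultimately show ?thesis
    using assms(1) by (simp add: linked_class_def)
qed

lemma linked_class_disjoint: "k \<noteq> l \<Longrightarrow> linked_class k \<inter> linked_class l = {}"
  by (auto simp: linked_class_def)

lemma linked_class_exists: "q i \<noteq> 0 \<Longrightarrow> i \<in> linked_class (LEAST j. linked j i)"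
  using q_mem[of i] q_idem[of i] unfolding linked_class_def linked_def by force

lemma unlinked_zero:
  assumes "i \<in> linked_class k" "j \<notin> linked_class k" "a \<in> A"
  shows "q i o\<^sub>L (a o\<^sub>L q j) = 0" "q j o\<^sub>L (a o\<^sub>L q i) = 0"
  using assms linked_class_closed linked_sym unfolding linked_def by blast+

text \<open>Each index \<open>i\<close> is joined to the least index \<open>k\<close> of its class
  by an inverse pair \<open>u i\<close>, \<open>v i\<close>, and \<open>T i j\<close> is
  \<open>u i v j\<close>. The matrix unit relations come from \<open>v j u j = q k\<close>, the
  diagonal from \<open>u i v i = q i\<close>. As \<open>u\<close> and \<open>v\<close> depend on one
  index only, a single \<open>T\<close> serves all classes.\<close>

lemma exists_matrix_units:
  "\<exists>T. \<forall>k. \<forall>i\<in>linked_class k. T i i = q i \<and> (\<forall>j\<in>linked_class k.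
    T i j \<in> A \<and> T i j \<noteq> 0 \<and> q i o\<^sub>L T i j = T i j \<and> T i j o\<^sub>L q j = T i j \<and>
    (\<forall>a\<in>A. \<exists>c. q i o\<^sub>L (a o\<^sub>L q j) = op_scaleC c (T i j)) \<and>
    (\<forall>l\<in>linked_class k. T i j o\<^sub>L T j l = T i l))"
proof -
  define b where "b i = (LEAST j. linked j i)" for i
  have "linked i (b i)" if "linked i i" for i
    using linked_class_linked[of i "b i"] that by (simp add: linked_class_def b_def)
  then have "\<forall>i. linked i i \<longrightarrow> (\<exists>u v. u \<in> A \<and> v \<in> A \<and> u \<noteq> 0 \<and> v \<noteq> 0 \<and> q i o\<^sub>L u = u \<and> u o\<^sub>L q (b i) = u \<and>
    q (b i) o\<^sub>L v = v \<and> v o\<^sub>L q i = v \<and> u o\<^sub>L v = q i \<and> v o\<^sub>L u = q (b i))"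
    using linked_inverse by presburger
  then obtain u v where uv: "\<And>i. linked i i \<Longrightarrow> u i \<in> A \<and> v i \<in> A \<and> u i \<noteq> 0 \<and> v i \<noteq> 0 \<and>
    q i o\<^sub>L u i = u i \<and> u i o\<^sub>L q (b i) = u i \<and> q (b i) o\<^sub>L v i = v i \<and> v i o\<^sub>L q i = v i \<and>
    u i o\<^sub>L v i = q i \<and> v i o\<^sub>L u i = q (b i)"
    by metis
  define T where "T i j = u i o\<^sub>L v j" for i j
  have cls: "linked i i" "b i = k" if "i \<in> linked_class k" for i k
    using that by (auto simp: linked_class_def b_def)
  note [simp] = compose_assoc
  show ?thesis
  proof (intro exI[of _ T] allI ballI conjI)
    fix k i j assume i: "i \<in> linked_class k" and j: "j \<in> linked_class k"
    note ui = uv[OF cls(1)[OF i], unfolded cls(2)[OF i]] and uj = uv[OF cls(1)[OF j], unfolded cls(2)[OF j]]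
    have uiBH: "u i \<in> BH"
      using ui operator_algebra_subset_BH[OF algebra] by blast
    have "T i j o\<^sub>L u j = u i"
      using ui uj by (simp add: T_def)
    then have "T i j \<noteq> 0"
      using ui by force
    moreover have "q i o\<^sub>L T i j = T i j" "T i j o\<^sub>L q j = T i j"
      using ui uj by (simp_all add: T_def flip: compose_assoc[of "q i"])
    moreover have "T i j \<in> A"
      using ui uj by (auto simp: T_def intro: operator_algebra_compose algebra)
    ultimately show "T i j \<in> A" "T i j \<noteq> 0" "q i o\<^sub>L T i j = T i j" "T i j o\<^sub>L q j = T i j"
      by blast+
    show "T i j o\<^sub>L T j l = T i l" if "l \<in> linked_class k" for l
    proof -
      have "T i j o\<^sub>L T j l = u i o\<^sub>L ((v j o\<^sub>L u j) o\<^sub>L v l)"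
        by (simp add: T_def)
      also have "\<dots> = u i o\<^sub>L v l"
        using uj uv[OF cls(1)[OF that], unfolded cls(2)[OF that]] by (simp del: compose_assoc)
      finally show ?thesis
        by (simp add: T_def)
    qed
    show "\<exists>c. q i o\<^sub>L (a o\<^sub>L q j) = op_scaleC c (T i j)" if a: "a \<in> A" for a
    proof -
      \<comment> \<open>The pairs transport \<open>q i a q j\<close> to \<open>q k A q k\<close>,
        which is one-dimensional by minimality; transporting back gives a multiple of
        \<open>T i j\<close>.\<close>
      define y where "y = v i o\<^sub>L (a o\<^sub>L u j)"
      have "y \<in> A"
        using ui uj a by (auto simp: y_def intro!: operator_algebra_compose algebra)
      moreover have "q k o\<^sub>L y = y" "y o\<^sub>L q k = y"
        using ui uj by (simp_all add: y_def flip: compose_assoc[of "q k"])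
      ultimately obtain c where c: "y = op_scaleC c (q k)"
        using alg_minimal_corner[OF minimal, of y k] by auto
      have "q i o\<^sub>L (a o\<^sub>L q j) = (u i o\<^sub>L v i) o\<^sub>L (a o\<^sub>L (u j o\<^sub>L v j))"
        using ui uj by (simp del: compose_assoc)
      also have "\<dots> = u i o\<^sub>L (y o\<^sub>L v j)"
        by (simp add: y_def)
      also have "\<dots> = op_scaleC c (T i j)"
        using uj by (simp add: c T_def op_scaleC_compose_left op_scaleC_compose_right uiBH)
      finally show ?thesis
        by blast
    qed
  next
    show "T i i = q i" if "i \<in> linked_class k" for k i
      using uv[OF cls(1)[OF that]] by (simp add: T_def)
  qed
qed

end

section \<open>Norms of operator matrices\<close>

text \<open>The supremum is usable only once the set is bounded; the sums of the entry norms in each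
  row provide a bound.\<close>

lemma mat_norm_upper:
  fixes x :: "nat \<Rightarrow> nat \<Rightarrow> 'h::complex_hilbert endo"
  assumes "(\<Sum>j<n. (norm (v j))\<^sup>2) \<le> 1"
  shows "sqrt (\<Sum>i<n. (norm (\<Sum>j<n. blinfun_apply (x i j) (v j)))\<^sup>2) \<le> mat_norm n x"
proof -
  have "bdd_above ((\<lambda>v. sqrt (\<Sum>i<n. (norm (\<Sum>j<n. blinfun_apply (x i j) (v j)))\<^sup>2)) `
      {v. (\<Sum>j<n. (norm (v j))\<^sup>2) \<le> 1})"
  proof (rule bdd_aboveI2)
    fix v :: "nat \<Rightarrow> 'h" assume "v \<in> {v. (\<Sum>j<n. (norm (v j))\<^sup>2) \<le> 1}"
    then have v: "(\<Sum>j<n. (norm (v j))\<^sup>2) \<le> 1" by simp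
    have v1: "norm (v j) \<le> 1" if "j < n" for j
    proof -
      have "(norm (v j))\<^sup>2 \<le> (\<Sum>j<n. (norm (v j))\<^sup>2)"
        using that by (intro member_le_sum) auto
      then have "(norm (v j))\<^sup>2 \<le> 1\<^sup>2"
        using v by simp
      then show ?thesis
        by (rule power2_le_imp_le) simp
    qed
    have "norm (\<Sum>j<n. x i j (v j)) \<le> (\<Sum>j<n. norm (x i j))" for i
    proof (rule sum_norm_le)
      fix j assume "j \<in> {..<n}"
      then show "norm (x i j (v j)) \<le> norm (x i j)"
        using norm_blinfun[of "x i j" "v j"] mult_left_mono[OF v1[of j], of "norm (x i j)"] by simp
    qed
    then show "sqrt (\<Sum>i<n. (norm (\<Sum>j<n. blinfun_apply (x i j) (v j)))\<^sup>2)
        \<le> sqrt (\<Sum>i<n. (\<Sum>j<n. norm (x i j))\<^sup>2)"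
      by (intro real_sqrt_le_mono sum_mono power_mono) auto
  qed
  then show ?thesis
    unfolding mat_norm_def using assms by (intro cSUP_upper) auto
qed

lemma mat_norm_least:
  fixes x :: "nat \<Rightarrow> nat \<Rightarrow> 'h::complex_hilbert endo"
  assumes "B \<ge> 0"
    and "\<And>v. (\<Sum>j<n. (norm (v j))\<^sup>2) \<le> 1 \<Longrightarrow>
      (\<Sum>i<n. (norm (\<Sum>j<n. blinfun_apply (x i j) (v j)))\<^sup>2) \<le> B\<^sup>2"
  shows "mat_norm n x \<le> B"
  unfolding mat_norm_def
proof (rule cSUP_least)
  have "(\<lambda>j. 0) \<in> {v :: nat \<Rightarrow> 'h. (\<Sum>j<n. (norm (v j))\<^sup>2) \<le> 1}"
    by simp
  then show "{v :: nat \<Rightarrow> 'h. (\<Sum>j<n. (norm (v j))\<^sup>2) \<le> 1} \<noteq> {}"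
    by (metis empty_iff)
  show "sqrt (\<Sum>i<n. (norm (\<Sum>j<n. x i j (v j)))\<^sup>2) \<le> B"
    if "v \<in> {v. (\<Sum>j<n. (norm (v j))\<^sup>2) \<le> 1}" for v
    using assms that by (simp add: real_le_lsqrt)
qed

lemma mat_norm_nonneg: "0 \<le> mat_norm n x"
  using mat_norm_upper[where v = "\<lambda>j. 0" and n = n and x = x] by simp

lemma mat_norm_bound:
  fixes x :: "nat \<Rightarrow> nat \<Rightarrow> 'h::complex_hilbert endo"
  shows "(\<Sum>i<n. (norm (\<Sum>j<n. blinfun_apply (x i j) (v j)))\<^sup>2)
    \<le> (mat_norm n x)\<^sup>2 * (\<Sum>j<n. (norm (v j))\<^sup>2)"
proof -
  define t where "t = (\<Sum>j<n. (norm (v j))\<^sup>2)"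
  have t: "t \<ge> 0"
    by (simp add: t_def sum_nonneg)
  show ?thesis
  proof (cases "t = 0")
    case True
    then have "v j = 0" if "j < n" for j
      using that by (simp add: t_def sum_nonneg_eq_0_iff)
    then show ?thesis by simp
  next
    case False
    define r where "r = inverse (sqrt t)"
    have r2: "r\<^sup>2 * t = 1"
      using False t by (simp add: r_def power_inverse)
    have "(\<Sum>j<n. (norm (r *\<^sub>R v j))\<^sup>2) = r\<^sup>2 * t"
      by (simp add: t_def power_mult_distrib sum_distrib_left)
    then have "sqrt (\<Sum>i<n. (norm (\<Sum>j<n. x i j (r *\<^sub>R v j)))\<^sup>2) \<le> mat_norm n x"
      by (intro mat_norm_upper) (simp add: r2)
    then have "(\<Sum>i<n. (norm (\<Sum>j<n. x i j (r *\<^sub>R v j)))\<^sup>2) \<le> (mat_norm n x)\<^sup>2"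
      by (rule sqrt_le_D)
    moreover have "(\<Sum>i<n. (norm (\<Sum>j<n. x i j (r *\<^sub>R v j)))\<^sup>2) =
        r\<^sup>2 * (\<Sum>i<n. (norm (\<Sum>j<n. x i j (v j)))\<^sup>2)"
      by (simp add: blinfun.scaleR_right power_mult_distrib sum_distrib_left
        flip: scaleR_sum_right)
    ultimately have "t * (r\<^sup>2 * (\<Sum>i<n. (norm (\<Sum>j<n. x i j (v j)))\<^sup>2)) \<le> t * (mat_norm n x)\<^sup>2"
      using t by (simp add: mult_left_mono)
    moreover have "t * (r\<^sup>2 * (\<Sum>i<n. (norm (\<Sum>j<n. x i j (v j)))\<^sup>2)) =
        (\<Sum>i<n. (norm (\<Sum>j<n. x i j (v j)))\<^sup>2)"
      using r2 by (simp add: mult.commute flip: mult.assoc)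
    ultimately show ?thesis
      unfolding t_def[symmetric] by (simp only: mult.commute)
  qed
qed

text \<open>Allows estimates for operators to be read off from estimates for matrices.\<close>

lemma mat_norm_one: "mat_norm 1 (\<lambda>i j. y) = norm y"
proof (rule antisym)
  show "mat_norm 1 (\<lambda>i j. y) \<le> norm y"
  proof (rule mat_norm_least)
    fix v :: "nat \<Rightarrow> 'a" assume "(\<Sum>j<1. (norm (v j))\<^sup>2) \<le> 1"
    then have "norm (v 0) \<le> 1"
      by (simp add: power2_nonneg_ge_1_iff[symmetric] abs_square_le_1)
    then have "norm (y (v 0)) \<le> norm y"
      using norm_blinfun[of y "v 0"] mult_left_mono[of "norm (v 0)" 1 "norm y"] by simp
    then show "(\<Sum>i<1::nat. (norm (\<Sum>j<1. y (v j)))\<^sup>2) \<le> (norm y)\<^sup>2"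
      by (simp add: power_mono)
  qed simp
  show "norm y \<le> mat_norm 1 (\<lambda>i j. y)"
  proof (rule norm_blinfun_bound[OF mat_norm_nonneg])
    fix z
    have "(norm (y z))\<^sup>2 \<le> (mat_norm 1 (\<lambda>i j. y) * norm z)\<^sup>2"
      using mat_norm_bound[where n = 1 and x = "\<lambda>i j. y" and v = "\<lambda>j. z"] by (simp add: power_mult_distrib)
    then show "norm (y z) \<le> mat_norm 1 (\<lambda>i j. y) * norm z"
      by (rule power2_le_imp_le) (simp add: mat_norm_nonneg)
  qed
qed

section \<open>Decomposition into blocks\<close>

context minimal_sequence
begin

text \<open>Left multiplication by the (possibly infinite) sum of the \<open>q\<^sub>i\<close> with \<open>i \<in> S\<close>, which need not
  belong to \<open>A\<close>.\<close>

definition cut :: "nat set \<Rightarrow> 'h endo \<Rightarrow> 'h endo"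
  where "cut S x = lim (\<lambda>n. partial S n o\<^sub>L x)"

lemma norm_partial_compose_le: "norm (partial S n o\<^sub>L x) \<le> norm x"
  by (intro compose_contraction_left norm_projection_le partial_projection)

text \<open>The projections \<open>partial S n\<close> need not converge in norm, but on
  \<open>x\<close> they do: beyond \<open>N\<close> their differences act on \<open>x\<close> as on
  \<open>x - partial UNIV N x\<close>, which is small because \<open>x\<close> is in the
  corner.\<close>

lemma cut_tendsto:
  assumes x: "x \<in> corner"
  shows "(\<lambda>n. partial S n o\<^sub>L x) \<longlonglongrightarrow> cut S x"
proof -
  have "Cauchy (\<lambda>n. partial S n o\<^sub>L x)"
  proof (rule CauchyI)
    fix e :: real assume "e > 0"
    moreover have "(\<lambda>n. partial UNIV n o\<^sub>L x) \<longlonglongrightarrow> x"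
      using x by (simp add: corner_def)
    ultimately obtain N where N: "norm ((partial UNIV N o\<^sub>L x) - x) < e / 2"
      by (metis LIMSEQ_iff half_gt_zero order_refl)
    define y where "y = x - (partial UNIV N o\<^sub>L x)"
    have y: "norm y < e / 2"
      using N by (simp add: y_def norm_minus_commute)
    have "norm ((partial S m o\<^sub>L x) - (partial S n o\<^sub>L x)) < e" if "m \<ge> N" "n \<ge> N" for m n
    proof -
      have "partial S k o\<^sub>L y = (partial S k o\<^sub>L x) - (partial S N o\<^sub>L x)" if "k \<ge> N" for k
        using that
        by (simp add: y_def compose_simps partial_compose min_absorb2 flip: compose_assoc)
      then have "(partial S m o\<^sub>L x) - (partial S n o\<^sub>L x) = (partial S m o\<^sub>L y) - (partial S n o\<^sub>L y)"
        using that by simp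
      then show ?thesis
        using norm_triangle_ineq4[of "partial S m o\<^sub>L y" "partial S n o\<^sub>L y"] y
          norm_partial_compose_le[of S m y] norm_partial_compose_le[of S n y] by simp
    qed
    then show "\<exists>M. \<forall>m\<ge>M. \<forall>n\<ge>M. norm ((partial S m o\<^sub>L x) - (partial S n o\<^sub>L x)) < e"
      by blast
  qed
  then show ?thesis
    unfolding cut_def by (simp add: Cauchy_convergent_iff convergent_LIMSEQ_iff)
qed

lemma norm_cut_le:
  assumes x: "x \<in> corner"
  shows "norm (cut S x) \<le> norm x"
  using LIMSEQ_le_const2[OF tendsto_norm[OF cut_tendsto[OF x]]] norm_partial_compose_le by blast

text \<open>A cut to indices from \<open>N\<close> on annihilates \<open>partial UNIV N x\<close>.
  This is the source of the decay required of a \<open>c0\<close> sequence.\<close>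

lemma norm_cut_tail_le:
  assumes x: "x \<in> corner" and S: "S \<inter> {..<N} = {}"
  shows "norm (cut S x) \<le> norm (x - (partial UNIV N o\<^sub>L x))"
proof -
  have "partial S n o\<^sub>L x = partial S n o\<^sub>L (x - (partial UNIV N o\<^sub>L x))" for n
  proof -
    have "{..<min n N} \<inter> S = {}"
      using S by auto
    then have "partial S n o\<^sub>L partial UNIV N = 0"
      by (simp add: partial_compose) (simp add: partial_def)
    then show ?thesis
      by (simp add: compose_simps flip: compose_assoc)
  qed
  then have "norm (partial S n o\<^sub>L x) \<le> norm (x - (partial UNIV N o\<^sub>L x))" for n
    by (metis norm_partial_compose_le)
  then show ?thesis
    using LIMSEQ_le_const2[OF tendsto_norm[OF cut_tendsto[OF x]]] by blast
qed

lemma cut_add: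
  assumes "x \<in> corner" "y \<in> corner"
  shows "cut S (x + y) = cut S x + cut S y"
proof (rule LIMSEQ_unique[OF cut_tendsto])
  show "(\<lambda>n. partial S n o\<^sub>L (x + y)) \<longlonglongrightarrow> cut S x + cut S y"
    unfolding compose_simps by (intro tendsto_add cut_tendsto assms)
qed (intro operator_algebra_add operator_algebra_corner assms)

lemma cut_scaleC:
  assumes "x \<in> corner"
  shows "cut S (op_scaleC c x) = op_scaleC c (cut S x)"
proof (rule LIMSEQ_unique[OF cut_tendsto])
  have "partial S n o\<^sub>L op_scaleC c x = op_scaleC c (partial S n o\<^sub>L x)" for n
    by (simp add: op_scaleC_compose_right projection_BH[OF partial_projection])
  then show "(\<lambda>n. partial S n o\<^sub>L op_scaleC c x) \<longlonglongrightarrow> op_scaleC c (cut S x)"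
    by (simp add: tendsto_op_scaleC cut_tendsto assms)
qed (intro operator_algebra_scaleC operator_algebra_corner assms)

lemma cut_diff:
  assumes "x \<in> corner" "y \<in> corner"
  shows "cut S (x - y) = cut S x - cut S y"
  using cut_add[OF operator_algebra_diff[OF operator_algebra_corner assms] assms(2), of S] by simp

lemma cut_zero: "cut S 0 = 0"
  by (simp add: cut_def)

lemma cut_sum:
  assumes "\<And>k. k \<in> F \<Longrightarrow> a k \<in> corner"
  shows "cut S (\<Sum>k\<in>F. a k) = (\<Sum>k\<in>F. cut S (a k))"
  using assms
proof (induction F rule: infinite_finite_induct)
  case (insert k F)
  then have "sum a F \<in> corner"
    by (intro ops.subspace_sum operator_algebra_csubspace operator_algebra_corner) auto
  then show ?case
    using insert by (simp add: cut_add)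
qed (simp_all add: cut_zero)

lemma cut_tendsto_cut:
  assumes f: "\<And>n. f n \<in> corner" and x: "x \<in> corner" and lim: "f \<longlonglongrightarrow> x"
  shows "(\<lambda>n. cut S (f n)) \<longlonglongrightarrow> cut S x"
proof (rule LIM_zero_cancel, rule Lim_null_comparison)
  show "\<forall>\<^sub>F n in sequentially. norm (cut S (f n) - cut S x) \<le> norm (f n - x)"
    using f x by (intro always_eventually allI)
      (metis cut_diff norm_cut_le operator_algebra_corner operator_algebra_diff)
  show "(\<lambda>n. norm (f n - x)) \<longlonglongrightarrow> 0"
    using lim by (intro tendsto_norm_zero LIM_zero)
qed

lemma partial_cut:
  assumes "x \<in> corner"
  shows "partial S n o\<^sub>L cut S x = partial S n o\<^sub>L x"
proof (rule LIMSEQ_unique)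
  show "(\<lambda>m. partial S n o\<^sub>L (partial S m o\<^sub>L x)) \<longlonglongrightarrow> (partial S n o\<^sub>L cut S x)"
    by (intro tendsto_compose_op tendsto_const cut_tendsto assms)
  have "\<forall>\<^sub>F m in sequentially. partial S n o\<^sub>L (partial S m o\<^sub>L x) = partial S n o\<^sub>L x"
    unfolding eventually_sequentially
    by (intro exI[of _ n]) (simp add: partial_compose min_absorb1 flip: compose_assoc)
  then show "(\<lambda>m. partial S n o\<^sub>L (partial S m o\<^sub>L x)) \<longlonglongrightarrow> (partial S n o\<^sub>L x)"
    by (rule tendsto_eventually)
qed

lemma partial_compose_partial_sum:
  "partial S m o\<^sub>L (x o\<^sub>L partial S' n) = (\<Sum>i\<in>{..<m} \<inter> S. \<Sum>j\<in>{..<n} \<inter> S'. q i o\<^sub>L (x o\<^sub>L q j))"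
proof -
  have "partial S m o\<^sub>L (x o\<^sub>L partial S' n) = (\<Sum>i\<in>{..<m} \<inter> S. q i o\<^sub>L (x o\<^sub>L partial S' n))"
    unfolding partial_def[of S]
    by (rule bounded_bilinear.sum_left[OF bounded_bilinear_blinfun_compose])
  then show ?thesis
    by (simp add: partial_def[of S'] bounded_bilinear.sum_right[OF bounded_bilinear_blinfun_compose])
qed

end

section \<open>Block diagonality and the complete norm formula\<close>

context semiprime_minimal_sequence
begin

text \<open>Entries \<open>q i x q j\<close> with \<open>i\<close> in the class and \<open>j\<close>
  outside vanish, so cutting on the left to a class also cuts on the right.\<close>

lemma partial_class_right:
  assumes "x \<in> A"
  shows "partial (linked_class k) m o\<^sub>L (x o\<^sub>L partial UNIV n) =
    partial (linked_class k) m o\<^sub>L (x o\<^sub>L partial (linked_class k) n)"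
  unfolding partial_compose_partial_sum
proof (rule sum.cong[OF refl])
  fix i assume "i \<in> {..<m} \<inter> linked_class k"
  then show "(\<Sum>j\<in>{..<n} \<inter> UNIV. q i o\<^sub>L (x o\<^sub>L q j)) =
      (\<Sum>j\<in>{..<n} \<inter> linked_class k. q i o\<^sub>L (x o\<^sub>L q j))"
    by (intro sum.mono_neutral_right ballI unlinked_zero(1)[OF _ _ assms]) auto
qed

lemma cut_class_right:
  assumes "x \<in> corner"
  shows "cut (linked_class k) x o\<^sub>L partial UNIV n = cut (linked_class k) x o\<^sub>L partial (linked_class k) n"
proof (rule LIMSEQ_unique)
  have x: "x \<in> A" using assms by (simp add: corner_def)
  show "(\<lambda>m. partial (linked_class k) m o\<^sub>L (x o\<^sub>L partial UNIV n))
      \<longlonglongrightarrow> (cut (linked_class k) x o\<^sub>L partial UNIV n)"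
    unfolding compose_assoc[symmetric] by (intro tendsto_compose_op tendsto_const cut_tendsto assms)
  show "(\<lambda>m. partial (linked_class k) m o\<^sub>L (x o\<^sub>L partial UNIV n))
      \<longlonglongrightarrow> (cut (linked_class k) x o\<^sub>L partial (linked_class k) n)"
    unfolding partial_class_right[OF x] unfolding compose_assoc[symmetric]
    by (intro tendsto_compose_op tendsto_const cut_tendsto assms)
qed

text \<open>With \<open>P\<close> standing for the possibly infinite sum over the class,
  \<open>P x y = (P x P) y = (P x) (P y)\<close>; the first equality is block diagonality.\<close>

lemma cut_class_compose:
  assumes x: "x \<in> corner" and y: "y \<in> corner"
  shows "cut (linked_class k) (x o\<^sub>L y) = cut (linked_class k) x o\<^sub>L cut (linked_class k) y"
proof -
  let ?S = "linked_class k"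
  have "cut ?S (x o\<^sub>L y) = cut ?S x o\<^sub>L y"
  proof (rule LIMSEQ_unique[OF cut_tendsto])
    show "(\<lambda>n. partial ?S n o\<^sub>L (x o\<^sub>L y)) \<longlonglongrightarrow> (cut ?S x o\<^sub>L y)"
      unfolding compose_assoc[symmetric] by (intro tendsto_compose_op tendsto_const cut_tendsto x)
  qed (intro operator_algebra_compose operator_algebra_corner x y)
  moreover have "cut ?S x o\<^sub>L y = cut ?S x o\<^sub>L cut ?S y"
  proof (rule LIMSEQ_unique)
    show "(\<lambda>n. cut ?S x o\<^sub>L (partial UNIV n o\<^sub>L y)) \<longlonglongrightarrow> (cut ?S x o\<^sub>L y)"
      using y by (intro tendsto_compose_op tendsto_const) (simp add: corner_def)
    show "(\<lambda>n. cut ?S x o\<^sub>L (partial UNIV n o\<^sub>L y)) \<longlonglongrightarrow> (cut ?S x o\<^sub>L cut ?S y)"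
      unfolding compose_assoc[symmetric] cut_class_right[OF x]
      unfolding compose_assoc by (intro tendsto_compose_op tendsto_const cut_tendsto y)
  qed
  ultimately show ?thesis by simp
qed

text \<open>Labels \<open>k < m\<close> suffice because a class is labelled by its least element.
  Indices in no class contribute \<open>q i = 0\<close>.\<close>

lemma partial_class_decomposition:
  "partial UNIV m = (\<Sum>k<m. partial (linked_class k) m)"
proof -
  have "(\<Sum>k<m. partial (linked_class k) m) = (\<Sum>i\<in>(\<Union>k<m. {..<m} \<inter> linked_class k). q i)"
    unfolding partial_def using linked_class_disjoint
    by (intro sum.UNION_disjoint[symmetric]) auto
  also have "\<dots> = (\<Sum>i<m. q i)"
  proof (rule sum.mono_neutral_left)
    show "\<forall>i\<in>{..<m} - (\<Union>k<m. {..<m} \<inter> linked_class k). q i = 0"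
      using linked_class_exists linked_class_le by (fastforce intro: order_le_less_trans)
  qed auto
  finally show ?thesis
    by (simp add: partial_UNIV)
qed

lemma partial_class_norm:
  "(norm (partial UNIV m z))\<^sup>2 = (\<Sum>k<m. (norm (partial (linked_class k) m z))\<^sup>2)"
proof -
  have "partial UNIV m z = (\<Sum>k<m. partial (linked_class k) m z)"
    by (simp add: partial_class_decomposition blinfun.sum_left)
  moreover have "inner (partial (linked_class k) m z) (partial (linked_class l) m z) = 0" if "k \<noteq> l" for k l
  proof -
    have "inner (partial (linked_class k) m z) (partial (linked_class l) m z) =
        inner z ((partial (linked_class k) m o\<^sub>L partial (linked_class l) m) z)"
      by (simp add: projection_inner[OF partial_projection])
    then show ?thesis
      using linked_class_disjoint[OF that] by (simp add: partial_compose)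
  qed
  ultimately show ?thesis
    by (simp add: norm_sum_Pythagorean pairwise_def orthogonal_def)
qed

text \<open>Cutting multiplies the matrix on the left by a diagonal of equal projections, up to a
  limit, and this is a contraction on every column vector.\<close>

lemma mat_norm_cut_le:
  assumes x: "\<And>i j. i < n \<Longrightarrow> j < n \<Longrightarrow> x i j \<in> corner"
  shows "mat_norm n (\<lambda>i j. cut S (x i j)) \<le> mat_norm n x"
proof (rule mat_norm_least[OF mat_norm_nonneg])
  fix v :: "nat \<Rightarrow> 'a" assume v: "(\<Sum>j<n. (norm (v j))\<^sup>2) \<le> 1"
  have "norm (\<Sum>j<n. cut S (x i j) (v j)) \<le> norm (\<Sum>j<n. x i j (v j))" if i: "i < n" for i
  proof (rule LIMSEQ_le_const2)
    show "(\<lambda>m. norm (\<Sum>j<n. (partial S m o\<^sub>L x i j) (v j))) \<longlonglongrightarrow> norm (\<Sum>j<n. cut S (x i j) (v j))"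
      using i by (intro tendsto_norm tendsto_sum blinfun.tendsto tendsto_const cut_tendsto x) auto
    have "norm (\<Sum>j<n. (partial S m o\<^sub>L x i j) (v j)) \<le> norm (\<Sum>j<n. x i j (v j))" for m
      using projection_apply_le[OF partial_projection] by (simp flip: blinfun.sum_right)
    then show "\<exists>N. \<forall>m\<ge>N. norm (\<Sum>j<n. (partial S m o\<^sub>L x i j) (v j)) \<le> norm (\<Sum>j<n. x i j (v j))"
      by blast
  qed
  then have "(\<Sum>i<n. (norm (\<Sum>j<n. cut S (x i j) (v j)))\<^sup>2) \<le> (\<Sum>i<n. (norm (\<Sum>j<n. x i j (v j)))\<^sup>2)"
    by (intro sum_mono power_mono) auto
  also have "\<dots> \<le> (mat_norm n x)\<^sup>2"
    using mat_norm_upper[OF v, of x] by (rule sqrt_le_D)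
  finally show "(\<Sum>i<n. (norm (\<Sum>j<n. cut S (x i j) (v j)))\<^sup>2) \<le> (mat_norm n x)\<^sup>2" .
qed

text \<open>The compressions \<open>partial UNIV m x partial UNIV m\<close> are block diagonal for
  an orthogonal decomposition into finitely many classes, so their norm is controlled by the largest
  block. They converge to the entries of \<open>x\<close> in norm.\<close>

lemma mat_norm_le_cut:
  assumes x: "\<And>i j. i < n \<Longrightarrow> j < n \<Longrightarrow> x i j \<in> corner" and B: "B \<ge> 0"
    and bound: "\<And>k. mat_norm n (\<lambda>i j. cut (linked_class k) (x i j)) \<le> B"
  shows "mat_norm n x \<le> B"
proof (rule mat_norm_least[OF B])
  fix v :: "nat \<Rightarrow> 'a" assume v: "(\<Sum>j<n. (norm (v j))\<^sup>2) \<le> 1"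
  define w where "w m i = (\<Sum>j<n. (partial UNIV m o\<^sub>L (x i j o\<^sub>L partial UNIV m)) (v j))" for m i
  show "(\<Sum>i<n. (norm (\<Sum>j<n. x i j (v j)))\<^sup>2) \<le> B\<^sup>2"
  proof (rule LIMSEQ_le_const2)
    show "(\<lambda>m. \<Sum>i<n. (norm (w m i))\<^sup>2) \<longlonglongrightarrow> (\<Sum>i<n. (norm (\<Sum>j<n. x i j (v j)))\<^sup>2)"
      unfolding w_def
      by (intro tendsto_sum tendsto_power tendsto_norm blinfun.tendsto tendsto_const corner_two_sided x)
        auto
    have "(\<Sum>i<n. (norm (w m i))\<^sup>2) \<le> B\<^sup>2" for m
    proof -
      define P where "P k = partial (linked_class k) m" for k
      define y where "y k i = (\<Sum>j<n. cut (linked_class k) (x i j) (P k (v j)))" for k i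
      \<comment> \<open>The component of the compressed image in class \<open>k\<close> depends only
        on the components of the \<open>v j\<close> in that class.\<close>
      have P_w: "P k (w m i) = P k (y k i)" if "i < n" for i k
      proof -
        have "P k o\<^sub>L (partial UNIV m o\<^sub>L (x i j o\<^sub>L partial UNIV m)) =
            P k o\<^sub>L (cut (linked_class k) (x i j) o\<^sub>L P k)" if "j < n" for j
        proof -
          have xA: "x i j \<in> A"
            using x[OF \<open>i < n\<close> that] by (simp add: corner_def)
          have "P k o\<^sub>L (partial UNIV m o\<^sub>L (x i j o\<^sub>L partial UNIV m)) =
              P k o\<^sub>L (x i j o\<^sub>L partial UNIV m)"
            by (simp add: P_def partial_compose flip: compose_assoc)
          also have "\<dots> = P k o\<^sub>L (x i j o\<^sub>L P k)"
            unfolding P_def by (rule partial_class_right[OF xA])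
          also have "\<dots> = P k o\<^sub>L (cut (linked_class k) (x i j) o\<^sub>L P k)"
            unfolding P_def using partial_cut[OF x[OF \<open>i < n\<close> that]] by (simp flip: compose_assoc)
          finally show ?thesis .
        qed
        then have "P k ((partial UNIV m o\<^sub>L (x i j o\<^sub>L partial UNIV m)) (v j)) =
            P k (cut (linked_class k) (x i j) (P k (v j)))" if "j < n" for j
          using that by (metis blinfun_apply_blinfun_compose)
        then show ?thesis
          by (simp add: w_def y_def blinfun.sum_right)
      qed
      have fix_w: "partial UNIV m (w m i) = w m i" for i
        by (simp add: w_def blinfun.sum_right s_apply)
      have "(\<Sum>i<n. (norm (w m i))\<^sup>2) = (\<Sum>i<n. \<Sum>k<m. (norm (P k (w m i)))\<^sup>2)"
        using partial_class_norm[of m "w m i" for i] by (simp add: fix_w P_def)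
      also have "\<dots> = (\<Sum>i<n. \<Sum>k<m. (norm (P k (y k i)))\<^sup>2)"
        by (simp add: P_w)
      also have "\<dots> \<le> (\<Sum>i<n. \<Sum>k<m. (norm (y k i))\<^sup>2)"
        unfolding P_def by (intro sum_mono power_mono projection_apply_le partial_projection) auto
      also have "\<dots> = (\<Sum>k<m. \<Sum>i<n. (norm (y k i))\<^sup>2)"
        by (rule sum.swap)
      \<comment> \<open>Each block is estimated on its own part of \<open>v\<close>. These parts are
        orthogonal, so their squared norms sum to at most that of \<open>v\<close> and the constant
        remains \<open>B\<close>, independent of the number of blocks.\<close>
      also have "\<dots> \<le> (\<Sum>k<m. B\<^sup>2 * (\<Sum>j<n. (norm (P k (v j)))\<^sup>2))"
      proof (rule sum_mono)
        fix k
        have "(\<Sum>i<n. (norm (y k i))\<^sup>2) \<le>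
            (mat_norm n (\<lambda>i j. cut (linked_class k) (x i j)))\<^sup>2 * (\<Sum>j<n. (norm (P k (v j)))\<^sup>2)"
          unfolding y_def by (rule mat_norm_bound)
        also have "\<dots> \<le> B\<^sup>2 * (\<Sum>j<n. (norm (P k (v j)))\<^sup>2)"
          by (intro mult_right_mono power_mono bound mat_norm_nonneg sum_nonneg) auto
        finally show "(\<Sum>i<n. (norm (y k i))\<^sup>2) \<le> B\<^sup>2 * (\<Sum>j<n. (norm (P k (v j)))\<^sup>2)" .
      qed
      also have "\<dots> = B\<^sup>2 * (\<Sum>j<n. \<Sum>k<m. (norm (P k (v j)))\<^sup>2)"
        by (simp add: sum_distrib_left sum.swap[of _ "{..<m}"])
      also have "\<dots> = B\<^sup>2 * (\<Sum>j<n. (norm (partial UNIV m (v j)))\<^sup>2)"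
        by (simp add: partial_class_norm P_def)
      also have "\<dots> \<le> B\<^sup>2 * (\<Sum>j<n. (norm (v j))\<^sup>2)"
        by (intro mult_left_mono sum_mono power_mono projection_apply_le partial_projection) auto
      also have "\<dots> \<le> B\<^sup>2"
        using v by (simp add: mult_left_le)
      finally show ?thesis .
    qed
    then show "\<exists>N. \<forall>m\<ge>N. (\<Sum>i<n. (norm (w m i))\<^sup>2) \<le> B\<^sup>2"
      by blast
  qed
qed

lemma c0_mat_norm_cut:
  assumes x: "\<And>i j. i < n \<Longrightarrow> j < n \<Longrightarrow> x i j \<in> corner"
  shows "c0_mat_norm n (\<lambda>i j k. cut (linked_class k) (x i j)) = mat_norm n x"
  unfolding c0_mat_norm_def
proof (rule antisym)
  let ?f = "\<lambda>k. mat_norm n (\<lambda>i j. cut (linked_class k) (x i j))"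
  show "(SUP k. ?f k) \<le> mat_norm n x"
    by (intro cSUP_least mat_norm_cut_le x) auto
  have bdd: "bdd_above (range ?f)"
    by (rule bdd_aboveI2[where M = "mat_norm n x"]) (rule mat_norm_cut_le[OF x])
  then have le: "?f k \<le> (SUP k. ?f k)" for k
    by (rule cSUP_upper[OF UNIV_I])
  show "mat_norm n x \<le> (SUP k. ?f k)"
    using mat_norm_le_cut[OF x _ le] order_trans[OF mat_norm_nonneg le] by blast
qed

lemma norm_le_cut:
  assumes "y \<in> corner" "B \<ge> 0" "\<And>k. norm (cut (linked_class k) y) \<le> B"
  shows "norm y \<le> B"
  using mat_norm_le_cut[of 1 "\<lambda>i j. y" B] assms mat_norm_one by metis

lemma sigma_matricial_corner: "sigma_matricial corner"
proof -
  obtain T where *: "\<forall>k. \<forall>i\<in>linked_class k. T i i = q i \<and> (\<forall>j\<in>linked_class k.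
    T i j \<in> A \<and> T i j \<noteq> 0 \<and> q i o\<^sub>L T i j = T i j \<and> T i j o\<^sub>L q j = T i j \<and>
    (\<forall>a\<in>A. \<exists>c. q i o\<^sub>L (a o\<^sub>L q j) = op_scaleC c (T i j)) \<and>
    (\<forall>l\<in>linked_class k. T i j o\<^sub>L T j l = T i l))"
    using exists_matrix_units ..
  have T: "T i j \<in> A" "T i j \<noteq> 0" "q i o\<^sub>L T i j = T i j" "T i j o\<^sub>L q j = T i j"
    and T_corner: "\<And>a. a \<in> A \<Longrightarrow> \<exists>c. q i o\<^sub>L (a o\<^sub>L q j) = op_scaleC c (T i j)"
    and T_mult: "\<And>l. l \<in> linked_class k \<Longrightarrow> T i j o\<^sub>L T j l = T i l"
    if "i \<in> linked_class k" "j \<in> linked_class k" for i j k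
    using * that by blast+
  have T_diag: "T i i = q i" if "i \<in> linked_class k" for i k
    using * that by blast
  \<comment> \<open>Numbers that label no class are dropped, because a 1-matricial algebra needs a
    non-empty index set.\<close>
  define K where "K = {k. linked_class k \<noteq> {}}"
  define G where "G k = {T i j |i j. i \<in> linked_class k \<and> j \<in> linked_class k}" for k
  define M where "M k = closure (op_cspan (G k))" for k
  define \<theta> where "\<theta> x k = cut (linked_class k) x" for x k
  note corner_alg = operator_algebra_corner
  have T_fixed: "partial S n o\<^sub>L T i j = (if i < n \<and> i \<in> S then T i j else 0)"
    "T i j o\<^sub>L partial S n = (if j < n \<and> j \<in> S then T i j else 0)"
    if "i \<in> linked_class k" "j \<in> linked_class k" for i j k n S
  proof -
    have "partial S n o\<^sub>L T i j = (partial S n o\<^sub>L q i) o\<^sub>L T i j"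
      "T i j o\<^sub>L partial S n = T i j o\<^sub>L (q j o\<^sub>L partial S n)"
      using T[OF that] by (simp add: compose_assoc, simp flip: compose_assoc)
    then show "partial S n o\<^sub>L T i j = (if i < n \<and> i \<in> S then T i j else 0)"
      "T i j o\<^sub>L partial S n = (if j < n \<and> j \<in> S then T i j else 0)"
      using T[OF that] by (simp_all add: partial_q q_partial)
  qed
  have T_mem: "T i j \<in> corner" if "i \<in> linked_class k" "j \<in> linked_class k" for i j k
    using T[OF that] by (auto simp: corner_def T_fixed[OF that] intro!: tendsto_eventually eventually_sequentiallyI[of "Suc (max i j)"])
  have G_corner: "G k \<subseteq> corner" for k
    using T_mem by (auto simp: G_def)
  have M_corner: "M k \<subseteq> corner" for k
    unfolding M_def
    by (intro closed_span_subset operator_algebra_csubspace operator_algebra_closed corner_alg G_corner)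
  have M_sub: "op_csubspace (M k)" for k
    unfolding M_def by (intro csubspace_closure ops.subspace_span)
  have G_M: "G k \<subseteq> op_cspan (G k)" "op_cspan (G k) \<subseteq> M k" for k
    unfolding M_def by (auto intro: ops.span_base closure_subset[THEN subsetD])
  have units: "matrix_units (linked_class k) T" for k
    unfolding matrix_units_def
  proof (intro conjI ballI)
    fix i j l m assume *: "i \<in> linked_class k" "j \<in> linked_class k" "l \<in> linked_class k" "m \<in> linked_class k"
    have "T i j o\<^sub>L T l m = 0" if "j \<noteq> l"
    proof -
      have "T i j o\<^sub>L T l m = (T i j o\<^sub>L q j) o\<^sub>L (q l o\<^sub>L T l m)"
        using T * by simp
      also have "\<dots> = T i j o\<^sub>L ((q j o\<^sub>L q l) o\<^sub>L T l m)"
        by (simp only: compose_assoc)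
      finally show ?thesis
        by (simp add: ortho[OF that])
    qed
    then show "T i j o\<^sub>L T l m = (if j = l then T i m else 0)"
      using T_mult * by auto
  qed (use T in blast)
  have M_alg: "operator_algebra (M k)" for k
    unfolding M_def
  proof (rule operator_algebra_closed_span[OF corner_alg G_corner])
    fix a b assume "a \<in> G k" "b \<in> G k"
    then obtain i j l m where *: "i \<in> linked_class k" "j \<in> linked_class k" "l \<in> linked_class k"
      "m \<in> linked_class k" "a = T i j" "b = T l m"
      by (auto simp: G_def)
    then have "a o\<^sub>L b = (if j = l then T i m else 0)"
      using units unfolding matrix_units_def by blast
    moreover have "T i m \<in> G k"
      using * by (auto simp: G_def)
    ultimately show "a o\<^sub>L b \<in> op_cspan (G k)"
      by (simp add: ops.span_base ops.span_zero)
  qed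
  have "separable_one_matricial (M k)" if k: "k \<in> K" for k
    unfolding separable_one_matricial_def
  proof (intro conjI exI)
    show "M k = closure (op_cspan {T i j |i j. i \<in> linked_class k \<and> j \<in> linked_class k})"
      by (simp add: M_def G_def)
    show "\<forall>i\<in>linked_class k. norm (T i i) = 1"
      using T T_diag by (metis norm_projection_eq_1 q_projection)
  qed (use k M_alg units in \<open>auto simp: K_def\<close>)
  moreover have "completely_isometric_iso_c0 corner K M \<theta>"
  proof -
    have cut_mem: "\<theta> x k \<in> M k" if x: "x \<in> corner" for x k
    proof -
      have xA: "x \<in> A" and lim: "(\<lambda>n. x o\<^sub>L partial UNIV n) \<longlonglongrightarrow> x"
        using x by (auto simp: corner_def)
      have closed: "closed (M k)"
        by (simp add: M_def)
      \<comment> \<open>The finite compressions are finite sums of entries \<open>q i x q j\<close>,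
        each a multiple of \<open>T i j\<close>. Closedness of \<open>M k\<close> then allows first
        \<open>n\<close> and then \<open>m\<close> to tend to infinity.\<close>
      have "partial (linked_class k) m o\<^sub>L (x o\<^sub>L partial UNIV n) \<in> M k" for m n
        unfolding partial_class_right[OF xA] unfolding partial_compose_partial_sum
      proof (intro ops.subspace_sum M_sub)
        fix i j assume "i \<in> {..<m} \<inter> linked_class k" "j \<in> {..<n} \<inter> linked_class k"
        then have ij: "i \<in> linked_class k" "j \<in> linked_class k" by auto
        then have "T i j \<in> M k"
          using G_M by (auto simp: G_def)
        then show "q i o\<^sub>L (x o\<^sub>L q j) \<in> M k"
          using T_corner[OF ij xA] ops.subspace_scale[OF M_sub] by auto
      qed
      then have "partial (linked_class k) m o\<^sub>L x \<in> M k" for m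
        by (rule closed_sequentially[OF closed _ tendsto_compose_op[OF tendsto_const lim]])
      then show ?thesis
        unfolding \<theta>_def by (rule closed_sequentially[OF closed _ cut_tendsto[OF x]])
    qed
    have cut_M: "\<theta> x l = (if l = k then x else 0)" if x: "x \<in> M k" for x k l
    proof -
      \<comment> \<open>The asserted identity defines a closed subspace, so it suffices to check it
        on the matrix units that generate \<open>M k\<close>.\<close>
      define V where "V = {x \<in> corner. cut (linked_class l) x = (if l = k then x else 0)}"
      have "op_csubspace V"
        unfolding V_def by (rule ops.subspaceI)
          (auto simp: cut_add cut_scaleC cut_zero operator_algebra_intros[OF corner_alg])
      moreover have "closed V"
        unfolding closed_sequential_limits
      proof (intro allI impI)
        fix f y assume f: "(\<forall>n. f n \<in> V) \<and> f \<longlonglongrightarrow> y"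
        then have y: "y \<in> corner"
          using closed_sequentially[OF operator_algebra_closed[OF corner_alg], of f y] by (auto simp: V_def)
        have "(\<lambda>n. cut (linked_class l) (f n)) \<longlonglongrightarrow> cut (linked_class l) y"
          using f y by (intro cut_tendsto_cut) (auto simp: V_def)
        moreover have "(\<lambda>n. cut (linked_class l) (f n)) \<longlonglongrightarrow> (if l = k then y else 0)"
          using f by (auto simp: V_def)
        ultimately show "y \<in> V"
          using y LIMSEQ_unique by (fastforce simp: V_def)
      qed
      moreover have "G k \<subseteq> V"
      proof
        fix z assume "z \<in> G k"
        then obtain i j where ij: "i \<in> linked_class k" "j \<in> linked_class k" and z: "z = T i j"
          by (auto simp: G_def)
        have "i \<in> linked_class l \<longleftrightarrow> l = k"
          using ij(1) linked_class_disjoint[of k l] by auto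
        then have "(\<lambda>n. partial (linked_class l) n o\<^sub>L z) \<longlonglongrightarrow> (if l = k then z else 0)"
          unfolding z T_fixed[OF ij]
          by (auto intro!: tendsto_eventually eventually_sequentiallyI[of "Suc i"])
        then show "z \<in> V"
          using T_mem[OF ij] cut_tendsto[of z "linked_class l"] LIMSEQ_unique
          by (auto simp: V_def z)
      qed
      ultimately have "M k \<subseteq> V"
        unfolding M_def by (rule closed_span_subset)
      then show ?thesis
        using x by (auto simp: V_def \<theta>_def)
    qed
    have \<theta>_c0: "\<theta> x \<in> c0_sum K M" if x: "x \<in> corner" for x
      unfolding c0_sum_def
    proof (intro CollectI conjI ballI allI impI)
      show "\<theta> x k = 0" if "k \<notin> K" for k
        using that by (simp add: K_def \<theta>_def cut_def)
      have "(\<lambda>n. partial UNIV n o\<^sub>L x) \<longlonglongrightarrow> x"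
        using x by (simp add: corner_def)
      then have "(\<lambda>N. norm (x - (partial UNIV N o\<^sub>L x))) \<longlonglongrightarrow> norm (x - x)"
        by (intro tendsto_norm tendsto_diff tendsto_const)
      then have tail: "(\<lambda>N. norm (x - (partial UNIV N o\<^sub>L x))) \<longlonglongrightarrow> 0"
        by simp
      \<comment> \<open>Class \<open>k\<close> contains no index below \<open>k\<close>, so the
        block is bounded by the remainder of \<open>x\<close> at \<open>k\<close>.\<close>
      have "\<forall>k. norm (\<theta> x k) \<le> norm (x - (partial UNIV k o\<^sub>L x))"
        unfolding \<theta>_def by (intro allI norm_cut_tail_le x) (auto dest: linked_class_le)
      then show "\<theta> x \<longlonglongrightarrow> 0"
        by (rule Lim_null_comparison[OF always_eventually tail])
    qed (rule cut_mem[OF x])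
    have inj: "x = y" if "x \<in> corner" "y \<in> corner" "\<theta> x = \<theta> y" for x y
    proof -
      have "cut (linked_class k) x = cut (linked_class k) y" for k
        using fun_cong[OF that(3), of k] by (simp add: \<theta>_def)
      then have le: "norm (cut (linked_class k) (x - y)) \<le> 0" for k
        using that by (simp add: cut_diff)
      have "norm (x - y) \<le> 0"
        by (rule norm_le_cut[OF operator_algebra_diff[OF corner_alg that(1,2)] order_refl le])
      then show ?thesis by simp
    qed
    have surj: "\<exists>x\<in>corner. a = \<theta> x" if a: "a \<in> c0_sum K M" for a
    proof -
      have a_M: "a k \<in> M k" for k
        using a ops.subspace_0[OF M_sub] by (cases "k \<in> K") (auto simp: c0_sum_def)
      have a_corner: "a k \<in> corner" for k
        using a_M M_corner by blast
      define y where "y N = (\<Sum>k<N. a k)" for N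
      have y: "y N \<in> corner" for N
        unfolding y_def by (intro ops.subspace_sum operator_algebra_csubspace corner_alg a_corner)
      have \<theta>_y: "\<theta> (y N) l = (if l < N then a l else 0)" for N l
        using cut_M[OF a_M] by (simp add: y_def \<theta>_def cut_sum a_corner)
      \<comment> \<open>The norm in the corner is bounded by the supremum over the blocks. The
        blocks of \<open>y m - y n\<close> are single terms \<open>a l\<close> or \<open>0\<close>,
        so \<open>a \<longlonglongrightarrow> 0\<close> is enough and no summability of the norms is
        required.\<close>
      have "Cauchy y"
      proof (rule CauchyI)
        fix e :: real assume e: "e > 0"
        have "a \<longlonglongrightarrow> 0" using a by (simp add: c0_sum_def)
        then obtain N where N: "\<And>k. k \<ge> N \<Longrightarrow> norm (a k) < e / 2"
          using LIMSEQ_D[of a 0 "e / 2"] e by auto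
        have "norm (y m - y n) < e" if "m \<ge> N" "n \<ge> N" for m n
        proof -
          have "norm (cut (linked_class l) (y m - y n)) \<le> e / 2" for l
          proof -
            have "cut (linked_class l) (y m - y n) = \<theta> (y m) l - \<theta> (y n) l"
              by (simp add: \<theta>_def cut_diff y)
            then show ?thesis
              using N[of l] that e by (auto simp: \<theta>_y)
          qed
          then have "norm (y m - y n) \<le> e / 2"
            using e by (intro norm_le_cut[OF operator_algebra_diff[OF corner_alg y y]]) simp_all
          with e show ?thesis by simp
        qed
        then show "\<exists>N. \<forall>m\<ge>N. \<forall>n\<ge>N. norm (y m - y n) < e"
          by blast
      qed
      then obtain x where x: "y \<longlonglongrightarrow> x"
        using Cauchy_convergent_iff convergentD by blast
      then have xc: "x \<in> corner"
        by (rule closed_sequentially[OF operator_algebra_closed[OF corner_alg] y])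
      have "\<theta> x l = a l" for l
      proof (rule LIMSEQ_unique)
        show "(\<lambda>N. \<theta> (y N) l) \<longlonglongrightarrow> \<theta> x l"
          unfolding \<theta>_def by (intro cut_tendsto_cut y xc x)
        show "(\<lambda>N. \<theta> (y N) l) \<longlonglongrightarrow> a l"
          unfolding \<theta>_y by (auto intro!: tendsto_eventually eventually_sequentiallyI[of "Suc l"])
      qed
      then have "a = \<theta> x"
        by (simp add: fun_eq_iff)
      then show ?thesis
        using xc by blast
    qed
    show ?thesis
      unfolding completely_isometric_iso_c0_def
    proof (intro conjI)
      show "bij_betw \<theta> corner (c0_sum K M)"
        unfolding bij_betw_def inj_on_def using inj surj \<theta>_c0 by blast
      have "\<theta> = (\<lambda>x k. cut (linked_class k) x)"
        by (simp add: \<theta>_def fun_eq_iff)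
      then show "\<forall>n x. (\<forall>i<n. \<forall>j<n. x i j \<in> corner) \<longrightarrow>
          c0_mat_norm n (\<lambda>i j. \<theta> (x i j)) = mat_norm n x"
        using c0_mat_norm_cut by simp
    qed (auto simp: \<theta>_def cut_add cut_scaleC cut_class_compose fun_eq_iff)
  qed
  ultimately show ?thesis
    unfolding sigma_matricial_def using corner_alg by blast
qed

end

theorem theorem4p24:
  fixes A :: "'h::complex_hilbert endo set"
  assumes "operator_algebra A"
    and "separable_space (top_of_set A)"
    and "semiprime A"
  shows "sigma_matricial (h_soc A)"
proof -
  obtain q :: "nat \<Rightarrow> 'h endo" where q: "\<And>i. alg_minimal A (q i)" "\<And>i j. i \<noteq> j \<Longrightarrow> q i o\<^sub>L q j = 0"
    and dense: "\<And>e \<epsilon>. alg_minimal A e \<Longrightarrow> \<epsilon> > 0 \<Longrightarrow>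
      \<exists>f n. norm (f - e) < \<epsilon> \<and> (\<Sum>i<n. q i) o\<^sub>L f = f"
    by (rule exists_minimal_sequence[OF assms(1,2)]) blast
  interpret semiprime_minimal_sequence A q
    by standard (use assms q in auto)
  show ?thesis
    using h_soc_corner[OF assms(2) dense] sigma_matricial_corner by simp
qed

end
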